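(* Let $\mu=(m,n-m)$ be a partition of $n$, and let $R,S,T$ be finite multisets of positive integers with $|R|+|S|+|T|=n$ and $|S|>m$. Let $\mathcal{S}$ be the set of all pairs $(U,V)$ of multisets such that $S=U\sqcup V$ and $|U|=m-|R|$. For each $(U,V)\in\mathcal{S}$, let $A[U,V]$ denote the row-standard $\mu$-tableau whose first row has multiset of entries $A[U,V]^1=R\sqcup U$ and whose second row has multiset of entries $A[U,V]^2=T\sqcup V$. Then $$\sum_{(U,V)\in\mathcal{S}}\ \prod_{i}\genfrac{[}{]}{0pt}{}{R_i+U_i}{R_i}\genfrac{[}{]}{0pt}{}{T_i+V_i}{T_i}\ \prod_{i<j}q^{R_jU_i+T_iV_j}\ \hat\phi_{A[U,V]}=0,$$ an identity of homomorphisms $S^\mu\to M^\lambda$, where $\lambda$ is the common type of the tableaux $A[U,V]$, i.e. $\lambda_i=R_i+S_i+T_i$.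
   Context: $\mathbb F$ is an arbitrary field and $q\in\mathbb F$ is a fixed non-zero element. $\mathfrak S_n$ is the symmetric group on $\{1,\dots,n\}$, acting on the right (in a product $uv$, $u$ is applied first), with Coxeter length function $l$ and simple transpositions $s_i=(i\ i{+}1)$. $\mathcal H_n$ is the unital associative $\mathbb F$-algebra with generators $T_1,\dots,T_{n-1}$ and relations $(T_i-q)(T_i+1)=0$, $T_iT_j=T_jT_i$ for $i\le j-2$, and $T_iT_{i+1}T_i=T_{i+1}T_iT_{i+1}$. For $w\in\mathfrak S_n$ with reduced expression $w=s_{i_1}\cdots s_{i_k}$, put $T_w=T_{i_1}\cdots T_{i_k}$. Modules are right modules and maps are written on the right. A composition of $n$ is a sequence of non-negative integers (zeros allowed, trailing zeros ignored) with sum $n$; a partition is a weakly decreasing composition; $\mu'$ is the conjugate of a partition $\mu$. For a composition $\lambda$ of $n$, $W_\lambda\le\mathfrak S_n$ is the standard Young subgroup, $x_\lambda=\sum_{w\in W_\lambda}T_w$, $y_\lambda=\sum_{w\in W_\lambda}(-q)^{-l(w)}T_w$ and $M^\lambda=x_\lambda\mathcal H_n$. $\mathfrak t^\lambda$ is the $\lambda$-tableau with $1,\dots,n$ in order along successive rows; for a partition $\mu$, $\mathfrak t_\mu$ is the $\mu$-tableau with $1,\dots,n$ in order down successive columns, $w_\mu$ is the permutation with $\mathfrak t^\mu w_\mu=\mathfrak t_\mu$ (permutations act on entries), and $S^\mu=x_\mu T_{w_\mu}y_{\mu'}\mathcal H_n\subseteq M^\mu$ is the Specht module. For compositions $\mu,\lambda$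 of $n$, a $\mu$-tableau of type $\lambda$ is a filling of the Young diagram of $\mu$ with positive integers in which each $i$ occurs $\lambda_i$ times; it is row-standard if entries weakly increase along rows. $A^g$ denotes the multiset of entries in row $g$ of $A$. For a row-standard $\mu$-tableau $A$ of type $\lambda$, $1_A\in\mathfrak S_n$ is the permutation such that $\mathfrak t^\lambda1_A$ is the $\lambda$-tableau with entries $1,\dots,n$, increasing along rows, in which $i$ lies in row $r$ if the position occupied by $i$ in $\mathfrak t^\mu$ is occupied by $r$ in $A$. The homomorphism $\phi_A:M^\mu\to M^\lambda$ of $\mathcal H_n$-modules is given by $x_\mu\phi_A=\sum_{w\in W_\lambda1_AW_\mu}T_w$. If $\mu$ is a partition, $\hat\phi_A$ is the restriction of $\phi_A$ to $S^\mu$. For a multiset $C$ of positive integers, $C_i$ is the number of $i$s in $C$; $C\sqcup D$ is the multiset with $(C\sqcup D)_i=C_i+D_i$. Put $[k]=1+q+\dots+q^{k-1}$, $[k]!=\prod_{i=1}^k[i]$; for $a\ge b\ge0$, $\genfrac{[}{]}{0pt}{}{a}{b}$ is the quantum binomial coefficient $\frac{[a]!}{[b]![a-b]!}$, which is a polynomial when $q$ is an indeterminate, specialised to the given $q\in\mathbb F$. Products run over all positive integers $i$ (respectively pairs $i<j$). *)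

theory Defs
  imports
    "HOL-Algebra.QuotRing"
    "HOL-Combinatorics.Permutations"
    "HOL-Computational_Algebra.Polynomial"
    "HOL-Library.Multiset"
    "HOL-Library.Poly_Mapping"
begin

section \<open>The symmetric group\<close>

text \<open>
  Elements of the symmetric group are functions \<open>w\<close> with \<open>w permutes {1..n}\<close>. The group acts on the
  right, so the product \<open>uv\<close> (first \<open>u\<close>, then \<open>v\<close>) is the function \<open>v \<circ> u\<close>.
\<close>

definition simple_transp :: "nat \<Rightarrow> nat \<Rightarrow> nat" where
  "simple_transp i = transpose i (Suc i)"

fun word_perm :: "nat list \<Rightarrow> nat \<Rightarrow> nat" where
  "word_perm [] = id"
| "word_perm (i # is) = word_perm is \<circ> simple_transp i"

definition coxeter_length :: "nat \<Rightarrow> (nat \<Rightarrow> nat) \<Rightarrow> nat" where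
  "coxeter_length n w =
     (LEAST k. \<exists>is. set is \<subseteq> {1..<n} \<and> word_perm is = w \<and> length is = k)"

definition reduced_expression :: "nat \<Rightarrow> (nat \<Rightarrow> nat) \<Rightarrow> nat list \<Rightarrow> bool" where
  "reduced_expression n w is \<longleftrightarrow>
     set is \<subseteq> {1..<n} \<and> word_perm is = w \<and> length is = coxeter_length n w"


section \<open>The Hecke algebra, by generators and relations\<close>

text \<open>
  Words in the generators form the free monoid, written additively because
  \<^typ>\<open>'k \<Rightarrow>\<^sub>0 'a\<close> is the monoid algebra over an additively written monoid of keys.
\<close>

datatype gen_word = Gen_Word (letters: "nat list")

instantiation gen_word :: monoid_add
begin

definition zero_gen_word :: gen_word where "0 = Gen_Word []"

definition plus_gen_word :: "gen_word \<Rightarrow> gen_word \<Rightarrow> gen_word" where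
  "u + v = Gen_Word (letters u @ letters v)"

instance
  by standard (simp_all add: zero_gen_word_def plus_gen_word_def)

end

definition free_algebra :: "nat \<Rightarrow> (gen_word \<Rightarrow>\<^sub>0 'a::field) ring" where
  "free_algebra n =
     \<lparr>carrier = {f. \<forall>w\<in>Poly_Mapping.keys f. set (letters w) \<subseteq> {1..<n}},
      monoid.mult = (*), one = 1, zero = 0, add = (+)\<rparr>"

abbreviation free_gen :: "nat \<Rightarrow> gen_word \<Rightarrow>\<^sub>0 'a::field" where
  "free_gen i \<equiv> Poly_Mapping.single (Gen_Word [i]) 1"

abbreviation free_scalar :: "'a::field \<Rightarrow> gen_word \<Rightarrow>\<^sub>0 'a" where
  "free_scalar c \<equiv> Poly_Mapping.single 0 c"

definition hecke_relators :: "nat \<Rightarrow> 'a::field \<Rightarrow> (gen_word \<Rightarrow>\<^sub>0 'a) set" where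
  "hecke_relators n q =
     {(free_gen i - free_scalar q) * (free_gen i + 1) | i. 1 \<le> i \<and> i < n}
   \<union> {free_gen i * free_gen j - free_gen j * free_gen i | i j. 1 \<le> i \<and> i + 2 \<le> j \<and> j < n}
   \<union> {free_gen i * free_gen (i+1) * free_gen i - free_gen (i+1) * free_gen i * free_gen (i+1)
       | i. 1 \<le> i \<and> i + 1 < n}"

definition hecke_ideal :: "nat \<Rightarrow> 'a::field \<Rightarrow> (gen_word \<Rightarrow>\<^sub>0 'a) set" where
  "hecke_ideal n q = Idl\<^bsub>free_algebra n\<^esub> (hecke_relators n q)"

type_synonym 'a hecke_elem = "(gen_word \<Rightarrow>\<^sub>0 'a) set"

definition hecke :: "nat \<Rightarrow> 'a::field \<Rightarrow> 'a hecke_elem ring" where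
  "hecke n q = free_algebra n Quot hecke_ideal n q"

definition hecke_gen :: "nat \<Rightarrow> 'a::field \<Rightarrow> nat \<Rightarrow> 'a hecke_elem" where
  "hecke_gen n q i = hecke_ideal n q +>\<^bsub>free_algebra n\<^esub> free_gen i"

definition hecke_smult :: "nat \<Rightarrow> 'a::field \<Rightarrow> 'a \<Rightarrow> 'a hecke_elem \<Rightarrow> 'a hecke_elem" where
  "hecke_smult n q c h =
     (hecke_ideal n q +>\<^bsub>free_algebra n\<^esub> free_scalar c) \<otimes>\<^bsub>hecke n q\<^esub> h"

definition hecke_word :: "nat \<Rightarrow> 'a::field \<Rightarrow> nat list \<Rightarrow> 'a hecke_elem" where
  "hecke_word n q is =
     foldr (\<lambda>i h. hecke_gen n q i \<otimes>\<^bsub>hecke n q\<^esub> h) is \<one>\<^bsub>hecke n q\<^esub>"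

text \<open>By Matsumoto's theorem \<open>T\<^sub>w\<close> does not depend on the chosen reduced expression.\<close>

definition hecke_T :: "nat \<Rightarrow> 'a::field \<Rightarrow> (nat \<Rightarrow> nat) \<Rightarrow> 'a hecke_elem" where
  "hecke_T n q w = hecke_word n q (SOME is. reduced_expression n w is)"

lemma ring_free_algebra: "ring (free_algebra n :: (gen_word \<Rightarrow>\<^sub>0 'a::field) ring)"
proof (rule ringI)
  let ?F = "free_algebra n :: (gen_word \<Rightarrow>\<^sub>0 'a) ring"
  have add: "f + g \<in> carrier ?F" if "f \<in> carrier ?F" "g \<in> carrier ?F" for f g
    using that Poly_Mapping.keys_add[of f g] by (auto simp: free_algebra_def)
  have mult: "f * g \<in> carrier ?F" if "f \<in> carrier ?F" "g \<in> carrier ?F" for f g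
  proof -
    have "set (letters w) \<subseteq> {1..<n}" if "w \<in> Poly_Mapping.keys (f * g)" for w
    proof -
      obtain u v where uv: "w = u + v" "u \<in> Poly_Mapping.keys f" "v \<in> Poly_Mapping.keys g"
        using \<open>w \<in> Poly_Mapping.keys (f * g)\<close> Poly_Mapping.keys_mult[of f g] by auto
      then show ?thesis
        using \<open>f \<in> carrier ?F\<close> \<open>g \<in> carrier ?F\<close>
        by (auto simp: free_algebra_def plus_gen_word_def)
    qed
    then show ?thesis by (simp add: free_algebra_def)
  qed
  show "abelian_group ?F"
  proof (rule abelian_groupI)
    fix f assume "f \<in> carrier ?F"
    then have "- f \<in> carrier ?F" by (simp add: free_algebra_def)
    then show "\<exists>g\<in>carrier ?F. g \<oplus>\<^bsub>?F\<^esub> f = \<zero>\<^bsub>?F\<^esub>"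
      by (intro bexI[of _ "- f"]) (auto simp: free_algebra_def)
  next
    show "f \<oplus>\<^bsub>?F\<^esub> g \<in> carrier ?F" if "f \<in> carrier ?F" "g \<in> carrier ?F" for f g
      using add[OF that] by (simp add: free_algebra_def)
  qed (simp_all add: free_algebra_def ac_simps)
  show "Group.monoid ?F"
  proof (rule monoidI)
    show "f \<otimes>\<^bsub>?F\<^esub> g \<in> carrier ?F" if "f \<in> carrier ?F" "g \<in> carrier ?F" for f g
      using mult[OF that] by (simp add: free_algebra_def)
    have "Poly_Mapping.keys (1 :: gen_word \<Rightarrow>\<^sub>0 'a) = {0}"
      by (metis keys_one)
    then show "\<one>\<^bsub>?F\<^esub> \<in> carrier ?F"
      by (simp add: free_algebra_def zero_gen_word_def)
  qed (simp_all add: free_algebra_def mult.assoc)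
qed (simp_all add: free_algebra_def distrib_left distrib_right)

lemma hecke_relators_carrier: "hecke_relators n q \<subseteq> carrier (free_algebra n)"
proof -
  interpret ring "free_algebra n :: (gen_word \<Rightarrow>\<^sub>0 'a::field) ring" by (rule ring_free_algebra)
  let ?F = "free_algebra n :: (gen_word \<Rightarrow>\<^sub>0 'a::field) ring"
  have gen: "free_gen i \<in> carrier ?F" if "1 \<le> i" "i < n" for i
    using that by (simp add: free_algebra_def)
  have scalar: "free_scalar c \<in> carrier ?F" for c
    by (simp add: free_algebra_def zero_gen_word_def)
  have add: "f + g \<in> carrier ?F" if "f \<in> carrier ?F" "g \<in> carrier ?F" for f g
    using add.m_closed[OF that] by (simp add: free_algebra_def)
  have mult: "f * g \<in> carrier ?F" if "f \<in> carrier ?F" "g \<in> carrier ?F" for f g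
    using m_closed[OF that] by (simp add: free_algebra_def)
  have diff: "f - g \<in> carrier ?F" if "f \<in> carrier ?F" "g \<in> carrier ?F" for f g
  proof -
    have "- g \<in> carrier ?F" using that(2) by (simp add: free_algebra_def)
    from add[OF that(1) this] show ?thesis by simp
  qed
  have "1 \<in> carrier ?F" using scalar[of 1] by simp
  then have
    "(free_gen i - free_scalar q) * (free_gen i + 1) \<in> carrier ?F" if "1 \<le> i" "i < n" for i
    using that by (intro mult diff add gen scalar)
  moreover have "free_gen i * free_gen j - free_gen j * free_gen i \<in> carrier ?F"
    if "1 \<le> i" "i + 2 \<le> j" "j < n" for i j
  proof -
    have "free_gen i \<in> carrier ?F" "free_gen j \<in> carrier ?F"
      using that by (auto intro: gen)
    then show ?thesis by (intro mult diff)
  qed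
  moreover have "free_gen i * free_gen (i+1) * free_gen i
      - free_gen (i+1) * free_gen i * free_gen (i+1) \<in> carrier ?F"
    if "1 \<le> i" "i + 1 < n" for i
  proof -
    have "free_gen i \<in> carrier ?F" "free_gen (i+1) \<in> carrier ?F"
      using that by (auto intro: gen)
    then show ?thesis by (intro mult diff)
  qed
  ultimately show ?thesis
    unfolding hecke_relators_def by blast
qed

lemma ring_hecke: "ring (hecke n q)"
  unfolding hecke_def hecke_ideal_def
  by (intro ideal.quotient_is_ring ring.genideal_ideal ring_free_algebra hecke_relators_carrier)


section \<open>Compositions, partitions and tableaux\<close>

text \<open>
  A composition is a function whose value at \<open>i \<ge> 1\<close> is the \<open>i\<close>th part (this identifies sequences
  that differ in trailing zeros); the value at the unused index \<open>0\<close> is \<open>0\<close>.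
\<close>

definition composition_of :: "nat \<Rightarrow> (nat \<Rightarrow> nat) \<Rightarrow> bool" where
  "composition_of n lam \<longleftrightarrow>
     lam 0 = 0 \<and> finite {i. lam i \<noteq> 0} \<and> (\<Sum>i | lam i \<noteq> 0. lam i) = n"

definition partition_of :: "nat \<Rightarrow> (nat \<Rightarrow> nat) \<Rightarrow> bool" where
  "partition_of n \<mu> \<longleftrightarrow> composition_of n \<mu> \<and> (\<forall>i j. 1 \<le> i \<and> i \<le> j \<longrightarrow> \<mu> j \<le> \<mu> i)"

definition composition_of_list :: "nat list \<Rightarrow> nat \<Rightarrow> nat" where
  "composition_of_list xs i = (if 1 \<le> i \<and> i \<le> length xs then xs ! (i - 1) else 0)"

definition conjugate :: "(nat \<Rightarrow> nat) \<Rightarrow> nat \<Rightarrow> nat" where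
  "conjugate \<mu> j = (if j = 0 then 0 else card {i. 1 \<le> i \<and> j \<le> \<mu> i})"

text \<open>Boxes are pairs (row, column), both counted from \<open>1\<close>.\<close>

definition diagram :: "(nat \<Rightarrow> nat) \<Rightarrow> (nat \<times> nat) set" where
  "diagram lam = {(r, c). 1 \<le> r \<and> 1 \<le> c \<and> c \<le> lam r}"

type_synonym tableau = "nat \<times> nat \<Rightarrow> nat"

definition row_tab :: "(nat \<Rightarrow> nat) \<Rightarrow> tableau" where
  "row_tab lam = (\<lambda>(r, c). (\<Sum>k = 1..<r. lam k) + c)"

definition col_tab :: "(nat \<Rightarrow> nat) \<Rightarrow> tableau" where
  "col_tab \<mu> = (\<lambda>(r, c). (\<Sum>k = 1..<c. conjugate \<mu> k) + r)"

definition row_entries :: "(nat \<Rightarrow> nat) \<Rightarrow> tableau \<Rightarrow> nat \<Rightarrow> nat multiset" where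
  "row_entries \<mu> A g = image_mset (\<lambda>c. A (g, c)) (mset_set {1..\<mu> g})"

definition row_standard :: "(nat \<Rightarrow> nat) \<Rightarrow> tableau \<Rightarrow> bool" where
  "row_standard \<mu> A \<longleftrightarrow>
     (\<forall>g c d. (g, c) \<in> diagram \<mu> \<and> (g, d) \<in> diagram \<mu> \<and> c \<le> d \<longrightarrow> A (g, c) \<le> A (g, d))"

text \<open>The row-standard filling whose row \<open>g\<close> has the multiset of entries \<open>C g\<close>.\<close>

definition tableau_of_rows :: "(nat \<Rightarrow> nat multiset) \<Rightarrow> tableau" where
  "tableau_of_rows C = (\<lambda>(g, c). sorted_list_of_multiset (C g) ! (c - 1))"

lemma row_entries_tableau_of_rows:
  assumes "size (C g) = \<mu> g"
  shows "row_entries \<mu> (tableau_of_rows C) g = C g"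
proof -
  let ?xs = "sorted_list_of_multiset (C g)"
  have len: "length ?xs = \<mu> g"
    using assms by (metis mset_sorted_list_of_multiset size_mset)
  have "row_entries \<mu> (tableau_of_rows C) g = image_mset (\<lambda>c. ?xs ! (c - 1)) (mset_set (Suc ` {0..<\<mu> g}))"
    by (simp add: row_entries_def tableau_of_rows_def image_Suc_atLeastLessThan atLeastLessThanSuc_atLeastAtMost)
  also have "\<dots> = image_mset ((!) ?xs) (mset_set {0..<\<mu> g})"
    by (subst image_mset_mset_set[symmetric]) (simp_all add: multiset.map_comp comp_def)
  also have "\<dots> = mset ?xs"
    by (metis len map_nth mset_map mset_upt)
  finally show ?thesis by simp
qed

lemma row_standard_tableau_of_rows:
  assumes "\<And>g. 1 \<le> g \<Longrightarrow> size (C g) = \<mu> g"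
  shows "row_standard \<mu> (tableau_of_rows C)"
proof -
  have "length (sorted_list_of_multiset (C g)) = \<mu> g" if "1 \<le> g" for g
    using assms[OF that] by (metis mset_sorted_list_of_multiset size_mset)
  then have "sorted_list_of_multiset (C g) ! (c - 1) \<le> sorted_list_of_multiset (C g) ! (d - 1)"
    if "1 \<le> g" "1 \<le> c" "c \<le> d" "d \<le> \<mu> g" for g c d
    using that by (intro sorted_nth_mono) simp_all
  then show ?thesis
    by (simp add: row_standard_def tableau_of_rows_def diagram_def)
qed


section \<open>Young subgroups, permutation modules and Specht modules\<close>

definition young_subgroup :: "nat \<Rightarrow> (nat \<Rightarrow> nat) \<Rightarrow> (nat \<Rightarrow> nat) set" where
  "young_subgroup n lam =
     {w. w permutes {1..n} \<and>
         (\<forall>r\<ge>1. w ` {row_tab lam (r, c) | c. (r, c) \<in> diagram lam}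
               = {row_tab lam (r, c) | c. (r, c) \<in> diagram lam})}"

definition hecke_x :: "nat \<Rightarrow> 'a::field \<Rightarrow> (nat \<Rightarrow> nat) \<Rightarrow> 'a hecke_elem" where
  "hecke_x n q lam = (\<Oplus>\<^bsub>hecke n q\<^esub>w\<in>young_subgroup n lam. hecke_T n q w)"

definition hecke_y :: "nat \<Rightarrow> 'a::field \<Rightarrow> (nat \<Rightarrow> nat) \<Rightarrow> 'a hecke_elem" where
  "hecke_y n q lam =
     (\<Oplus>\<^bsub>hecke n q\<^esub>w\<in>young_subgroup n lam.
        hecke_smult n q (inverse ((- q) ^ coxeter_length n w)) (hecke_T n q w))"

definition right_ideal_gen :: "nat \<Rightarrow> 'a::field \<Rightarrow> 'a hecke_elem \<Rightarrow> 'a hecke_elem set" where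
  "right_ideal_gen n q x = {x \<otimes>\<^bsub>hecke n q\<^esub> h | h. h \<in> carrier (hecke n q)}"

definition perm_module :: "nat \<Rightarrow> 'a::field \<Rightarrow> (nat \<Rightarrow> nat) \<Rightarrow> 'a hecke_elem set" where
  "perm_module n q lam = right_ideal_gen n q (hecke_x n q lam)"

definition w_perm :: "nat \<Rightarrow> (nat \<Rightarrow> nat) \<Rightarrow> nat \<Rightarrow> nat" where
  "w_perm n \<mu> =
     (THE w. w permutes {1..n} \<and> (\<forall>b\<in>diagram \<mu>. w (row_tab \<mu> b) = col_tab \<mu> b))"

definition specht_module :: "nat \<Rightarrow> 'a::field \<Rightarrow> (nat \<Rightarrow> nat) \<Rightarrow> 'a hecke_elem set" where
  "specht_module n q \<mu> =
     right_ideal_gen n q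
       (hecke_x n q \<mu> \<otimes>\<^bsub>hecke n q\<^esub> hecke_T n q (w_perm n \<mu>) \<otimes>\<^bsub>hecke n q\<^esub> hecke_y n q (conjugate \<mu>))"


section \<open>Tableau homomorphisms\<close>

definition one_perm :: "nat \<Rightarrow> (nat \<Rightarrow> nat) \<Rightarrow> (nat \<Rightarrow> nat) \<Rightarrow> tableau \<Rightarrow> nat \<Rightarrow> nat" where
  "one_perm n \<mu> lam A =
     (THE w. w permutes {1..n} \<and>
        (\<forall>r c d. (r, c) \<in> diagram lam \<and> (r, d) \<in> diagram lam \<and> c < d
            \<longrightarrow> w (row_tab lam (r, c)) < w (row_tab lam (r, d))) \<and>
        (\<forall>b\<in>diagram \<mu>. \<exists>c. (A b, c) \<in> diagram lam \<and> w (row_tab lam (A b, c)) = row_tab \<mu> b))"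

definition double_coset ::
    "nat \<Rightarrow> (nat \<Rightarrow> nat) \<Rightarrow> (nat \<Rightarrow> nat) \<Rightarrow> (nat \<Rightarrow> nat) \<Rightarrow> (nat \<Rightarrow> nat) set" where
  "double_coset n lam d \<mu> =
     {v \<circ> d \<circ> u | u v. u \<in> young_subgroup n lam \<and> v \<in> young_subgroup n \<mu>}"

text \<open>
  Homomorphisms of right modules between right ideals, as functions that are \<^const>\<open>undefined\<close>
  off their domain, so that equality of homomorphisms is equality of functions.
\<close>

definition right_module_hom ::
    "nat \<Rightarrow> 'a::field \<Rightarrow> 'a hecke_elem set \<Rightarrow> 'a hecke_elem set
       \<Rightarrow> ('a hecke_elem \<Rightarrow> 'a hecke_elem) set" where
  "right_module_hom n q M N =
     {f \<in> M \<rightarrow>\<^sub>E N.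
        (\<forall>x\<in>M. \<forall>y\<in>M. f (x \<oplus>\<^bsub>hecke n q\<^esub> y) = f x \<oplus>\<^bsub>hecke n q\<^esub> f y) \<and>
        (\<forall>x\<in>M. \<forall>h\<in>carrier (hecke n q). f (x \<otimes>\<^bsub>hecke n q\<^esub> h) = f x \<otimes>\<^bsub>hecke n q\<^esub> h)}"

definition tableau_hom ::
    "nat \<Rightarrow> 'a::field \<Rightarrow> (nat \<Rightarrow> nat) \<Rightarrow> (nat \<Rightarrow> nat) \<Rightarrow> tableau
       \<Rightarrow> 'a hecke_elem \<Rightarrow> 'a hecke_elem" where
  "tableau_hom n q \<mu> lam A =
     (THE f. f \<in> right_module_hom n q (perm_module n q \<mu>) (perm_module n q lam) \<and>
        f (hecke_x n q \<mu>) =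
          (\<Oplus>\<^bsub>hecke n q\<^esub>w\<in>double_coset n lam (one_perm n \<mu> lam A) \<mu>. hecke_T n q w))"

definition specht_hom ::
    "nat \<Rightarrow> 'a::field \<Rightarrow> (nat \<Rightarrow> nat) \<Rightarrow> (nat \<Rightarrow> nat) \<Rightarrow> tableau
       \<Rightarrow> 'a hecke_elem \<Rightarrow> 'a hecke_elem" where
  "specht_hom n q \<mu> lam A = restrict (tableau_hom n q \<mu> lam A) (specht_module n q \<mu>)"


section \<open>Quantum binomial coefficients\<close>

definition quantum_int :: "nat \<Rightarrow> 'a::field poly" where
  "quantum_int k = (\<Sum>i<k. monom 1 i)"

definition quantum_fact :: "nat \<Rightarrow> 'a::field poly" where
  "quantum_fact k = (\<Prod>i = 1..k. quantum_int i)"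

text \<open>
  The division takes place in the polynomial ring, where it is exact; only the quotient is
  specialised at \<open>q\<close>, so that vanishing quantum factorials at \<open>q\<close> are harmless.
\<close>

definition quantum_binomial :: "'a::field \<Rightarrow> nat \<Rightarrow> nat \<Rightarrow> 'a" where
  "quantum_binomial q a b =
     poly (quantum_fact a div (quantum_fact b * quantum_fact (a - b))) q"

end

theory Submission
  imports Defs
begin

text \<open>
  Put \<open>\<nu> = (|R|, |S|, |T|)\<close>. The sum is the restriction to \<open>S\<^sup>\<mu>\<close> of a composite
  \<open>M\<^sup>\<mu> \<rightarrow> M\<^sup>\<nu> \<rightarrow> M\<^sup>\<lambda>\<close>: the first map is the tableau homomorphism of the \<open>\<mu>\<close>-tableau of type \<open>\<nu>\<close>
  with entries sorted, the second that of the \<open>\<nu>\<close>-tableau with rows \<open>R\<close>, \<open>S\<close>, \<open>T\<close>. It vanishes on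
  \<open>S\<^sup>\<mu>\<close> because \<open>x\<^sub>\<nu> h y = 0\<close> for \<open>y = y\<^bsub>\<mu>'\<^esub>\<close> and all \<open>h\<close>: a right coset of \<open>W\<^sub>\<nu>\<close> is a word in which the
  letter 2 occurs \<open>|S| > m\<close> times, while \<open>\<mu>'\<close> has at most \<open>m\<close> rows, all of length at most two, so two
  equal letters are adjacent in one row.

  To expand the composite, let \<open>W\<^sub>\<rho>\<close> be the intersection of \<open>W\<^sub>\<nu>\<close> and \<open>W\<^sub>\<mu>\<close> and write \<open>x\<^sub>\<mu> = x\<^sub>\<rho> g\<close>. The
  double coset sum of the second tableau is the sum of \<open>T\<^sub>e x\<^sub>\<rho>\<close> over minimal representatives \<open>e\<close> of left
  cosets of \<open>W\<^sub>\<rho>\<close>, and multiplying by \<open>g\<close> turns \<open>T\<^sub>e x\<^sub>\<rho>\<close> into \<open>T\<^sub>e x\<^sub>\<mu>\<close>, which is a power of \<open>q\<close> times a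
  coset sum of \<open>W\<^sub>\<mu>\<close>. Collecting these powers gives weighted sums over subsets, and these are the
  products of quantum binomial coefficients in the statement.

  All of this only uses the multiplication rules for the \<open>T\<^sub>w\<close>, not their linear independence.
\<close>

section \<open>Inversions\<close>

text \<open>Since the \<open>T_w\<close> are not known to be independent, coefficients cannot be
  read off from elements. Elements are therefore written as \<open>lincomb g\<close> for explicit
  functions \<open>g\<close> on permutations, and identities are only transferred from functions to
  elements. A composition enters through a function \<open>r\<close> giving the row of each
  position. As products apply the left factor first, left cosets of the Young subgroup are the
  fibres of \<open>w \<mapsto> r \<circ> w\<close>, labelled by words in the row numbers, and right
  cosets are those of \<open>w \<mapsto> r \<circ> perm_inv w\<close>. Double cosets become
  conditions on the contents of rows. The size of \<open>U\<close> is forced to be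
  \<open>m - |R|\<close>, so a single \<open>\<rho> = (|R|, |U|, |V|, |T|)\<close> serves all pairs.
  The exponent of \<open>q\<close> belonging to a representative \<open>e\<close> is the length of
  its \<open>W_\<mu>\<close> part: the number of its inversions between blocks that
  \<open>\<mu>\<close> merges, the first with the second and the third with the fourth. So the
  weight separates into one factor for each row of \<open>\<mu>\<close>.\<close>

definition inversions :: "nat \<Rightarrow> (nat \<Rightarrow> nat) \<Rightarrow> (nat \<times> nat) set" where
  "inversions n w = {(i, j). 1 \<le> i \<and> i < j \<and> j \<le> n \<and> w j < w i}"

text \<open>A stand-in for \<open>coxeter_length\<close>, to which it is shown equal: unlike a
  minimum over words, it can be followed under multiplication by one simple transposition.\<close>

definition inv_count :: "nat \<Rightarrow> (nat \<Rightarrow> nat) \<Rightarrow> nat" where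
  "inv_count n w = card (inversions n w)"

abbreviation perm_inv :: "(nat \<Rightarrow> nat) \<Rightarrow> nat \<Rightarrow> nat" where
  "perm_inv w \<equiv> inv_into UNIV w"

lemma finite_inversions [simp]: "finite (inversions n w)"
  by (rule finite_subset[of _ "{1..n} \<times> {1..n}"]) (auto simp: inversions_def)

lemma simple_transp_apply:
  "simple_transp i k = (if k = i then Suc i else if k = Suc i then i else k)"
  by (auto simp: simple_transp_def transpose_def)

lemma simple_transp_involutory [simp]: "simple_transp i (simple_transp i k) = k"
  by (simp add: simple_transp_def)

lemma simple_transp_comp_self [simp]: "simple_transp i \<circ> simple_transp i = id"
  by (simp add: fun_eq_iff)

lemma comp_simple_transp_cancel [simp]: "w \<circ> simple_transp i \<circ> simple_transp i = w"
  by (simp add: fun_eq_iff)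

lemma simple_transp_comp_cancel [simp]: "simple_transp i \<circ> (simple_transp i \<circ> w) = w"
  by (simp add: fun_eq_iff)

lemma inj_simple_transp: "inj (simple_transp i)"
  by (metis injI simple_transp_involutory)

lemma simple_transp_permutes:
  assumes "1 \<le> i" "i < n"
  shows "simple_transp i permutes {1..n}"
  unfolding simple_transp_def using assms by (intro permutes_swap_id) auto

lemma permutes_comp_simple_transp:
  assumes "w permutes {1..n}" "1 \<le> i" "i < n"
  shows "w \<circ> simple_transp i permutes {1..n}" "simple_transp i \<circ> w permutes {1..n}"
  using permutes_compose[OF simple_transp_permutes assms(1)]
    permutes_compose[OF assms(1) simple_transp_permutes] assms by auto

text \<open>For \<open>P\<close> the relation of lying in the same row of a composition, this is the length of the
  component of \<open>w\<close> in the Young subgroup.\<close>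

definition restricted_inv_count :: "nat \<Rightarrow> (nat \<Rightarrow> nat \<Rightarrow> bool) \<Rightarrow> (nat \<Rightarrow> nat) \<Rightarrow> nat" where
  "restricted_inv_count n P w = card {(i, j) \<in> inversions n w. P (w i) (w j)}"

text \<open>Exchanging \<open>i\<close> and \<open>Suc i\<close> in both coordinates maps the
  inversions of \<open>w\<close> into those of the product, which has \<open>(i, Suc i)\<close> as
  its only further inversion. The relation \<open>P\<close> is tested on values, and these travel
  along with the exchange.\<close>

lemma restricted_inv_count_comp_simple_transp:
  assumes "1 \<le> i" "i < n" "w i < w (Suc i)"
  shows "restricted_inv_count n P (w \<circ> simple_transp i) =
    restricted_inv_count n P w + (if P (w (Suc i)) (w i) then 1 else 0)"
proof -
  let ?s = "simple_transp i"
  let ?f = "\<lambda>(a, b). (?s a, ?s b)"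
  let ?I = "\<lambda>w. {(i, j) \<in> inversions n w. P (w i) (w j)}"
  let ?J = "if P (w (Suc i)) (w i) then {(i, Suc i)} else {}"
  have "?I (w \<circ> ?s) = ?J \<union> ?f ` ?I w" (is "?L = ?R")
  proof (intro subset_antisym subsetI)
    fix p assume "p \<in> ?L"
    then obtain a b where p: "p = (a, b)" "1 \<le> a" "a < b" "b \<le> n" "w (?s b) < w (?s a)"
      "P (w (?s a)) (w (?s b))"
      by (auto simp: inversions_def)
    show "p \<in> ?R"
    proof (cases "a = i \<and> b = Suc i")
      case True
      then show ?thesis using p by (auto simp: simple_transp_apply)
    next
      case False
      then have "(?s a, ?s b) \<in> ?I w"
        using p assms by (auto simp: inversions_def simple_transp_apply split: if_splits)
      moreover have "p = ?f (?s a, ?s b)" using p by simp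
      ultimately show ?thesis by blast
    qed
  next
    fix p assume "p \<in> ?R"
    then consider "p = (i, Suc i)" "P (w (Suc i)) (w i)"
      | a b where "p = (?s a, ?s b)" "(a, b) \<in> ?I w"
      by (auto split: if_splits)
    then show "p \<in> ?L"
    proof cases
      case 1
      then show ?thesis using assms by (auto simp: inversions_def simple_transp_apply)
    next
      case 2
      then have "1 \<le> a" "a < b" "b \<le> n" "w b < w a" "P (w a) (w b)" by (auto simp: inversions_def)
      moreover have "\<not> (a = i \<and> b = Suc i)" using assms calculation by auto
      ultimately show ?thesis using assms 2(1)
        by (auto simp: inversions_def simple_transp_apply)
    qed
  qed
  moreover have "?J \<inter> ?f ` ?I w = {}"
  proof -
    have "(i, Suc i) \<noteq> ?f (a, b)" if "a < b" for a b
      using that by (auto simp: simple_transp_apply)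
    then show ?thesis by (force simp: inversions_def)
  qed
  moreover have "inj_on ?f (?I w)"
    using inj_simple_transp[of i] by (auto simp: inj_on_def dest: injD)
  moreover have "finite (?I w)"
    by (rule finite_subset[OF _ finite_inversions[of n w]]) auto
  ultimately show ?thesis
    by (simp add: restricted_inv_count_def card_Un_disjoint card_image)
qed

lemma inv_count_comp_simple_transp:
  assumes "1 \<le> i" "i < n" "w i < w (Suc i)"
  shows "inv_count n (w \<circ> simple_transp i) = Suc (inv_count n w)"
proof -
  have "inv_count n v = restricted_inv_count n (\<lambda>_ _. True) v" for v
    by (simp add: inv_count_def restricted_inv_count_def)
  then show ?thesis
    using restricted_inv_count_comp_simple_transp[OF assms, where P = "\<lambda>_ _. True"] by simp
qed

lemma inv_count_comp_simple_transp_descent: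
  assumes "1 \<le> i" "i < n" "w (Suc i) < w i"
  shows "inv_count n w = Suc (inv_count n (w \<circ> simple_transp i))"
  using inv_count_comp_simple_transp[of i n "w \<circ> simple_transp i"] assms
  by (simp add: simple_transp_apply)

text \<open>An inversion \<open>(i, j)\<close> of \<open>w\<close> corresponds to
  \<open>(w j, w i)\<close> for the inverse. This carries length statements from left to right
  multiplication.\<close>

lemma inv_count_inv:
  assumes "w permutes {1..n}"
  shows "inv_count n (perm_inv w) = inv_count n w"
proof -
  have w: "perm_inv w (w k) = k" "w (perm_inv w k) = k" for k
    using permutes_inverses[OF assms] by auto
  have rng: "w k \<in> {1..n} \<longleftrightarrow> k \<in> {1..n}" "perm_inv w k \<in> {1..n} \<longleftrightarrow> k \<in> {1..n}" for k
    using permutes_in_image[OF assms] permutes_in_image[OF permutes_inv[OF assms]] by auto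
  have "bij_betw (\<lambda>(i, j). (w j, w i)) (inversions n w) (inversions n (perm_inv w))"
  proof (rule bij_betw_byWitness[where f' = "\<lambda>(i, j). (perm_inv w j, perm_inv w i)"])
    show "(\<lambda>(i, j). (w j, w i)) ` inversions n w \<subseteq> inversions n (perm_inv w)"
      using rng(1) by (fastforce simp: inversions_def w)
    show "(\<lambda>(i, j). (perm_inv w j, perm_inv w i)) ` inversions n (perm_inv w) \<subseteq> inversions n w"
      using rng(2) by (fastforce simp: inversions_def w)
  qed (auto simp: w)
  then show ?thesis by (simp add: inv_count_def bij_betw_same_card)
qed

lemma inv_simple_transp: "perm_inv (simple_transp i) = simple_transp i"
  by (rule inv_unique_comp) simp_all

lemma simple_transp_comp_eq_inv:
  assumes "w permutes {1..n}"
  shows "perm_inv (simple_transp i \<circ> w) = perm_inv w \<circ> simple_transp i"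
    "perm_inv (w \<circ> simple_transp i) = simple_transp i \<circ> perm_inv w"
  using permutes_bij[OF assms] inj_simple_transp
  by (simp_all add: o_inv_distrib inv_simple_transp simple_transp_def)

lemma inv_count_simple_transp_comp:
  assumes "w permutes {1..n}" "1 \<le> i" "i < n" "perm_inv w i < perm_inv w (Suc i)"
  shows "inv_count n (simple_transp i \<circ> w) = Suc (inv_count n w)"
  using inv_count_comp_simple_transp[OF assms(2-4)] assms
    inv_count_inv[of "simple_transp i \<circ> w" n] inv_count_inv[of w n]
    permutes_comp_simple_transp(2)[OF assms(1-3)]
  by (simp add: simple_transp_comp_eq_inv)

section \<open>Words, reduced expressions and length\<close>

lemma word_perm_permutes: "set is \<subseteq> {1..<n} \<Longrightarrow> word_perm is permutes {1..n}"
proof (induction "is")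
  case (Cons i "is")
  then show ?case using permutes_comp_simple_transp(1)[of "word_perm is" n i]
    by (simp add: comp_def)
qed (simp add: permutes_id)

lemma word_perm_append: "word_perm (is @ js) = word_perm js \<circ> word_perm is"
  by (induction "is") (auto simp: fun_eq_iff)

lemma permutes_neq_Suc:
  assumes "w permutes {1..n}"
  shows "w i \<noteq> w (Suc i)"
  by (metis assms n_not_Suc_n permutes_inj injD)

text \<open>Each letter changes the number of inversions by exactly one, so a word cannot be shorter
  than that number.\<close>

lemma inv_count_word_perm_le: "set is \<subseteq> {1..<n} \<Longrightarrow> inv_count n (word_perm is) \<le> length is"
proof (induction "is")
  case Nil
  have "inversions n (word_perm []) = {}" by (auto simp: inversions_def)
  then show ?case by (simp only: inv_count_def card.empty)
next
  case (Cons i "is")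
  let ?w = "word_perm is"
  have i: "1 \<le> i" "i < n" using Cons.prems by auto
  show ?case
  proof (cases "?w i < ?w (Suc i)")
    case True
    then show ?thesis using inv_count_comp_simple_transp[OF i True] Cons by (simp add: comp_def)
  next
    case False
    then have "?w (Suc i) < ?w i"
      using permutes_neq_Suc[OF word_perm_permutes[of "is" n], of i] Cons.prems by auto
    then show ?thesis using inv_count_comp_simple_transp_descent[OF i] Cons by (fastforce simp: comp_def)
  qed
qed

text \<open>Without a descent the values increase weakly along \<open>1, ..., n\<close>, and there
  is no inversion.\<close>

lemma exists_descent:
  assumes w: "w permutes {1..n}" and pos: "inv_count n w > 0"
  obtains i where "1 \<le> i" "i < n" "w (Suc i) < w i"
proof -
  have "\<exists>i. 1 \<le> i \<and> i < n \<and> w (Suc i) < w i"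
  proof (rule ccontr)
    assume "\<not> ?thesis"
    then have asc: "w i \<le> w (Suc i)" if "1 \<le> i" "i < n" for i using that by force
    have mono: "w i \<le> w j" if "1 \<le> i" "i \<le> j" "j \<le> n" for i j
      using that(2,1,3)
    proof (induction j rule: dec_induct)
      case (step k)
      then have "w i \<le> w k" "w k \<le> w (Suc k)" using asc[of k] by simp_all
      then show ?case by (rule order_trans)
    qed simp
    have "inversions n w = {}"
      unfolding inversions_def using mono by (fastforce simp: not_less[symmetric])
    then show False using pos by (simp add: inv_count_def)
  qed
  then show thesis using that by blast
qed

text \<open>Without inversions \<open>w\<close> is strictly increasing on \<open>{1..n}\<close>,
  hence \<open>i \<le> w i\<close> throughout, and for a permutation this forces equality.\<close>

lemma inv_count_0_imp_id:
  assumes w: "w permutes {1..n}" and 0: "inv_count n w = 0"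
  shows "w = id"
proof -
  have emp: "inversions n w = {}" using 0 by (simp add: inv_count_def)
  have "strict_mono_on {1..n} w"
  proof (rule strict_mono_onI)
    fix i j assume "i \<in> {1..n}" "j \<in> {1..n}" "i < j"
    then show "w i < w j"
      using emp injD[OF permutes_inj[OF w], of i j] by (force simp: inversions_def)
  qed
  have ge: "i \<le> w i" if "i \<le> n" "1 \<le> i" for i
    using that
  proof (induction i)
    case (Suc i)
    show ?case
    proof (cases "i = 0")
      case True
      then show ?thesis using permutes_in_image[OF w, of 1] Suc.prems by auto
    next
      case False
      then have "w i < w (Suc i)" using strict_mono_onD[OF \<open>strict_mono_on {1..n} w\<close>, of i "Suc i"] Suc.prems by auto
      then show ?thesis using Suc False by force
    qed
  qed simp
  show ?thesis
    using permutes_natset_ge[OF w] ge by auto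
qed

lemma exists_reduced_word:
  assumes "w permutes {1..n}"
  shows "\<exists>is. set is \<subseteq> {1..<n} \<and> word_perm is = w \<and> length is = inv_count n w"
  using assms
proof (induction "inv_count n w" arbitrary: w)
  case 0
  then have "w = word_perm []" using inv_count_0_imp_id[of w n] by simp
  then show ?case using 0 by (intro exI[of _ "[]"]) simp
next
  case (Suc k)
  then obtain i where i: "1 \<le> i" "i < n" "w (Suc i) < w i"
    using exists_descent[of w n] by auto
  have "k = inv_count n (w \<circ> simple_transp i)"
    using inv_count_comp_simple_transp_descent[of i n w] i Suc.hyps(2) by auto
  from Suc.hyps(1)[OF this] obtain "is" where
    "set is \<subseteq> {1..<n}" "word_perm is = w \<circ> simple_transp i" "length is = k"
    using permutes_comp_simple_transp(1)[of w n i] i Suc.prems by (metis \<open>k = _\<close>)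
  then show ?case using i Suc.hyps(2)
    by (intro exI[of _ "i # is"]) auto
qed

lemma coxeter_length_eq_inv_count:
  assumes "w permutes {1..n}"
  shows "coxeter_length n w = inv_count n w"
  unfolding coxeter_length_def
proof (rule Least_equality)
  show "\<exists>is. set is \<subseteq> {1..<n} \<and> word_perm is = w \<and> length is = inv_count n w"
    by (rule exists_reduced_word[OF assms])
qed (use inv_count_word_perm_le in auto)

lemma reduced_expression_iff:
  "reduced_expression n w is \<longleftrightarrow>
     set is \<subseteq> {1..<n} \<and> word_perm is = w \<and> length is = inv_count n w"
  unfolding reduced_expression_def
  using coxeter_length_eq_inv_count word_perm_permutes by metis

text \<open>The first letter acts on positions. If it were not a descent, its removal would leave
  more inversions than the remaining word has letters.\<close>

lemma reduced_expression_ConsD: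
  assumes "reduced_expression n w (i # is)"
  shows "1 \<le> i" "i < n" "w (Suc i) < w i" "reduced_expression n (w \<circ> simple_transp i) is"
proof -
  have *: "set is \<subseteq> {1..<n}" "word_perm is \<circ> simple_transp i = w" "Suc (length is) = inv_count n w"
    using assms by (auto simp: reduced_expression_iff)
  show i: "1 \<le> i" "i < n" using assms by (auto simp: reduced_expression_iff)
  have eq: "word_perm is = w \<circ> simple_transp i" using *(2) by auto
  have le: "inv_count n (w \<circ> simple_transp i) \<le> length is"
    using inv_count_word_perm_le[OF *(1)] eq by simp
  have "w permutes {1..n}" using word_perm_permutes[of "i # is" n] assms by (auto simp: reduced_expression_iff)
  show d: "w (Suc i) < w i"
  proof (rule ccontr)
    assume "\<not> ?thesis"
    then have "w i < w (Suc i)" using permutes_neq_Suc[OF \<open>w permutes {1..n}\<close>, of i] by auto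
    then show False using inv_count_comp_simple_transp[OF i] le *(3) by auto
  qed
  show "reduced_expression n (w \<circ> simple_transp i) is"
    using * eq inv_count_comp_simple_transp_descent[OF i d]
    by (auto simp: reduced_expression_iff)
qed

lemma reduced_expression_Cons:
  assumes "reduced_expression n w is" "1 \<le> i" "i < n" "w i < w (Suc i)"
  shows "reduced_expression n (w \<circ> simple_transp i) (i # is)"
  using assms inv_count_comp_simple_transp[OF assms(2-4)]
  by (auto simp: reduced_expression_iff)

section \<open>The standard basis elements\<close>

lemma free_scalar_comm: "free_scalar c * f = f * free_scalar c"
proof (induction f rule: update_induct)
  case const
  then show ?case by simp
next
  case (update f k v)
  have "Poly_Mapping.update k v f = f + Poly_Mapping.single k v"
    by (rule poly_mapping_eqI)
      (use update(1) in \<open>auto simp: lookup_update lookup_add lookup_single not_in_keys_iff_lookup_eq_zero when_def\<close>)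
  then show ?case
    by (simp add: distrib_left distrib_right update mult_single mult.commute)
qed

locale hecke_algebra =
  fixes n :: nat and q :: "'a::field"
begin

abbreviation F :: "(gen_word \<Rightarrow>\<^sub>0 'a) ring" where "F \<equiv> free_algebra n"
abbreviation H :: "'a hecke_elem ring" where "H \<equiv> hecke n q"

definition proj :: "(gen_word \<Rightarrow>\<^sub>0 'a) \<Rightarrow> 'a hecke_elem" where
  "proj f = hecke_ideal n q +>\<^bsub>F\<^esub> f"

text \<open>Scalars as elements of \<open>H\<close>: scalar multiplication becomes a ring product,
  and only centrality has to be added to the ring laws.\<close>

definition scal :: "'a \<Rightarrow> 'a hecke_elem" where
  "scal c = proj (free_scalar c)"

abbreviation T :: "nat \<Rightarrow> 'a hecke_elem" where "T \<equiv> hecke_gen n q"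
abbreviation Tw :: "(nat \<Rightarrow> nat) \<Rightarrow> 'a hecke_elem" where "Tw \<equiv> hecke_T n q"

sublocale H: ring "hecke n q" by (rule ring_hecke)

lemma F_simps:
  "carrier F = {f. \<forall>w\<in>Poly_Mapping.keys f. set (letters w) \<subseteq> {1..<n}}"
  "monoid.mult F = (*)" "one F = 1" "zero F = 0" "add F = (+)"
  by (simp_all add: free_algebra_def)

lemma ideal_hecke_ideal: "ideal (hecke_ideal n q) F"
  unfolding hecke_ideal_def by (rule ring.genideal_ideal[OF ring_free_algebra hecke_relators_carrier])

lemma proj_ring_hom: "proj \<in> ring_hom F H"
  using ideal.rcos_ring_hom[OF ideal_hecke_ideal] by (simp add: proj_def[abs_def] hecke_def)

lemma proj_closed [simp]: "f \<in> carrier F \<Longrightarrow> proj f \<in> carrier H"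
  using ring_hom_closed[OF proj_ring_hom] .

lemma proj_mult: "f \<in> carrier F \<Longrightarrow> g \<in> carrier F \<Longrightarrow> proj (f * g) = proj f \<otimes>\<^bsub>H\<^esub> proj g"
  using ring_hom_mult[OF proj_ring_hom] by (simp add: F_simps)

lemma proj_add: "f \<in> carrier F \<Longrightarrow> g \<in> carrier F \<Longrightarrow> proj (f + g) = proj f \<oplus>\<^bsub>H\<^esub> proj g"
  using ring_hom_add[OF proj_ring_hom] by (simp add: F_simps)

lemma proj_one: "proj 1 = \<one>\<^bsub>H\<^esub>"
  using ring_hom_one[OF proj_ring_hom] by (simp add: F_simps)

lemma carrier_H: "carrier H = proj ` carrier F"
  by (auto simp: hecke_def FactRing_def A_RCOSETS_def' proj_def)

lemma F_add_closed: "f \<in> carrier F \<Longrightarrow> g \<in> carrier F \<Longrightarrow> f + g \<in> carrier F"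
  using ring.ring_simprules(1)[OF ring_free_algebra, of f n g] by (simp only: F_simps)

lemma F_mult_closed: "f \<in> carrier F \<Longrightarrow> g \<in> carrier F \<Longrightarrow> f * g \<in> carrier F"
  using ring.ring_simprules(5)[OF ring_free_algebra, of f n g] by (simp only: F_simps)

lemma F_diff_closed:
  assumes "f \<in> carrier F" "g \<in> carrier F" shows "f - g \<in> carrier F"
proof -
  have "- g \<in> carrier F" using assms(2) by (simp add: free_algebra_def)
  from F_add_closed[OF assms(1) this] show ?thesis by (simp only: add_uminus_conv_diff)
qed

lemma free_scalar_closed [simp]: "free_scalar c \<in> carrier F"
  by (simp add: F_simps zero_gen_word_def)

lemma free_gen_closed [simp]: "1 \<le> i \<Longrightarrow> i < n \<Longrightarrow> free_gen i \<in> carrier F"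
  by (simp add: F_simps)

lemma proj_eqI:
  assumes "f \<in> carrier F" "g \<in> carrier F" "f - g \<in> hecke_ideal n q"
  shows "proj f = proj g"
proof -
  have "proj (f - g) = \<zero>\<^bsub>H\<^esub>"
    using ring.a_rcos_zero[OF ring_free_algebra ideal_hecke_ideal assms(3)]
    by (simp add: proj_def hecke_def FactRing_def)
  moreover have "proj f = proj (f - g) \<oplus>\<^bsub>H\<^esub> proj g"
    using proj_add[of "f - g" g] F_diff_closed assms by simp
  ultimately show ?thesis using assms by simp
qed

lemma relator_in_ideal: "r \<in> hecke_relators n q \<Longrightarrow> r \<in> hecke_ideal n q"
  unfolding hecke_ideal_def
  using ring.genideal_self[OF ring_free_algebra hecke_relators_carrier] by blast

lemma T_closed [simp]: "1 \<le> i \<Longrightarrow> i < n \<Longrightarrow> T i \<in> carrier H"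
  by (simp add: hecke_gen_def proj_def[symmetric])

lemma scal_closed [simp]: "scal c \<in> carrier H"
  by (simp add: scal_def)

lemma hecke_smult_eq: "hecke_smult n q c h = scal c \<otimes>\<^bsub>H\<^esub> h"
  by (simp add: hecke_smult_def scal_def proj_def)

lemma scal_add: "scal (c + d) = scal c \<oplus>\<^bsub>H\<^esub> scal d"
  by (simp add: scal_def proj_add[symmetric] single_add)

lemma scal_mult: "scal (c * d) = scal c \<otimes>\<^bsub>H\<^esub> scal d"
  by (simp add: scal_def proj_mult[symmetric] mult_single)

lemma scal_1: "scal 1 = \<one>\<^bsub>H\<^esub>"
  by (simp add: scal_def proj_one)

lemma scal_0: "scal 0 = \<zero>\<^bsub>H\<^esub>"
proof -
  have "scal 0 \<oplus>\<^bsub>H\<^esub> scal 0 = scal 0" using scal_add[of 0 0] by simp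
  then show ?thesis by (simp add: H.add.r_cancel_one)
qed

lemma scal_comm: "h \<in> carrier H \<Longrightarrow> scal c \<otimes>\<^bsub>H\<^esub> h = h \<otimes>\<^bsub>H\<^esub> scal c"
  unfolding carrier_H scal_def by (auto simp: proj_mult[symmetric] free_scalar_comm)

lemma scal_left_comm:
  assumes "g \<in> carrier H" "h \<in> carrier H"
  shows "g \<otimes>\<^bsub>H\<^esub> (scal c \<otimes>\<^bsub>H\<^esub> h) = scal c \<otimes>\<^bsub>H\<^esub> (g \<otimes>\<^bsub>H\<^esub> h)"
  using assms by (simp add: H.m_assoc[symmetric] scal_comm[of g])

lemma T_quadratic:
  assumes "1 \<le> i" "i < n"
  shows "T i \<otimes>\<^bsub>H\<^esub> T i = (scal (q - 1) \<otimes>\<^bsub>H\<^esub> T i) \<oplus>\<^bsub>H\<^esub> scal q"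
proof -
  let ?g = "free_gen i :: gen_word \<Rightarrow>\<^sub>0 'a"
  have "(?g - free_scalar q) * (?g + 1) \<in> hecke_ideal n q"
    by (rule relator_in_ideal) (use assms in \<open>auto simp: hecke_relators_def\<close>)
  also have "(?g - free_scalar q) * (?g + 1) = ?g * ?g - (free_scalar (q - 1) * ?g + free_scalar q)"
    by (simp add: single_diff algebra_simps)
  finally have "proj (?g * ?g) = proj (free_scalar (q - 1) * ?g + free_scalar q)"
    by (intro proj_eqI F_mult_closed F_add_closed free_scalar_closed free_gen_closed assms)
  then show ?thesis
    using assms by (simp add: proj_mult proj_add F_mult_closed scal_def hecke_gen_def proj_def[symmetric])
qed

lemma T_comm:
  assumes "1 \<le> i" "i + 2 \<le> j" "j < n"
  shows "T i \<otimes>\<^bsub>H\<^esub> T j = T j \<otimes>\<^bsub>H\<^esub> T i"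
proof -
  have "proj (free_gen i * free_gen j) = proj (free_gen j * free_gen i)"
  proof (intro proj_eqI F_mult_closed free_gen_closed relator_in_ideal)
    show "free_gen i * free_gen j - free_gen j * free_gen i \<in> hecke_relators n q"
      using assms unfolding hecke_relators_def by blast
  qed (use assms in auto)
  then show ?thesis
    using assms by (simp add: proj_mult hecke_gen_def proj_def[symmetric])
qed

lemma T_braid:
  assumes "1 \<le> i" "i + 1 < n"
  shows "T i \<otimes>\<^bsub>H\<^esub> (T (Suc i) \<otimes>\<^bsub>H\<^esub> T i) = T (Suc i) \<otimes>\<^bsub>H\<^esub> (T i \<otimes>\<^bsub>H\<^esub> T (Suc i))"
proof -
  have "proj (free_gen i * free_gen (i+1) * free_gen i) = proj (free_gen (i+1) * free_gen i * free_gen (i+1))"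
  proof (intro proj_eqI F_mult_closed free_gen_closed relator_in_ideal)
    show "free_gen i * free_gen (i+1) * free_gen i
      - free_gen (i+1) * free_gen i * free_gen (i+1) \<in> hecke_relators n q"
      using assms unfolding hecke_relators_def by blast
  qed (use assms in auto)
  then show ?thesis
    using assms by (simp add: proj_mult F_mult_closed hecke_gen_def proj_def[symmetric] H.m_assoc)
qed

text \<open>Monomials span the free algebra, and each arises from the empty word by left
  multiplication by generators. This reaches an arbitrary element of the algebra without a
  basis.\<close>

lemma hecke_induct [consumes 1, case_names one add scal gen]:
  assumes "h \<in> carrier H"
    and one: "P \<one>\<^bsub>H\<^esub>"
    and add: "\<And>x y. x \<in> carrier H \<Longrightarrow> y \<in> carrier H \<Longrightarrow> P x \<Longrightarrow> P y \<Longrightarrow> P (x \<oplus>\<^bsub>H\<^esub> y)"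
    and scal: "\<And>c x. x \<in> carrier H \<Longrightarrow> P x \<Longrightarrow> P (scal c \<otimes>\<^bsub>H\<^esub> x)"
    and gen: "\<And>i x. 1 \<le> i \<Longrightarrow> i < n \<Longrightarrow> x \<in> carrier H \<Longrightarrow> P x \<Longrightarrow> P (T i \<otimes>\<^bsub>H\<^esub> x)"
  shows "P h"
proof -
  have word: "Poly_Mapping.single (Gen_Word is) 1 \<in> carrier F \<and> P (proj (Poly_Mapping.single (Gen_Word is) 1))"
    if "set is \<subseteq> {1..<n}" for "is"
    using that
  proof (induction "is")
    case Nil
    have "Poly_Mapping.single (Gen_Word []) 1 = (1 :: gen_word \<Rightarrow>\<^sub>0 'a)"
      by (metis single_one zero_gen_word_def)
    then show ?case using one proj_one free_scalar_closed[of 1] by simp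
  next
    case (Cons i "is")
    have "Poly_Mapping.single (Gen_Word (i # is)) 1
        = (free_gen i :: gen_word \<Rightarrow>\<^sub>0 'a) * Poly_Mapping.single (Gen_Word is) 1"
      by (simp add: mult_single plus_gen_word_def)
    moreover have "1 \<le> i" "i < n" using Cons.prems by auto
    ultimately show ?case
      using Cons gen[of i "proj (Poly_Mapping.single (Gen_Word is) 1)"]
      by (simp add: proj_mult F_mult_closed hecke_gen_def proj_def[symmetric])
  qed
  have "f \<in> carrier F \<longrightarrow> P (proj f)" for f
  proof (induction f rule: update_induct)
    case const
    \<comment> \<open>Zero is reached as the multiple of the unit by the scalar \<open>0\<close>;
      the induction rule has no case of its own for it.\<close>
    have "proj 0 = scal 0" by (simp add: scal_def)
    then show ?case using scal[OF H.one_closed one, of 0] H.r_one[OF scal_closed, of 0] by metis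
  next
    case (update f k v)
    show ?case
    proof
      assume car: "Poly_Mapping.update k v f \<in> carrier F"
      have upd: "Poly_Mapping.update k v f = f + free_scalar v * Poly_Mapping.single k 1"
        by (rule poly_mapping_eqI)
          (use update(1) in \<open>auto simp: mult_single lookup_update lookup_add lookup_single
             not_in_keys_iff_lookup_eq_zero when_def\<close>)
      have "Poly_Mapping.keys (Poly_Mapping.update k v f) = insert k (Poly_Mapping.keys f)"
        using update(2) by (simp add: keys_update)
      then have f: "f \<in> carrier F" and k: "set (letters k) \<subseteq> {1..<n}"
        using car by (auto simp: F_simps)
      obtain "is" where "k = Gen_Word is" by (cases k)
      then have k': "Poly_Mapping.single k 1 \<in> carrier F" "P (proj (Poly_Mapping.single k 1))"
        using word[of "is"] k by auto
      have "proj (Poly_Mapping.update k v f)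
          = proj f \<oplus>\<^bsub>H\<^esub> (scal v \<otimes>\<^bsub>H\<^esub> proj (Poly_Mapping.single k 1))"
        unfolding upd using f k'(1) by (simp add: proj_add proj_mult F_mult_closed scal_def)
      then show "P (proj (Poly_Mapping.update k v f))"
        using add scal f k' update.IH by simp
    qed
  qed
  then show ?thesis using assms(1) unfolding carrier_H by blast
qed

section \<open>Words in the generators and Matsumoto's theorem\<close>

lemma hecke_word_Nil: "hecke_word n q [] = \<one>\<^bsub>H\<^esub>"
  by (simp add: hecke_word_def)

lemma hecke_word_Cons: "hecke_word n q (i # is) = T i \<otimes>\<^bsub>H\<^esub> hecke_word n q is"
  by (simp add: hecke_word_def)

lemma hecke_word_closed: "set is \<subseteq> {1..<n} \<Longrightarrow> hecke_word n q is \<in> carrier H"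
  by (induction "is") (auto simp: hecke_word_Nil hecke_word_Cons)

lemma hecke_word_snoc:
  "set is \<subseteq> {1..<n} \<Longrightarrow> 1 \<le> i \<Longrightarrow> i < n \<Longrightarrow>
     hecke_word n q (is @ [i]) = hecke_word n q is \<otimes>\<^bsub>H\<^esub> T i"
  by (induction "is") (auto simp: hecke_word_Nil hecke_word_Cons H.m_assoc hecke_word_closed)

lemma reduced_permutes: "reduced_expression n w is \<Longrightarrow> w permutes {1..n}"
  using word_perm_permutes by (auto simp: reduced_expression_iff)

lemma exists_reduced_expression: "w permutes {1..n} \<Longrightarrow> \<exists>is. reduced_expression n w is"
  using exists_reduced_word by (auto simp: reduced_expression_iff)

lemma reduced_expression_length:
  "reduced_expression n w is \<Longrightarrow> length is = inv_count n w"
  by (simp add: reduced_expression_iff)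

text \<open>Matsumoto's theorem. When two reduced words start with different letters \<open>i\<close> and \<open>j\<close>,
  both are compared with a reduced word that starts with the longest element of the parabolic
  subgroup generated by \<open>s\<^sub>i\<close> and \<open>s\<^sub>j\<close>.\<close>

lemma hecke_word_reduced_cong:
  assumes "reduced_expression n w is" "reduced_expression n w js"
  shows "hecke_word n q is = hecke_word n q js"
  using assms
proof (induction "length is" arbitrary: w "is" js rule: less_induct)
  case less
  \<comment> \<open>It suffices to treat \<open>i \<le> j\<close>; otherwise the final case
    distinction exchanges the two words.\<close>
  have main: "hecke_word n q (i # is') = hecke_word n q (j # js')"
    if red: "reduced_expression n w (i # is')" "reduced_expression n w (j # js')"
      and len: "length is = Suc (length is')" "length is = Suc (length js')" and ij: "i \<le> j"
    for i j is' js'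
  proof -
    note i = reduced_expression_ConsD[OF red(1)] and j = reduced_expression_ConsD[OF red(2)]
    let ?si = "simple_transp i" and ?sj = "simple_transp j"
    have wp: "w permutes {1..n}" using reduced_permutes red(1) by blast
    have IHi: "hecke_word n q is' = hecke_word n q ks" if "reduced_expression n (w \<circ> ?si) ks" for ks
      using less.hyps[OF _ i(4) that] len by simp
    have IHj: "hecke_word n q js' = hecke_word n q ks" if "reduced_expression n (w \<circ> ?sj) ks" for ks
      using less.hyps[OF _ j(4) that] len by simp
    consider "i = j" | "i + 2 \<le> j" | "j = Suc i" using ij by linarith
    then show ?thesis
    proof cases
      case 1
      then show ?thesis using IHi[of js'] j(4) by (simp add: hecke_word_Cons)
    next
      case 2
      define u where "u = w \<circ> ?si \<circ> ?sj"
      have u': "u = w \<circ> ?sj \<circ> ?si"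
        using 2 by (auto simp: u_def fun_eq_iff simple_transp_apply)
      have "u permutes {1..n}"
        unfolding u_def using wp i(1,2) j(1,2) by (intro permutes_comp_simple_transp(1))
      then obtain ks where ks: "reduced_expression n u ks" using exists_reduced_expression by blast
      have "u j < u (Suc j)" "u i < u (Suc i)"
        using i(3) j(3) 2 by (auto simp: u_def simple_transp_apply)
      then have "reduced_expression n (w \<circ> ?si) (j # ks)" "reduced_expression n (w \<circ> ?sj) (i # ks)"
        using reduced_expression_Cons[OF ks, of j] reduced_expression_Cons[OF ks, of i] i(1,2) j(1,2)
        by (simp_all add: u_def) (simp_all add: u'[unfolded u_def])
      then have eq: "hecke_word n q is' = T j \<otimes>\<^bsub>H\<^esub> hecke_word n q ks"
        "hecke_word n q js' = T i \<otimes>\<^bsub>H\<^esub> hecke_word n q ks"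
        using IHi IHj by (simp_all add: hecke_word_Cons)
      have "hecke_word n q ks \<in> carrier H"
        using ks by (intro hecke_word_closed) (auto simp: reduced_expression_iff)
      then show ?thesis
        using T_comm[of i j] i(1,2) j(1,2) 2
        by (simp add: hecke_word_Cons eq H.m_assoc[symmetric])
    next
      case 3
      \<comment> \<open>The values of \<open>w\<close> at \<open>i\<close>, \<open>i + 1\<close>,
        \<open>i + 2\<close> decrease, so removing all three braid letters leaves \<open>u\<close>
        increasing there. A reduced word of \<open>u\<close> can then be prolonged to one of
        \<open>w\<close> by either side of the braid relation.\<close>
      define u where "u = w \<circ> ?si \<circ> ?sj \<circ> ?si"
      have u': "u = w \<circ> ?sj \<circ> ?si \<circ> ?sj"
        using 3 by (auto simp: u_def fun_eq_iff simple_transp_apply)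
      have "u permutes {1..n}"
        unfolding u_def using wp i(1,2) j(1,2) by (intro permutes_comp_simple_transp(1))
      then obtain ks where ks: "reduced_expression n u ks" using exists_reduced_expression by blast
      have u_asc: "u i < u (Suc i)" "(u \<circ> ?si) j < (u \<circ> ?si) (Suc j)"
        "u j < u (Suc j)" "(u \<circ> ?sj) i < (u \<circ> ?sj) (Suc i)"
        using i(3) j(3) 3 by (auto simp: u_def simple_transp_apply)
      have "reduced_expression n (u \<circ> ?si \<circ> ?sj) (j # i # ks)"
        "reduced_expression n (u \<circ> ?sj \<circ> ?si) (i # j # ks)"
        using u_asc ks i(1,2) j(1,2) by (blast intro: reduced_expression_Cons)+
      moreover have "u \<circ> ?si \<circ> ?sj = w \<circ> ?si" by (simp add: u_def)
      moreover have "u \<circ> ?sj \<circ> ?si = w \<circ> ?sj" by (simp add: u')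
      ultimately have eq: "hecke_word n q is' = T j \<otimes>\<^bsub>H\<^esub> (T i \<otimes>\<^bsub>H\<^esub> hecke_word n q ks)"
        "hecke_word n q js' = T i \<otimes>\<^bsub>H\<^esub> (T j \<otimes>\<^bsub>H\<^esub> hecke_word n q ks)"
        using IHi IHj by (simp_all add: hecke_word_Cons)
      have car: "hecke_word n q ks \<in> carrier H"
        using ks by (intro hecke_word_closed) (auto simp: reduced_expression_iff)
      have "T i \<otimes>\<^bsub>H\<^esub> (T j \<otimes>\<^bsub>H\<^esub> T i) \<otimes>\<^bsub>H\<^esub> hecke_word n q ks
          = T j \<otimes>\<^bsub>H\<^esub> (T i \<otimes>\<^bsub>H\<^esub> T j) \<otimes>\<^bsub>H\<^esub> hecke_word n q ks"
        using T_braid[of i] i(1,2) j(1,2) 3 by simp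
      then show ?thesis
        using car i(1,2) j(1,2) by (simp add: hecke_word_Cons eq H.m_assoc)
    qed
  qed
  show ?case
  proof (cases "is")
    case Nil
    then have "length js = 0"
      using less.prems[THEN reduced_expression_length] by simp
    then have "js = []" by simp
    then show ?thesis using Nil by simp
  next
    case (Cons i is')
    then obtain j js' where js: "js = j # js'"
      using less.prems by (cases js) (auto simp: reduced_expression_iff)
    have "length js = length is" using less.prems by (simp add: reduced_expression_length)
    then show ?thesis
      using main[of i is' j js'] main[of j js' i is'] less.prems Cons js
      by (cases "i \<le> j") auto
  qed
qed

lemma Tw_eq_word: "reduced_expression n w is \<Longrightarrow> Tw w = hecke_word n q is"
  unfolding hecke_T_def by (rule hecke_word_reduced_cong) (rule someI)

lemma Tw_closed [simp]: "w permutes {1..n} \<Longrightarrow> Tw w \<in> carrier H"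
  using exists_reduced_expression[of w] hecke_word_closed
  by (force simp: Tw_eq_word reduced_expression_iff)

lemma Tw_id: "Tw id = \<one>\<^bsub>H\<^esub>"
proof -
  obtain "is" where rd: "reduced_expression n id is"
    using exists_reduced_expression[OF permutes_id] by blast
  have "inversions n id = {}" by (auto simp: inversions_def)
  then have "is = []" using rd by (simp add: reduced_expression_iff inv_count_def del: id_def)
  then show ?thesis using Tw_eq_word[OF rd] by (simp add: hecke_word_Nil)
qed

text \<open>The left factor is applied first, so \<open>T i\<close> on the left exchanges two
  positions and ascents of \<open>w\<close> decide; on the right it exchanges two values, and
  ascents of the inverse decide.\<close>

lemma T_Tw_ascent:
  assumes "w permutes {1..n}" "1 \<le> i" "i < n" "w i < w (Suc i)"
  shows "T i \<otimes>\<^bsub>H\<^esub> Tw w = Tw (w \<circ> simple_transp i)"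
proof -
  obtain "is" where rd: "reduced_expression n w is"
    using exists_reduced_expression assms(1) by blast
  from Tw_eq_word[OF reduced_expression_Cons[OF rd assms(2-4)]] show ?thesis
    by (simp add: hecke_word_Cons Tw_eq_word[OF rd])
qed

lemma T_Tw_descent:
  assumes "w permutes {1..n}" "1 \<le> i" "i < n" "w (Suc i) < w i"
  shows "T i \<otimes>\<^bsub>H\<^esub> Tw w = (scal (q - 1) \<otimes>\<^bsub>H\<^esub> Tw w) \<oplus>\<^bsub>H\<^esub> (scal q \<otimes>\<^bsub>H\<^esub> Tw (w \<circ> simple_transp i))"
proof -
  let ?v = "w \<circ> simple_transp i"
  have v: "?v permutes {1..n}" by (rule permutes_comp_simple_transp(1)[OF assms(1-3)])
  have Tw: "Tw w = T i \<otimes>\<^bsub>H\<^esub> Tw ?v"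
    using T_Tw_ascent[OF v assms(2,3)] assms(4) by (simp add: simple_transp_apply)
  show ?thesis
    unfolding Tw using assms v
    by (simp add: H.m_assoc[symmetric] T_quadratic H.l_distr)
qed

lemma Tw_T_ascent:
  assumes "w permutes {1..n}" "1 \<le> i" "i < n" "perm_inv w i < perm_inv w (Suc i)"
  shows "Tw w \<otimes>\<^bsub>H\<^esub> T i = Tw (simple_transp i \<circ> w)"
proof -
  obtain "is" where rd: "reduced_expression n w is"
    using exists_reduced_expression assms(1) by blast
  then have "reduced_expression n (simple_transp i \<circ> w) (is @ [i])"
    using inv_count_simple_transp_comp[OF assms] assms(2,3)
    by (auto simp: reduced_expression_iff word_perm_append)
  from Tw_eq_word[OF this] show ?thesis
    using hecke_word_snoc[of "is" i] rd assms(2,3)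
    by (simp add: Tw_eq_word[OF rd] reduced_expression_iff)
qed

lemma Tw_T_descent:
  assumes "w permutes {1..n}" "1 \<le> i" "i < n" "perm_inv w (Suc i) < perm_inv w i"
  shows "Tw w \<otimes>\<^bsub>H\<^esub> T i = (scal (q - 1) \<otimes>\<^bsub>H\<^esub> Tw w) \<oplus>\<^bsub>H\<^esub> (scal q \<otimes>\<^bsub>H\<^esub> Tw (simple_transp i \<circ> w))"
proof -
  let ?v = "simple_transp i \<circ> w"
  have v: "?v permutes {1..n}" by (rule permutes_comp_simple_transp(2)[OF assms(1-3)])
  have Tw: "Tw w = Tw ?v \<otimes>\<^bsub>H\<^esub> T i"
    using Tw_T_ascent[OF v assms(2,3)] assms
    by (simp add: simple_transp_comp_eq_inv(1)[OF assms(1)] simple_transp_apply)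
  show ?thesis
    unfolding Tw using assms v
    by (simp add: H.m_assoc T_quadratic H.r_distr scal_comm scal_left_comm)
qed

end

section \<open>Sums of standard basis elements\<close>

text \<open>Indicator function of a left coset of the Young subgroup with row function
  \<open>r\<close>: multiplying \<open>w\<close> on the right by an element of the subgroup does not
  change \<open>r \<circ> w\<close>. The word \<open>f\<close> is the label of the coset.\<close>

definition row_fibre :: "(nat \<Rightarrow> nat) \<Rightarrow> (nat \<Rightarrow> nat) \<Rightarrow> (nat \<Rightarrow> nat) \<Rightarrow> 'a::field" where
  "row_fibre r f w = of_bool (r \<circ> w = f)"

text \<open>For weakly increasing \<open>r\<close> these are the shortest representatives of the
  left cosets.\<close>

definition increasing_in_rows :: "nat \<Rightarrow> (nat \<Rightarrow> nat) \<Rightarrow> (nat \<Rightarrow> nat) \<Rightarrow> bool" where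
  "increasing_in_rows n r w \<longleftrightarrow>
     (\<forall>i j. 1 \<le> i \<longrightarrow> i < j \<longrightarrow> j \<le> n \<longrightarrow> r (w i) = r (w j) \<longrightarrow> w i < w j)"

text \<open>Maximising \<open>\<Sum> i w(i)\<close> over a fibre excludes pairs that can be swapped.\<close>

lemma exists_increasing_in_rows:
  assumes w: "w permutes {1..n}"
  shows "\<exists>e. e permutes {1..n} \<and> r \<circ> e = r \<circ> w \<and> increasing_in_rows n r e"
proof -
  let ?A = "{e. e permutes {1..n} \<and> r \<circ> e = r \<circ> w}"
  let ?h = "\<lambda>e. \<Sum>i\<in>{1..n}. i * e i :: nat"
  have fin: "finite ?A"
    by (rule finite_subset[OF _ finite_permutations[of "{1..n}"]]) auto
  have "?h ` ?A \<noteq> {}" using w by blast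
  then have "Max (?h ` ?A) \<in> ?h ` ?A" using fin by (intro Max_in) auto
  then obtain e where e: "e \<in> ?A" "?h e = Max (?h ` ?A)" by (metis (no_types, lifting) imageE)
  have e_max: "?h e' \<le> ?h e" if "e' \<in> ?A" for e'
    unfolding e(2) using fin that by (intro Max_ge) auto
  have "increasing_in_rows n r e"
    unfolding increasing_in_rows_def
  proof (intro allI impI)
    fix i j assume ij: "1 \<le> i" "i < j" "j \<le> n" "r (e i) = r (e j)"
    show "e i < e j"
    proof (rule ccontr)
      assume "\<not> ?thesis"
      moreover have "e i \<noteq> e j" using permutes_inj[of e "{1..n}"] e(1) ij(2) by (auto dest: injD)
      ultimately have lt: "e j < e i" by simp
      define e' where "e' = e \<circ> transpose i j"
      have "e' permutes {1..n}"
        unfolding e'_def using e(1) ij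
        by (intro permutes_compose[of _ "{1..n}"] permutes_swap_id) auto
      moreover have "r \<circ> e' = r \<circ> e"
        using ij(4) by (auto simp: e'_def fun_eq_iff transpose_def)
      ultimately have le: "?h e' \<le> ?h e" using e(1) by (intro e_max) simp
      have split: "?h g = i * g i + j * g j + (\<Sum>k\<in>{1..n}-{i,j}. k * g k)" for g
      proof -
        have "{1..n} = {i, j} \<union> ({1..n} - {i, j})" using ij by auto
        then have "?h g = sum (\<lambda>k. k * g k) ({i, j} \<union> ({1..n} - {i, j}))" by simp
        also have "\<dots> = sum (\<lambda>k. k * g k) {i, j} + sum (\<lambda>k. k * g k) ({1..n} - {i, j})"
          by (rule sum.union_disjoint) auto
        finally show ?thesis using ij by simp
      qed
      have rest: "(\<Sum>k\<in>{1..n}-{i,j}. k * e' k) = (\<Sum>k\<in>{1..n}-{i,j}. k * e k)"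
        by (rule sum.cong) (auto simp: e'_def transpose_def)
      have "e' i = e j" "e' j = e i" by (auto simp: e'_def)
      with le have *: "i * e j + j * e i \<le> i * e i + j * e j"
        unfolding split rest by (simp only: add_le_cancel_right)
      \<comment> \<open>Rearrangement inequality: undoing the inversion would raise the weighted sum
        by \<open>(j - i) d\<close>, against maximality.\<close>
      obtain d where "e i = e j + d" "d > 0" using less_imp_add_positive[OF lt] by metis
      then have "j * d \<le> i * d" using * by (simp add: add_mult_distrib2)
      then show False using \<open>d > 0\<close> ij by simp
    qed
  qed
  then show ?thesis using e(1) by blast
qed

lemma row_fibre_comp_transp:
  "row_fibre r f (w \<circ> simple_transp i) = row_fibre r (f \<circ> simple_transp i) w"
proof -
  have "r \<circ> (w \<circ> simple_transp i) = f \<longleftrightarrow> r \<circ> w = f \<circ> simple_transp i"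
    by (metis comp_assoc comp_simple_transp_cancel)
  then show ?thesis by (simp only: row_fibre_def)
qed

lemma restricted_inv_count_increasing:
  assumes "increasing_in_rows n r w"
  shows "restricted_inv_count n (\<lambda>a b. r a = r b) w = 0"
proof -
  have "{(i, j) \<in> inversions n w. r (w i) = r (w j)} = {}"
    using assms unfolding increasing_in_rows_def inversions_def by fastforce
  then show ?thesis by (simp only: restricted_inv_count_def card.empty)
qed

context hecke_algebra
begin

abbreviation perms :: "(nat \<Rightarrow> nat) set" where "perms \<equiv> {w. w permutes {1..n}}"

lemma finite_perms [simp]: "finite perms" "finite {w. w permutes {Suc 0..n}}"
  using finite_permutations[of "{1..n}"] by simp_all

definition lincomb :: "((nat \<Rightarrow> nat) \<Rightarrow> 'a) \<Rightarrow> 'a hecke_elem" where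
  "lincomb g = (\<Oplus>\<^bsub>H\<^esub>w\<in>perms. scal (g w) \<otimes>\<^bsub>H\<^esub> Tw w)"

lemma lincomb_closed [simp]: "lincomb g \<in> carrier H"
  unfolding lincomb_def by (rule H.finsum_closed) auto

lemma lincomb_cong:
  assumes "\<And>w. w permutes {1..n} \<Longrightarrow> g w = h w"
  shows "lincomb g = lincomb h"
  unfolding lincomb_def by (rule H.finsum_cong') (auto simp: assms)

lemma lincomb_add: "lincomb (\<lambda>w. g w + h w) = lincomb g \<oplus>\<^bsub>H\<^esub> lincomb h"
proof -
  have "lincomb (\<lambda>w. g w + h w)
      = (\<Oplus>\<^bsub>H\<^esub>w\<in>perms. scal (g w) \<otimes>\<^bsub>H\<^esub> Tw w \<oplus>\<^bsub>H\<^esub> scal (h w) \<otimes>\<^bsub>H\<^esub> Tw w)"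
    unfolding lincomb_def by (rule H.finsum_cong') (auto simp: scal_add H.l_distr)
  then show ?thesis by (simp add: lincomb_def H.finsum_addf Pi_def)
qed

lemma lincomb_smult: "lincomb (\<lambda>w. c * g w) = scal c \<otimes>\<^bsub>H\<^esub> lincomb g"
proof -
  have "lincomb (\<lambda>w. c * g w) = (\<Oplus>\<^bsub>H\<^esub>w\<in>perms. scal c \<otimes>\<^bsub>H\<^esub> (scal (g w) \<otimes>\<^bsub>H\<^esub> Tw w))"
    unfolding lincomb_def by (rule H.finsum_cong') (auto simp: scal_mult H.m_assoc)
  then show ?thesis by (simp add: lincomb_def H.finsum_rdistr Pi_def)
qed

lemma lincomb_0: "lincomb (\<lambda>w. 0) = \<zero>\<^bsub>H\<^esub>"
  using lincomb_smult[of 0 "\<lambda>_. 0"] by (simp add: scal_0)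

lemma lincomb_sum:
  assumes "finite A"
  shows "lincomb (\<lambda>w. \<Sum>a\<in>A. g a w) = (\<Oplus>\<^bsub>H\<^esub>a\<in>A. lincomb (g a))"
  using assms
  by (induction A) (auto simp: lincomb_0 lincomb_add Pi_def)

lemma lincomb_of_bool:
  assumes "A \<subseteq> perms"
  shows "(\<Oplus>\<^bsub>H\<^esub>w\<in>A. Tw w) = lincomb (\<lambda>w. of_bool (w \<in> A))"
  unfolding lincomb_def
  by (rule H.add.finprod_mono_neutral_cong_left)
    (use assms in \<open>auto simp: scal_0 scal_1\<close>)

text \<open>\<open>X w\<close> is \<open>T\<^sub>i T\<^sub>w\<close> or \<open>T\<^sub>w T\<^sub>i\<close>, according as \<open>\<psi> w\<close> is \<open>w \<circ> s\<^sub>i\<close> or \<open>s\<^sub>i \<circ> w\<close>.\<close>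

lemma finsum_shift:
  assumes "\<And>w. w \<in> perms \<Longrightarrow> \<psi> w \<in> perms" "\<And>w. w \<in> perms \<Longrightarrow> \<psi> (\<psi> w) = w"
    and "\<And>w. w \<in> perms \<Longrightarrow> asc (\<psi> w) \<longleftrightarrow> \<not> asc w"
    and X: "\<And>w. w \<in> perms \<Longrightarrow> X w =
      (if asc w then Tw (\<psi> w) else (scal (q - 1) \<otimes>\<^bsub>H\<^esub> Tw w) \<oplus>\<^bsub>H\<^esub> (scal q \<otimes>\<^bsub>H\<^esub> Tw (\<psi> w)))"
  shows "(\<Oplus>\<^bsub>H\<^esub>w\<in>perms. scal (g w) \<otimes>\<^bsub>H\<^esub> X w)
    = lincomb (\<lambda>w. if asc w then q * g (\<psi> w) else g (\<psi> w) + (q - 1) * g w)"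
proof -
  let ?a = "\<lambda>w. if asc w then 1 else q" and ?b = "\<lambda>w. if asc w then 0 else q - 1"
  let ?c = "\<lambda>w. g (\<psi> w) * ?a (\<psi> w)"
  have "(\<Oplus>\<^bsub>H\<^esub>w\<in>perms. scal (g w) \<otimes>\<^bsub>H\<^esub> X w)
      = (\<Oplus>\<^bsub>H\<^esub>w\<in>perms. (scal (g w * ?a w) \<otimes>\<^bsub>H\<^esub> Tw (\<psi> w)) \<oplus>\<^bsub>H\<^esub> (scal (g w * ?b w) \<otimes>\<^bsub>H\<^esub> Tw w))"
  proof (rule H.finsum_cong'[OF refl])
    fix w assume w: "w \<in> perms"
    then have "w permutes {1..n}" "\<psi> w permutes {1..n}" using assms(1)[of w] by auto
    then show "scal (g w) \<otimes>\<^bsub>H\<^esub> X w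
      = (scal (g w * ?a w) \<otimes>\<^bsub>H\<^esub> Tw (\<psi> w)) \<oplus>\<^bsub>H\<^esub> (scal (g w * ?b w) \<otimes>\<^bsub>H\<^esub> Tw w)"
      by (simp add: X[OF w] scal_0 scal_1 scal_mult H.r_distr H.m_assoc H.a_comm)
  qed (use assms(1) in auto)
  also have "\<dots> = (\<Oplus>\<^bsub>H\<^esub>w\<in>perms. scal (g w * ?a w) \<otimes>\<^bsub>H\<^esub> Tw (\<psi> w)) \<oplus>\<^bsub>H\<^esub> lincomb (\<lambda>w. g w * ?b w)"
    unfolding lincomb_def using assms(1) by (intro H.finsum_addf) (auto simp: Pi_def)
  also have "(\<Oplus>\<^bsub>H\<^esub>w\<in>perms. scal (g w * ?a w) \<otimes>\<^bsub>H\<^esub> Tw (\<psi> w)) = lincomb ?c"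
  proof -
    have img: "\<psi> ` perms = perms"
    proof
      show "perms \<subseteq> \<psi> ` perms"
      proof
        fix w assume "w \<in> perms"
        then show "w \<in> \<psi> ` perms" using assms(1,2)[of w] by (intro image_eqI[of _ _ "\<psi> w"]) simp_all
      qed
    qed (use assms(1) in blast)
    have "inj_on \<psi> perms" using assms(2) by (metis inj_onI)
    then have "(\<Oplus>\<^bsub>H\<^esub>w\<in>\<psi> ` perms. scal (?c w) \<otimes>\<^bsub>H\<^esub> Tw w)
        = (\<Oplus>\<^bsub>H\<^esub>w\<in>perms. scal (?c (\<psi> w)) \<otimes>\<^bsub>H\<^esub> Tw (\<psi> w))"
      using assms(1) by (intro H.finsum_reindex) (auto simp: Pi_def)
    also have "\<dots> = (\<Oplus>\<^bsub>H\<^esub>w\<in>perms. scal (g w * ?a w) \<otimes>\<^bsub>H\<^esub> Tw (\<psi> w))"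
      using assms(1) by (intro H.finsum_cong') (auto simp: Pi_def assms(2))
    finally show ?thesis unfolding img lincomb_def by simp
  qed
  also have "lincomb ?c \<oplus>\<^bsub>H\<^esub> lincomb (\<lambda>w. g w * ?b w) = lincomb (\<lambda>w. ?c w + g w * ?b w)"
    by (rule lincomb_add[symmetric])
  also have "\<dots> = lincomb (\<lambda>w. if asc w then q * g (\<psi> w) else g (\<psi> w) + (q - 1) * g w)"
    by (rule lincomb_cong) (use assms(3) in \<open>auto simp: mult.commute\<close>)
  finally show ?thesis .
qed

text \<open>Coefficients of \<open>T i\<close> times the element with coefficients \<open>g\<close>.
  At an ascent \<open>w\<close> the only contribution is the scalar part \<open>q\<close> of the
  quadratic relation for the descent \<open>w \<circ> simple_transp i\<close>; at a descent, the
  ascent below it and the part \<open>q - 1\<close> contribute.\<close>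

definition left_shift :: "nat \<Rightarrow> ((nat \<Rightarrow> nat) \<Rightarrow> 'a) \<Rightarrow> (nat \<Rightarrow> nat) \<Rightarrow> 'a" where
  "left_shift i g w = (if w i < w (Suc i) then q * g (w \<circ> simple_transp i)
     else g (w \<circ> simple_transp i) + (q - 1) * g w)"

lemma T_lincomb:
  assumes "1 \<le> i" "i < n"
  shows "T i \<otimes>\<^bsub>H\<^esub> lincomb g = lincomb (left_shift i g)"
proof -
  have "T i \<otimes>\<^bsub>H\<^esub> lincomb g = (\<Oplus>\<^bsub>H\<^esub>w\<in>perms. scal (g w) \<otimes>\<^bsub>H\<^esub> (T i \<otimes>\<^bsub>H\<^esub> Tw w))"
    unfolding lincomb_def using assms
    by (subst H.finsum_rdistr) (simp_all add: Pi_def scal_left_comm cong: H.finsum_cong)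
  also have "\<dots> = lincomb (left_shift i g)"
    unfolding left_shift_def
  proof (rule finsum_shift)
    fix w assume "w \<in> perms"
    then have w: "w permutes {1..n}" by simp
    show "w \<circ> simple_transp i \<in> perms" using permutes_comp_simple_transp(1)[OF w assms] by simp
    show "(w \<circ> simple_transp i) i < (w \<circ> simple_transp i) (Suc i) \<longleftrightarrow> \<not> w i < w (Suc i)"
      using permutes_neq_Suc[OF w, of i] by (auto simp: simple_transp_apply)
    show "T i \<otimes>\<^bsub>H\<^esub> Tw w = (if w i < w (Suc i) then Tw (w \<circ> simple_transp i)
        else (scal (q - 1) \<otimes>\<^bsub>H\<^esub> Tw w) \<oplus>\<^bsub>H\<^esub> (scal q \<otimes>\<^bsub>H\<^esub> Tw (w \<circ> simple_transp i)))"
      using T_Tw_ascent[OF w assms] T_Tw_descent[OF w assms] permutes_neq_Suc[OF w, of i] by auto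
  qed (rule comp_simple_transp_cancel)
  finally show ?thesis .
qed

text \<open>Inversion of permutations turns right multiplication into left multiplication, so the
  same operator \<open>left_shift\<close> serves both sides and the fibre computations are done
  once.\<close>

lemma lincomb_T:
  assumes "1 \<le> i" "i < n"
  shows "lincomb (\<lambda>w. g (perm_inv w)) \<otimes>\<^bsub>H\<^esub> T i = lincomb (\<lambda>w. left_shift i g (perm_inv w))"
proof -
  let ?\<psi> = "\<lambda>w. simple_transp i \<circ> w"
  have inv: "perm_inv (?\<psi> w) = perm_inv w \<circ> simple_transp i" if "w permutes {1..n}" for w
    using simple_transp_comp_eq_inv(1)[OF that] .
  have neq: "perm_inv w i \<noteq> perm_inv w (Suc i)" if "w permutes {1..n}" for w
    using permutes_neq_Suc[OF permutes_inv[OF that]] .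
  have "lincomb (\<lambda>w. g (perm_inv w)) \<otimes>\<^bsub>H\<^esub> T i
      = (\<Oplus>\<^bsub>H\<^esub>w\<in>perms. scal (g (perm_inv w)) \<otimes>\<^bsub>H\<^esub> (Tw w \<otimes>\<^bsub>H\<^esub> T i))"
    unfolding lincomb_def using assms
    by (subst H.finsum_ldistr) (simp_all add: Pi_def H.m_assoc cong: H.finsum_cong)
  also have "\<dots> = lincomb (\<lambda>w. if perm_inv w i < perm_inv w (Suc i) then q * g (perm_inv (?\<psi> w))
      else g (perm_inv (?\<psi> w)) + (q - 1) * g (perm_inv w))"
  proof (rule finsum_shift)
    fix w assume "w \<in> perms"
    then have w: "w permutes {1..n}" by simp
    show "?\<psi> w \<in> perms" using permutes_comp_simple_transp(2)[OF w assms] by simp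
    show "perm_inv (?\<psi> w) i < perm_inv (?\<psi> w) (Suc i) \<longleftrightarrow> \<not> perm_inv w i < perm_inv w (Suc i)"
      using neq[OF w] by (auto simp: inv[OF w] simple_transp_apply)
    show "Tw w \<otimes>\<^bsub>H\<^esub> T i = (if perm_inv w i < perm_inv w (Suc i) then Tw (?\<psi> w)
        else (scal (q - 1) \<otimes>\<^bsub>H\<^esub> Tw w) \<oplus>\<^bsub>H\<^esub> (scal q \<otimes>\<^bsub>H\<^esub> Tw (?\<psi> w)))"
      using Tw_T_ascent[OF w assms] Tw_T_descent[OF w assms] neq[OF w] by auto
  qed (rule simple_transp_comp_cancel)
  also have "\<dots> = lincomb (\<lambda>w. left_shift i g (perm_inv w))"
    by (rule lincomb_cong) (simp add: left_shift_def inv)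
  finally show ?thesis .
qed

text \<open>The usual action of a generator on a permutation module, with words as labels:
  increasing neighbours are swapped, equal ones give the factor \<open>q\<close>, decreasing ones
  follow the quadratic relation. Monotonicity of \<open>r\<close> lets the order of the letters
  decide between ascents and descents of \<open>w\<close>.\<close>

lemma left_shift_row_fibre:
  assumes r: "mono_on {1..n} r" and w: "w permutes {1..n}" and i: "1 \<le> i" "i < n"
  shows "f i < f (Suc i) \<Longrightarrow>
      left_shift i (row_fibre r f) w = row_fibre r (f \<circ> simple_transp i) w"
    and "f i = f (Suc i) \<Longrightarrow> left_shift i (row_fibre r f) w = q * row_fibre r f w"
    and "f i > f (Suc i) \<Longrightarrow> left_shift i (row_fibre r f) w =
      q * row_fibre r (f \<circ> simple_transp i) w + (q - 1) * row_fibre r f w"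
proof -
  let ?s = "simple_transp i"
  have ran: "w i \<in> {1..n}" "w (Suc i) \<in> {1..n}" using permutes_in_image[OF w] i by auto
  have le: "r (w i) \<le> r (w (Suc i))" if "w i < w (Suc i)"
    using mono_onD[OF r ran] that by simp
  have ge: "r (w (Suc i)) \<le> r (w i)" if "\<not> w i < w (Suc i)"
    using mono_onD[OF r ran(2,1)] that by simp
  have val: "f i = r (w i)" "f (Suc i) = r (w (Suc i))" if "r \<circ> w = f"
    using that by auto
  have val': "f i = r (w (Suc i))" "f (Suc i) = r (w i)" if "r \<circ> w = f \<circ> ?s"
    using fun_cong[OF that, of i] fun_cong[OF that, of "Suc i"] by (auto simp: simple_transp_apply)
  \<comment> \<open>Here every \<open>w\<close> in the fibre of \<open>f\<close> has an ascent at
    \<open>i\<close>, and every \<open>w\<close> in the swapped fibre a descent, so the unwanted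
    term of \<open>left_shift\<close> vanishes in each case.\<close>
  show "left_shift i (row_fibre r f) w = row_fibre r (f \<circ> ?s) w" if "f i < f (Suc i)"
  proof (cases "w i < w (Suc i)")
    case True
    then have "r \<circ> w \<noteq> f \<circ> ?s" using le that val' by fastforce
    then show ?thesis using True by (simp only: left_shift_def row_fibre_comp_transp) (simp add: row_fibre_def)
  next
    case False
    then have "r \<circ> w \<noteq> f" using ge that val by fastforce
    then have "row_fibre r f w = (0 :: 'a)" by (simp only: row_fibre_def of_bool_eq)
    then show ?thesis using False by (simp only: left_shift_def row_fibre_comp_transp) simp
  qed
  show "left_shift i (row_fibre r f) w = q * row_fibre r f w" if "f i = f (Suc i)"
  proof -
    have "f \<circ> ?s = f" using that by (auto simp: fun_eq_iff simple_transp_apply)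
    then show ?thesis by (simp add: left_shift_def row_fibre_comp_transp[unfolded comp_def] comp_def algebra_simps)
  qed
  show "left_shift i (row_fibre r f) w =
      q * row_fibre r (f \<circ> ?s) w + (q - 1) * row_fibre r f w" if "f i > f (Suc i)"
  proof (cases "w i < w (Suc i)")
    case True
    then have "r \<circ> w \<noteq> f" using le that val by fastforce
    then have "row_fibre r f w = (0 :: 'a)" by (simp only: row_fibre_def of_bool_eq)
    then show ?thesis using True by (simp only: left_shift_def row_fibre_comp_transp) simp
  next
    case False
    then have "r \<circ> w \<noteq> f \<circ> ?s" using ge that val' by fastforce
    then have "row_fibre r (f \<circ> ?s) w = (0 :: 'a)" by (simp only: row_fibre_def of_bool_eq)
    then show ?thesis using False by (simp only: left_shift_def row_fibre_comp_transp) simp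
  qed
qed

text \<open>The fibre over \<open>r\<close> itself is the Young subgroup, so this is
  \<open>x_\<lambda>\<close>; see \<open>hecke_x_eq\<close>.\<close>

definition young_sum :: "(nat \<Rightarrow> nat) \<Rightarrow> 'a hecke_elem" where
  "young_sum r = lincomb (row_fibre r r)"

lemma young_sum_closed [simp]: "young_sum r \<in> carrier H"
  by (simp add: young_sum_def)

lemma T_row_fibre:
  assumes "mono_on {1..n} r" "1 \<le> i" "i < n"
  shows "f i < f (Suc i) \<Longrightarrow>
      T i \<otimes>\<^bsub>H\<^esub> lincomb (row_fibre r f) = lincomb (row_fibre r (f \<circ> simple_transp i))"
    and "f i = f (Suc i) \<Longrightarrow>
      T i \<otimes>\<^bsub>H\<^esub> lincomb (row_fibre r f) = scal q \<otimes>\<^bsub>H\<^esub> lincomb (row_fibre r f)"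
  unfolding T_lincomb[OF assms(2,3)] lincomb_smult[symmetric]
  by (rule lincomb_cong, simp only: left_shift_row_fibre[OF assms(1) _ assms(2,3)])+

lemma row_fibre_T:
  assumes "mono_on {1..n} r" "1 \<le> i" "i < n"
  shows "f i < f (Suc i) \<Longrightarrow>
      lincomb (\<lambda>w. row_fibre r f (perm_inv w)) \<otimes>\<^bsub>H\<^esub> T i
      = lincomb (\<lambda>w. row_fibre r (f \<circ> simple_transp i) (perm_inv w))"
    and "f i = f (Suc i) \<Longrightarrow>
      lincomb (\<lambda>w. row_fibre r f (perm_inv w)) \<otimes>\<^bsub>H\<^esub> T i
      = scal q \<otimes>\<^bsub>H\<^esub> lincomb (\<lambda>w. row_fibre r f (perm_inv w))"
    and "f i > f (Suc i) \<Longrightarrow>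
      lincomb (\<lambda>w. row_fibre r f (perm_inv w)) \<otimes>\<^bsub>H\<^esub> T i
      = (scal q \<otimes>\<^bsub>H\<^esub> lincomb (\<lambda>w. row_fibre r (f \<circ> simple_transp i) (perm_inv w)))
        \<oplus>\<^bsub>H\<^esub> (scal (q - 1) \<otimes>\<^bsub>H\<^esub> lincomb (\<lambda>w. row_fibre r f (perm_inv w)))"
  unfolding lincomb_T[OF assms(2,3)] lincomb_smult[symmetric] lincomb_add[symmetric]
  by (rule lincomb_cong, simp only: left_shift_row_fibre[OF assms(1) permutes_inv assms(2,3)])+

text \<open>A subgroup is closed under inverses, so its sum is a left and a right coset sum at
  once.\<close>

lemma young_sum_right:
  "young_sum r = lincomb (\<lambda>w. row_fibre r r (perm_inv w))"
  unfolding young_sum_def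
proof (rule lincomb_cong)
  fix w assume w: "w permutes {1..n}"
  have "r \<circ> w = r \<longleftrightarrow> r \<circ> perm_inv w = r"
    using permutes_inv_o[OF w] by (metis comp_assoc comp_id)
  then show "row_fibre r r w = row_fibre r r (perm_inv w)" by (simp only: row_fibre_def)
qed

text \<open>Peel \<open>w\<close> from the left by descents. Each generator either moves on to a new
  coset, or multiplies by \<open>q\<close> when the two adjacent letters of the word agree; the
  latter steps are exactly those at which \<open>restricted_inv_count\<close> grows.\<close>

lemma Tw_young_sum:
  assumes r: "mono_on {1..n} r" and "w permutes {1..n}"
  shows "Tw w \<otimes>\<^bsub>H\<^esub> young_sum r = scal (q ^ restricted_inv_count n (\<lambda>a b. r a = r b) w)
    \<otimes>\<^bsub>H\<^esub> lincomb (row_fibre r (r \<circ> w))"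
  using assms(2)
proof (induction "inv_count n w" arbitrary: w)
  case 0
  then have "w = id" using inv_count_0_imp_id by metis
  moreover have "restricted_inv_count n (\<lambda>a b. r a = r b) id = 0"
    by (rule restricted_inv_count_increasing) (simp add: increasing_in_rows_def)
  ultimately show ?case
    by (simp only: Tw_id comp_id power_0 scal_1 H.l_one young_sum_closed lincomb_closed)
      (simp only: young_sum_def)
next
  case (Suc k)
  then obtain i where i: "1 \<le> i" "i < n" "w (Suc i) < w i"
    using exists_descent[of w n] by auto
  define v where "v = w \<circ> simple_transp i"
  have v: "v permutes {1..n}" unfolding v_def by (rule permutes_comp_simple_transp(1)[OF Suc.prems i(1,2)])
  have w: "w = v \<circ> simple_transp i" by (simp add: v_def)
  have asc: "v i < v (Suc i)" using i(3) by (simp add: v_def simple_transp_apply)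
  have "k = inv_count n v"
    using inv_count_comp_simple_transp[OF i(1,2) asc] Suc.hyps(2) w by simp
  note IH = Suc.hyps(1)[OF this v]
  have "v i \<in> {1..n}" "v (Suc i) \<in> {1..n}" using permutes_in_image[OF v] i by auto
  then have le: "(r \<circ> v) i \<le> (r \<circ> v) (Suc i)" using mono_onD[OF r] asc by simp
  let ?k = "restricted_inv_count n (\<lambda>a b. r a = r b)"
  have k: "?k w = ?k v + (if r (v (Suc i)) = r (v i) then 1 else 0)"
    unfolding w by (rule restricted_inv_count_comp_simple_transp[OF i(1,2) asc])
  have "Tw w \<otimes>\<^bsub>H\<^esub> young_sum r = T i \<otimes>\<^bsub>H\<^esub> (Tw v \<otimes>\<^bsub>H\<^esub> young_sum r)"
    using T_Tw_ascent[OF v i(1,2) asc] i(1,2) v by (simp add: w[symmetric] H.m_assoc[symmetric])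
  also have "\<dots> = scal (q ^ ?k v) \<otimes>\<^bsub>H\<^esub> (T i \<otimes>\<^bsub>H\<^esub> lincomb (row_fibre r (r \<circ> v)))"
    unfolding IH using i by (simp add: scal_left_comm)
  also have "\<dots> = scal (q ^ ?k w) \<otimes>\<^bsub>H\<^esub> lincomb (row_fibre r (r \<circ> w))"
  proof (cases "(r \<circ> v) i = (r \<circ> v) (Suc i)")
    case True
    then have "r \<circ> w = r \<circ> v" by (auto simp: w fun_eq_iff simple_transp_apply)
    then show ?thesis
      unfolding T_row_fibre(2)[OF r i(1,2) True] using True k
      by (simp add: H.m_assoc[symmetric] scal_mult[symmetric] mult.commute)
  next
    case False
    then have lt: "(r \<circ> v) i < (r \<circ> v) (Suc i)" using le by simp
    show ?thesis
      unfolding T_row_fibre(1)[OF r i(1,2) lt] using False k by (simp add: w comp_assoc)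
  qed
  finally show ?case .
qed

text \<open>The mirror image of \<open>Tw_young_sum\<close>, peeling off the last factor instead of
  the first.\<close>

lemma young_sum_Tw:
  assumes r: "mono_on {1..n} r" and "w permutes {1..n}"
  shows "young_sum r \<otimes>\<^bsub>H\<^esub> Tw w =
    scal (q ^ restricted_inv_count n (\<lambda>a b. r a = r b) (perm_inv w))
    \<otimes>\<^bsub>H\<^esub> lincomb (\<lambda>v. row_fibre r (r \<circ> perm_inv w) (perm_inv v))"
  using assms(2)
proof (induction "inv_count n w" arbitrary: w)
  case 0
  then have "w = id" using inv_count_0_imp_id by metis
  moreover have "restricted_inv_count n (\<lambda>a b. r a = r b) id = 0"
    by (rule restricted_inv_count_increasing) (simp add: increasing_in_rows_def)
  ultimately show ?case
    by (simp only: Tw_id inv_id comp_id power_0 scal_1 H.l_one H.r_one young_sum_closed lincomb_closed)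
      (simp only: young_sum_right)
next
  case (Suc k)
  let ?i = perm_inv
  obtain i where i: "1 \<le> i" "i < n" "?i w (Suc i) < ?i w i"
    using exists_descent[OF permutes_inv[OF Suc.prems]] inv_count_inv[OF Suc.prems] Suc.hyps(2) by auto
  define v where "v = simple_transp i \<circ> w"
  have v: "v permutes {1..n}" unfolding v_def by (rule permutes_comp_simple_transp(2)[OF Suc.prems i(1,2)])
  have w: "w = simple_transp i \<circ> v" by (simp add: v_def)
  have iv: "?i v = ?i w \<circ> simple_transp i"
    unfolding v_def by (rule simple_transp_comp_eq_inv(1)[OF Suc.prems])
  then have iw: "?i w = ?i v \<circ> simple_transp i" by simp
  have asc: "?i v i < ?i v (Suc i)" using i(3) by (simp add: iv simple_transp_apply)
  have "k = inv_count n v"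
    using inv_count_simple_transp_comp[OF v i(1,2) asc] Suc.hyps(2) w by simp
  note IH = Suc.hyps(1)[OF this v]
  have "?i v i \<in> {1..n}" "?i v (Suc i) \<in> {1..n}" using permutes_in_image[OF permutes_inv[OF v]] i by auto
  then have le: "(r \<circ> ?i v) i \<le> (r \<circ> ?i v) (Suc i)" using mono_onD[OF r] asc by simp
  let ?k = "restricted_inv_count n (\<lambda>a b. r a = r b)"
  have k: "?k (?i w) = ?k (?i v) + (if r (?i v (Suc i)) = r (?i v i) then 1 else 0)"
    unfolding iw by (rule restricted_inv_count_comp_simple_transp[OF i(1,2) asc])
  have "young_sum r \<otimes>\<^bsub>H\<^esub> Tw w = (young_sum r \<otimes>\<^bsub>H\<^esub> Tw v) \<otimes>\<^bsub>H\<^esub> T i"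
    using Tw_T_ascent[OF v i(1,2) asc] i(1,2) v by (simp add: w[symmetric] H.m_assoc)
  also have "\<dots> = scal (q ^ ?k (?i v)) \<otimes>\<^bsub>H\<^esub> (lincomb (\<lambda>u. row_fibre r (r \<circ> ?i v) (?i u)) \<otimes>\<^bsub>H\<^esub> T i)"
    unfolding IH using i by (simp add: H.m_assoc)
  also have "\<dots> = scal (q ^ ?k (?i w)) \<otimes>\<^bsub>H\<^esub> lincomb (\<lambda>u. row_fibre r (r \<circ> ?i w) (?i u))"
  proof (cases "(r \<circ> ?i v) i = (r \<circ> ?i v) (Suc i)")
    case True
    then have "r \<circ> ?i w = r \<circ> ?i v" by (auto simp: iw fun_eq_iff simple_transp_apply)
    then show ?thesis
      unfolding row_fibre_T(2)[OF r i(1,2) True] using True k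
      by (simp add: H.m_assoc[symmetric] scal_mult[symmetric] mult.commute)
  next
    case False
    then have lt: "(r \<circ> ?i v) i < (r \<circ> ?i v) (Suc i)" using le by simp
    show ?thesis
      unfolding row_fibre_T(1)[OF r i(1,2) lt] using False k by (simp add: iw comp_assoc)
  qed
  finally show ?case .
qed

section \<open>Coset representatives and factoring out a Young sum\<close>

definition rows_of_perms :: "(nat \<Rightarrow> nat) \<Rightarrow> (nat \<Rightarrow> nat) set" where
  "rows_of_perms r = (\<lambda>w. r \<circ> w) ` perms"

definition min_rep :: "(nat \<Rightarrow> nat) \<Rightarrow> (nat \<Rightarrow> nat) \<Rightarrow> nat \<Rightarrow> nat" where
  "min_rep r f = (SOME e. e permutes {1..n} \<and> r \<circ> e = f \<and> increasing_in_rows n r e)"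

lemma finite_rows_of_perms [simp]: "finite (rows_of_perms r)"
  by (simp add: rows_of_perms_def)

lemma min_rep:
  assumes "f \<in> rows_of_perms r"
  shows "min_rep r f permutes {1..n}" "r \<circ> min_rep r f = f" "increasing_in_rows n r (min_rep r f)"
proof -
  obtain w where "w permutes {1..n}" "f = r \<circ> w" using assms by (auto simp: rows_of_perms_def)
  then have "\<exists>e. e permutes {1..n} \<and> r \<circ> e = f \<and> increasing_in_rows n r e"
    using exists_increasing_in_rows by blast
  from someI_ex[OF this] show "min_rep r f permutes {1..n}" "r \<circ> min_rep r f = f"
    "increasing_in_rows n r (min_rep r f)"
    unfolding min_rep_def by blast+
qed

lemma Tw_min_rep_closed [simp]: "f \<in> rows_of_perms r \<Longrightarrow> Tw (min_rep r f) \<in> carrier H"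
  by (intro Tw_closed min_rep(1))

lemma Tw_min_rep_young_sum:
  assumes "mono_on {1..n} r" "f \<in> rows_of_perms r"
  shows "Tw (min_rep r f) \<otimes>\<^bsub>H\<^esub> young_sum r = lincomb (row_fibre r f)"
  using Tw_young_sum[OF assms(1) min_rep(1)[OF assms(2)]] min_rep(2,3)[OF assms(2)]
  by (simp add: restricted_inv_count_increasing scal_1)

lemma young_sum_Tw_min_rep:
  assumes "mono_on {1..n} r" "f \<in> rows_of_perms r"
  shows "young_sum r \<otimes>\<^bsub>H\<^esub> Tw (perm_inv (min_rep r f)) = lincomb (\<lambda>w. row_fibre r f (perm_inv w))"
  using young_sum_Tw[OF assms(1) permutes_inv[OF min_rep(1)[OF assms(2)]]] min_rep[OF assms(2)]
  by (simp add: restricted_inv_count_increasing scal_1 permutes_inv_inv)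

text \<open>Each \<open>w\<close> lies in exactly one fibre, that of \<open>r \<circ> w\<close>, so
  a single summand survives.\<close>

lemma sum_row_fibre:
  assumes w: "w permutes {1..n}"
    and dep: "\<And>v w. v permutes {1..n} \<Longrightarrow> w permutes {1..n} \<Longrightarrow> r \<circ> v = r \<circ> w \<Longrightarrow> \<phi> v = \<phi> w"
  shows "\<phi> w = (\<Sum>f\<in>rows_of_perms r. \<phi> (min_rep r f) * row_fibre r f w)"
proof -
  have f: "r \<circ> w \<in> rows_of_perms r" using w by (auto simp: rows_of_perms_def)
  have "(\<Sum>f\<in>rows_of_perms r. \<phi> (min_rep r f) * row_fibre r f w)
      = (\<Sum>f\<in>rows_of_perms r. if f = r \<circ> w then \<phi> w else 0)"
  proof (rule sum.cong[OF refl])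
    fix f assume "f \<in> rows_of_perms r"
    then show "\<phi> (min_rep r f) * row_fibre r f w = (if f = r \<circ> w then \<phi> w else 0)"
      using dep[of "min_rep r f" w] min_rep w by (simp only: row_fibre_def) auto
  qed
  then show ?thesis using f by simp
qed

text \<open>Every coset sum is \<open>T_e\<close> times the Young sum for its increasing
  representative \<open>e\<close>. Collecting the coefficients gives an explicit left cofactor,
  which \<open>refined_sum_factors\<close> rewrites term by term.\<close>

lemma left_factorisation:
  assumes r: "mono_on {1..n} r"
    and dep: "\<And>v w. v permutes {1..n} \<Longrightarrow> w permutes {1..n} \<Longrightarrow> r \<circ> v = r \<circ> w \<Longrightarrow> \<phi> v = \<phi> w"
  shows "lincomb \<phi> = (\<Oplus>\<^bsub>H\<^esub>f\<in>rows_of_perms r. scal (\<phi> (min_rep r f)) \<otimes>\<^bsub>H\<^esub> Tw (min_rep r f))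
    \<otimes>\<^bsub>H\<^esub> young_sum r"
proof -
  have "lincomb \<phi> = lincomb (\<lambda>w. \<Sum>f\<in>rows_of_perms r. \<phi> (min_rep r f) * row_fibre r f w)"
    by (rule lincomb_cong, rule sum_row_fibre[where \<phi> = \<phi>, OF _ dep])
  also have "\<dots> = (\<Oplus>\<^bsub>H\<^esub>f\<in>rows_of_perms r. scal (\<phi> (min_rep r f)) \<otimes>\<^bsub>H\<^esub> lincomb (row_fibre r f))"
    by (simp add: lincomb_sum lincomb_smult)
  also have "\<dots> = (\<Oplus>\<^bsub>H\<^esub>f\<in>rows_of_perms r.
      scal (\<phi> (min_rep r f)) \<otimes>\<^bsub>H\<^esub> Tw (min_rep r f) \<otimes>\<^bsub>H\<^esub> young_sum r)"
    by (rule H.finsum_cong') (simp_all add: Tw_min_rep_young_sum[OF r] H.m_assoc min_rep(1) Pi_def)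
  also have "\<dots> = (\<Oplus>\<^bsub>H\<^esub>f\<in>rows_of_perms r. scal (\<phi> (min_rep r f)) \<otimes>\<^bsub>H\<^esub> Tw (min_rep r f))
    \<otimes>\<^bsub>H\<^esub> young_sum r"
    by (rule H.finsum_ldistr[symmetric]) (auto simp: min_rep(1))
  finally show ?thesis .
qed

lemma left_factor:
  assumes "mono_on {1..n} r"
    and "\<And>v w. v permutes {1..n} \<Longrightarrow> w permutes {1..n} \<Longrightarrow> r \<circ> v = r \<circ> w \<Longrightarrow> \<phi> v = \<phi> w"
  shows "\<exists>h\<in>carrier H. lincomb \<phi> = h \<otimes>\<^bsub>H\<^esub> young_sum r"
proof (rule bexI)
  show "lincomb \<phi> = (\<Oplus>\<^bsub>H\<^esub>f\<in>rows_of_perms r. scal (\<phi> (min_rep r f)) \<otimes>\<^bsub>H\<^esub> Tw (min_rep r f))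
    \<otimes>\<^bsub>H\<^esub> young_sum r"
    using assms by (rule left_factorisation)
qed (auto simp: min_rep(1) intro!: H.finsum_closed)

text \<open>Right cosets are the fibres of \<open>w \<mapsto> r \<circ> perm_inv w\<close>, and the
  inverses of the increasing representatives serve as cofactors.\<close>

lemma right_factor:
  assumes r: "mono_on {1..n} r"
    and dep: "\<And>v w. v permutes {1..n} \<Longrightarrow> w permutes {1..n} \<Longrightarrow> r \<circ> perm_inv v = r \<circ> perm_inv w \<Longrightarrow> \<phi> v = \<phi> w"
  shows "\<exists>h\<in>carrier H. lincomb \<phi> = young_sum r \<otimes>\<^bsub>H\<^esub> h"
proof -
  let ?\<phi> = "\<lambda>w. \<phi> (perm_inv w)"
  let ?t = "\<lambda>f. scal (?\<phi> (min_rep r f)) \<otimes>\<^bsub>H\<^esub> Tw (perm_inv (min_rep r f))"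
  have car: "Tw (perm_inv (min_rep r f)) \<in> carrier H" if "f \<in> rows_of_perms r" for f
    using min_rep(1)[OF that] by (simp add: permutes_inv)
  have "lincomb \<phi> = lincomb (\<lambda>w. \<Sum>f\<in>rows_of_perms r. ?\<phi> (min_rep r f) * row_fibre r f (perm_inv w))"
  proof (rule lincomb_cong)
    fix w assume w: "w permutes {1..n}"
    have "?\<phi> (perm_inv w) = (\<Sum>f\<in>rows_of_perms r. ?\<phi> (min_rep r f) * row_fibre r f (perm_inv w))"
      by (rule sum_row_fibre[OF permutes_inv[OF w]])
        (use dep in \<open>simp add: permutes_inv permutes_inv_inv\<close>)
    then show "\<phi> w = (\<Sum>f\<in>rows_of_perms r. ?\<phi> (min_rep r f) * row_fibre r f (perm_inv w))"
      using permutes_inv_inv[OF w] by simp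
  qed
  also have "\<dots> = (\<Oplus>\<^bsub>H\<^esub>f\<in>rows_of_perms r. scal (?\<phi> (min_rep r f))
      \<otimes>\<^bsub>H\<^esub> lincomb (\<lambda>w. row_fibre r f (perm_inv w)))"
    by (simp add: lincomb_sum lincomb_smult)
  also have "\<dots> = (\<Oplus>\<^bsub>H\<^esub>f\<in>rows_of_perms r. young_sum r \<otimes>\<^bsub>H\<^esub> ?t f)"
    using car by (intro H.finsum_cong') (simp_all add: young_sum_Tw_min_rep[OF r] scal_left_comm Pi_def)
  also have "\<dots> = young_sum r \<otimes>\<^bsub>H\<^esub> (\<Oplus>\<^bsub>H\<^esub>f\<in>rows_of_perms r. ?t f)"
    using car by (intro H.finsum_rdistr[symmetric]) auto
  finally show ?thesis using car by (intro bexI) (auto intro!: H.finsum_closed)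
qed

end

section \<open>Quantum binomial coefficients and weighted subset sums\<close>

lemma quantum_int_0 [simp]: "quantum_int 0 = 0"
  by (simp add: quantum_int_def)

lemma quantum_int_add: "quantum_int (c + d) = quantum_int c + monom 1 c * quantum_int d"
proof (induction d)
  case (Suc d)
  have "quantum_int (c + Suc d) = quantum_int (c + d) + (monom 1 (c + d) :: 'a poly)"
    by (simp add: quantum_int_def)
  moreover have "quantum_int (Suc d) = quantum_int d + (monom 1 d :: 'a poly)"
    by (simp add: quantum_int_def)
  ultimately show ?case using Suc by (simp add: distrib_left mult_monom)
qed simp

lemma quantum_fact_0 [simp]: "quantum_fact 0 = 1"
  by (simp add: quantum_fact_def)

lemma quantum_fact_Suc: "quantum_fact (Suc k) = quantum_int (Suc k) * quantum_fact k"
  by (simp add: quantum_fact_def mult.commute)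

lemma quantum_int_nonzero: "quantum_int (Suc k) \<noteq> (0 :: 'a::field poly)"
proof
  assume "quantum_int (Suc k) = (0 :: 'a poly)"
  then have "coeff (quantum_int (Suc k) :: 'a poly) 0 = 0" by simp
  then show False by (simp add: quantum_int_def coeff_sum lessThan_Suc_eq_insert_0)
qed

lemma quantum_fact_nonzero [simp]: "quantum_fact k \<noteq> (0 :: 'a::field poly)"
  by (induction k) (simp_all add: quantum_fact_Suc quantum_int_nonzero)

text \<open>Gaussian polynomials by the \<open>q\<close>-Pascal rule, free of division; they show
  that the division in \<open>quantum_binomial\<close> is exact and evaluate it.\<close>

fun gauss_poly :: "nat \<Rightarrow> nat \<Rightarrow> 'a::field poly" where
  "gauss_poly a 0 = 1"
| "gauss_poly 0 (Suc b) = 0"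
| "gauss_poly (Suc a) (Suc b) = gauss_poly a (Suc b) + monom 1 (a - b) * gauss_poly a b"

lemma gauss_poly_eq_0: "a < b \<Longrightarrow> gauss_poly a b = 0"
  by (induction a b rule: gauss_poly.induct) auto

text \<open>The step rests on \<open>[a + 1] = [a - b] + q^(a - b) [b + 1]\<close>.\<close>

lemma gauss_poly_fact:
  "b \<le> a \<Longrightarrow> gauss_poly a b * (quantum_fact b * quantum_fact (a - b)) = quantum_fact a"
proof (induction a b rule: gauss_poly.induct)
  case (3 a b)
  then have ba: "b \<le> a" by simp
  have 1: "gauss_poly a (Suc b) * (quantum_fact (Suc b) * quantum_fact (a - b))
      = quantum_int (a - b) * (quantum_fact a :: 'a poly)"
  proof (cases "b = a")
    case True
    then show ?thesis by (simp add: gauss_poly_eq_0)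
  next
    case False
    then have "a - b = Suc (a - Suc b)" using ba by simp
    then have "quantum_fact (a - b) = quantum_int (a - b) * (quantum_fact (a - Suc b) :: 'a poly)"
      by (metis quantum_fact_Suc)
    then show ?thesis using "3.IH"(1) False ba by (simp add: algebra_simps)
  qed
  have 2: "monom 1 (a - b) * gauss_poly a b * (quantum_fact (Suc b) * quantum_fact (a - b))
      = monom 1 (a - b) * quantum_int (Suc b) * (quantum_fact a :: 'a poly)"
    using "3.IH"(2)[OF ba, symmetric] by (simp add: quantum_fact_Suc)
  have "quantum_int (Suc a) = quantum_int (a - b) + monom 1 (a - b) * (quantum_int (Suc b) :: 'a poly)"
    using quantum_int_add[of "a - b" "Suc b"] ba by simp
  then show ?case
    using 1 2 by (simp add: quantum_fact_Suc[of a] distrib_right)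
qed auto

lemma quantum_binomial_eq:
  assumes "b \<le> a"
  shows "quantum_binomial q a b = poly (gauss_poly a b) q"
  unfolding quantum_binomial_def gauss_poly_fact[OF assms, symmetric] by simp

lemma quantum_binomial_0 [simp]: "quantum_binomial q a 0 = 1"
  by (simp add: quantum_binomial_eq)

lemma quantum_binomial_symmetric: "quantum_binomial q (a + b) a = quantum_binomial q (b + a) b"
  by (simp add: quantum_binomial_def mult.commute add.commute)

lemma quantum_binomial_refl [simp]: "quantum_binomial q a a = 1"
  using quantum_binomial_symmetric[of q a 0] by simp

lemma quantum_binomial_pascal:
  "quantum_binomial q (Suc r + Suc u) (Suc r) =
    quantum_binomial q (Suc r + u) (Suc r) + q ^ Suc u * quantum_binomial q (r + Suc u) r"
  by (simp add: quantum_binomial_eq poly_monom)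

text \<open>By \<open>weighted_subset_sum\<close> this counts the placements of \<open>R\<close> in
  a sorted word of content \<open>R + U\<close>, with a weight \<open>q\<close> for each letter of
  \<open>U\<close> to the left of a letter of \<open>R\<close>.\<close>

definition shuffle_coeff :: "'a::field \<Rightarrow> nat multiset \<Rightarrow> nat multiset \<Rightarrow> 'a" where
  "shuffle_coeff q R U =
     (\<Prod>i. quantum_binomial q (count R i + count U i) (count R i))
     * (\<Prod>(i, j). if i < j then q ^ (count R j * count U i) else 1)"

lemma Prod_any_eq_prod_atMost:
  fixes N :: nat
  assumes "\<And>i. i > N \<Longrightarrow> f i = 1"
  shows "(\<Prod>i. f i) = prod f {..N}"
proof (rule Prod_any.expand_superset)
  show "{i. f i \<noteq> 1} \<subseteq> {..N}"
  proof
    fix i assume "i \<in> {i. f i \<noteq> 1}"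
    then show "i \<in> {..N}" using assms[of i] by (cases "N < i") (auto simp: linorder_not_less)
  qed
qed simp

text \<open>\<open>Prod_any\<close> needs finite support. A bound on the larger index
  \<open>j\<close> suffices, since \<open>i < j\<close>.\<close>

lemma Prod_any_pairs_eq_power:
  fixes N :: nat
  assumes "\<And>i j. i < j \<Longrightarrow> j > N \<Longrightarrow> e i j = 0"
  shows "(\<Prod>(i, j). if i < j then q ^ e i j else 1) = q ^ (\<Sum>j\<le>N. \<Sum>i<j. e i j)"
proof -
  have "(\<Prod>(i, j). if i < j then q ^ e i j else 1)
      = prod (\<lambda>(i, j). if i < j then q ^ e i j else 1) ({..N} \<times> {..N})"
  proof (rule Prod_any.expand_superset)
    show "{p. (case p of (i, j) \<Rightarrow> if i < j then q ^ e i j else 1) \<noteq> 1} \<subseteq> {..N} \<times> {..N}"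
    proof
      fix p assume p: "p \<in> {p. (case p of (i, j) \<Rightarrow> if i < j then q ^ e i j else 1) \<noteq> 1}"
      obtain i j where ij: "p = (i, j)" by (cases p)
      then show "p \<in> {..N} \<times> {..N}"
        using assms[of i j] p by (cases "N < j") (auto simp: linorder_not_less split: if_splits)
    qed
  qed simp
  also have "\<dots> = (\<Prod>i\<le>N. \<Prod>j\<le>N. if i < j then q ^ e i j else 1)"
    by (simp add: prod.cartesian_product)
  also have "\<dots> = (\<Prod>j\<le>N. \<Prod>i\<le>N. if i < j then q ^ e i j else 1)"
    by (rule prod.swap)
  also have "\<dots> = (\<Prod>j\<le>N. \<Prod>i<j. q ^ e i j)"
  proof (rule prod.cong[OF refl])
    fix j assume "j \<in> {..N}"
    then show "(\<Prod>i\<le>N. if i < j then q ^ e i j else 1) = (\<Prod>i<j. q ^ e i j)"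
      by (intro prod.mono_neutral_cong_right) auto
  qed
  finally show ?thesis by (simp add: power_sum)
qed

lemma shuffle_coeff_eq:
  assumes "\<And>i. i > N \<Longrightarrow> count R i = 0" "\<And>i. i > N \<Longrightarrow> count U i = 0"
  shows "shuffle_coeff q R U =
    (\<Prod>i\<le>N. quantum_binomial q (count R i + count U i) (count R i))
    * q ^ (\<Sum>j\<le>N. count R j * (\<Sum>i<j. count U i))"
proof -
  have "(\<Prod>(i, j). if i < j then q ^ (count R j * count U i) else 1)
      = q ^ (\<Sum>j\<le>N. \<Sum>i<j. count R j * count U i)"
    by (rule Prod_any_pairs_eq_power) (use assms in auto)
  then show ?thesis
    using Prod_any_eq_prod_atMost[of N "\<lambda>i. quantum_binomial q (count R i + count U i) (count R i)"] assms
    by (simp add: shuffle_coeff_def sum_distrib_left)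
qed

lemma shuffle_coeff_split_max:
  assumes "\<And>i. i > l \<Longrightarrow> count R i = 0" "\<And>i. i > l \<Longrightarrow> count U i = 0"
  shows "shuffle_coeff q R U =
    (\<Prod>i<l. quantum_binomial q (count R i + count U i) (count R i))
    * q ^ (\<Sum>j<l. count R j * (\<Sum>i<j. count U i))
    * quantum_binomial q (count R l + count U l) (count R l) * q ^ (count R l * (\<Sum>i<l. count U i))"
proof -
  have "{..l} = insert l {..<l}" by auto
  then show ?thesis by (simp add: shuffle_coeff_eq[OF assms, of l] power_add)
qed

lemma size_eq_sum_count:
  fixes l :: nat
  assumes "\<And>i. i > l \<Longrightarrow> count U i = 0"
  shows "size U = (\<Sum>i<l. count U i) + count U l"
proof -
  have "set_mset U \<subseteq> {..l}"
  proof
    fix i assume "i \<in># U"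
    then show "i \<in> {..l}" using assms[of i] by (cases "l < i") (auto simp: count_eq_zero_iff linorder_not_less)
  qed
  then have "size U = sum (count U) {..l}"
    unfolding size_multiset_overloaded_eq
    by (intro sum.mono_neutral_left) (auto simp: count_eq_zero_iff)
  moreover have "{..l} = insert l {..<l}" by auto
  ultimately show ?thesis by simp
qed

text \<open>Removing one copy of the largest letter \<open>l\<close> leaves all factors below
  \<open>l\<close> unchanged, so this is the \<open>q\<close>-Pascal rule for \<open>l\<close>. The
  power \<open>q ^ size U\<close> combines \<open>q ^ count U l\<close> from that rule with the
  cross terms between \<open>l\<close> in \<open>R\<close> and the smaller letters of
  \<open>U\<close>.\<close>

lemma shuffle_coeff_rec:
  assumes R: "\<And>i. i > l \<Longrightarrow> count R i = 0" and U: "\<And>i. i > l \<Longrightarrow> count U i = 0"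
    and l: "l \<in># R + U"
  shows "shuffle_coeff q R U = (if l \<in># U then shuffle_coeff q R (U - {#l#}) else 0)
    + (if l \<in># R then q ^ size U * shuffle_coeff q (R - {#l#}) U else 0)"
proof -
  have R': "i > l \<Longrightarrow> count (R - {#l#}) i = 0" and U': "i > l \<Longrightarrow> count (U - {#l#}) i = 0" for i
    using R U by auto
  have less: "count (M - {#l#}) i = count M i" if "i < l" for M and i using that by auto
  let ?P = "(\<Prod>i<l. quantum_binomial q (count R i + count U i) (count R i))
    * q ^ (\<Sum>j<l. count R j * (\<Sum>i<j. count U i))"
  let ?u = "\<Sum>i<l. count U i"
  have kU: "shuffle_coeff q R (U - {#l#}) = ?P
      * quantum_binomial q (count R l + (count U l - 1)) (count R l) * q ^ (count R l * ?u)"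
    using shuffle_coeff_split_max[of l R "U - {#l#}" q] R U' by (simp add: less cong: sum.cong_simp prod.cong_simp)
  have kR: "shuffle_coeff q (R - {#l#}) U = ?P
      * quantum_binomial q (count R l - 1 + count U l) (count R l - 1) * q ^ ((count R l - 1) * ?u)"
    using shuffle_coeff_split_max[of l "R - {#l#}" U q] R' U by (simp add: less cong: sum.cong_simp prod.cong_simp)
  have k: "shuffle_coeff q R U = ?P
      * quantum_binomial q (count R l + count U l) (count R l) * q ^ (count R l * ?u)"
    by (rule shuffle_coeff_split_max[OF R U])
  have size: "size U = ?u + count U l" by (rule size_eq_sum_count[OF U])
  \<comment> \<open>If \<open>l\<close> occurs in only one of the multisets, the binomials for
    \<open>l\<close> are \<open>1\<close> and one term of the recursion is absent.\<close>
  consider "count U l = 0" "count R l > 0" | "count R l = 0" "count U l > 0"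
    | r u where "count R l = Suc r" "count U l = Suc u"
    using l by (cases "count R l"; cases "count U l") (auto simp: count_eq_zero_iff)
  then show ?thesis
  proof cases
    case 1
    then obtain r where r: "count R l = Suc r" using gr0_implies_Suc by blast
    then have "l \<in># R" "l \<notin># U" using 1 by (auto simp: count_eq_zero_iff count_inI)
    then show ?thesis using 1 r by (simp add: k kR size power_add)
  next
    case 2
    then have "l \<in># U" "l \<notin># R" by (auto simp: count_eq_zero_iff count_inI)
    then show ?thesis using 2 by (simp add: k kU)
  next
    case 3
    then have "l \<in># U" "l \<in># R" by (auto simp: count_inI)
    then show ?thesis
      unfolding k kU kR size 3 quantum_binomial_pascal
      by (simp add: power_add algebra_simps)
  qed
qed

abbreviation content :: "('b \<Rightarrow> nat) \<Rightarrow> 'b set \<Rightarrow> nat multiset" where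
  "content r P \<equiv> image_mset r (mset_set P)"

lemma content_Un_disjoint:
  "finite A \<Longrightarrow> finite B \<Longrightarrow> A \<inter> B = {} \<Longrightarrow> content r (A \<union> B) = content r A + content r B"
  by (simp add: mset_set_Union)

lemma content_Diff:
  "finite X \<Longrightarrow> P \<subseteq> X \<Longrightarrow> content r (X - P) = content r X - content r P"
  using content_Un_disjoint[of P "X - P" r] by (simp add: finite_subset Un_absorb1)

lemma content_subset: "finite X \<Longrightarrow> P \<subseteq> X \<Longrightarrow> content r P \<subseteq># content r X"
  by (intro image_mset_subseteq_mono subset_imp_msubset_mset_set)

text \<open>Adding the largest element to \<open>X\<close> turns this sum into the \<open>q\<close>-Pascal recursion.\<close>

lemma weighted_subset_sum:
  fixes q :: "'a::field" and X :: "nat set"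
  assumes "finite X" "mono_on X r"
  shows "(\<Sum>P | P \<subseteq> X \<and> content r P = R. q ^ card {(i, j). i \<in> X - P \<and> j \<in> P \<and> i < j})
    = (if R \<subseteq># content r X then shuffle_coeff q R (content r X - R) else 0)"
  using assms
proof (induction X arbitrary: R rule: finite_linorder_max_induct)
  case empty
  have "{P. P \<subseteq> {} \<and> content r P = R} = (if R = {#} then {{}} else {})" by auto
  moreover have "shuffle_coeff q {#} {#} = 1" by (subst shuffle_coeff_eq[of 0]) auto
  ultimately show ?case by auto
next
  case (insert z X)
  let ?D = "\<lambda>X P. {(i, j). i \<in> X - P \<and> j \<in> P \<and> i < j} :: (nat \<times> nat) set"
  let ?S = "\<lambda>R. \<Sum>P | P \<subseteq> X \<and> content r P = R. q ^ card (?D X P)"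
  let ?l = "r z"
  have "mono_on X r" using insert.prems by (rule mono_on_subset) auto
  note IH = insert.IH[OF this]
  have z: "z \<notin> X" using insert.hyps by auto
  have fin: "finite X" by fact
  have cX: "content r (insert z X) = add_mset ?l (content r X)" using z fin by simp
  have cP: "content r (insert z P) = add_mset ?l (content r P)" if "P \<subseteq> X" for P
    using that z fin by (subst mset_set.insert) (auto intro: finite_subset)
  have "{P. P \<subseteq> insert z X \<and> content r P = R}
      = {P. P \<subseteq> X \<and> content r P = R} \<union> insert z ` {P. P \<subseteq> X \<and> add_mset ?l (content r P) = R}"
    (is "?L = ?A \<union> insert z ` ?B")
  proof (intro subset_antisym subsetI)
    fix P assume P: "P \<in> ?L"
    show "P \<in> ?A \<union> insert z ` ?B"
    proof (cases "z \<in> P")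
      case True
      then have "P = insert z (P - {z})" "P - {z} \<subseteq> X" using P by auto
      then show ?thesis using P cP[of "P - {z}"] by (intro UnI2 image_eqI[of _ _ "P - {z}"]) auto
    qed (use P in auto)
  next
    fix P assume "P \<in> ?A \<union> insert z ` ?B"
    then show "P \<in> ?L" using cP by auto
  qed
  moreover have finA: "finite ?A" "finite ?B" using fin by auto
  moreover have "?A \<inter> insert z ` ?B = {}" using z by auto
  ultimately have split: "(\<Sum>P | P \<subseteq> insert z X \<and> content r P = R. q ^ card (?D (insert z X) P))
      = (\<Sum>P\<in>?A. q ^ card (?D (insert z X) P)) + (\<Sum>P\<in>insert z ` ?B. q ^ card (?D (insert z X) P))"
    by (simp add: sum.union_disjoint)
  have "(\<Sum>P\<in>?A. q ^ card (?D (insert z X) P)) = ?S R"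
  proof (rule sum.cong[OF refl])
    fix P assume "P \<in> ?A"
    then have "?D (insert z X) P = ?D X P" using insert.hyps(2) by fastforce
    then show "q ^ card (?D (insert z X) P) = q ^ card (?D X P)" by simp
  qed
  moreover have "(\<Sum>P\<in>insert z ` ?B. q ^ card (?D (insert z X) P))
      = (if ?l \<in># R then q ^ (Suc (card X) - size R) * ?S (R - {#?l#}) else 0)"
  proof -
    have inj: "inj_on (insert z) ?B" using z by (auto simp: inj_on_def)
    \<comment> \<open>As \<open>z\<close> exceeds all of \<open>X\<close>, the new pairs are the
      \<open>(i, z)\<close> with \<open>i\<close> in \<open>X - P\<close>. Their number is
      \<open>Suc (card X) - size R\<close> because \<open>R\<close> has one element more than
      \<open>P\<close>.\<close>
    have D: "card (?D (insert z X) (insert z P)) = card (?D X P) + (Suc (card X) - size R)"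
      if P: "P \<in> ?B" for P
    proof -
      have PX: "P \<subseteq> X" and R: "R = add_mset ?l (content r P)" using P by auto
      have "?D (insert z X) (insert z P) = ?D X P \<union> (\<lambda>i. (i, z)) ` (X - P)"
        using insert.hyps(2) PX by fastforce
      moreover have "finite (?D X P)" by (rule finite_subset[of _ "X \<times> X"]) (use fin PX in auto)
      moreover have "?D X P \<inter> (\<lambda>i. (i, z)) ` (X - P) = {}" using z PX by auto
      moreover have "card ((\<lambda>i. (i, z)) ` (X - P)) = card X - card P"
        using fin PX by (simp add: card_image inj_on_def card_Diff_subset finite_subset)
      ultimately show ?thesis using fin by (simp add: card_Un_disjoint R)
    qed
    have B: "?B = (if ?l \<in># R then {P. P \<subseteq> X \<and> content r P = R - {#?l#}} else {})"
      by auto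
    have "(\<Sum>P\<in>insert z ` ?B. q ^ card (?D (insert z X) P))
        = (\<Sum>P\<in>?B. q ^ card (?D X P) * q ^ (Suc (card X) - size R))"
      unfolding sum.reindex[OF inj] by (rule sum.cong[OF refl]) (simp only: comp_def D power_add)
    then show ?thesis unfolding B by (simp add: sum_distrib_left mult.commute)
  qed
  ultimately have eq: "(\<Sum>P | P \<subseteq> insert z X \<and> content r P = R. q ^ card (?D (insert z X) P))
      = ?S R + (if ?l \<in># R then q ^ (Suc (card X) - size R) * ?S (R - {#?l#}) else 0)"
    using split by simp
  show ?case
  proof (cases "R \<subseteq># add_mset ?l (content r X)")
    case False
    \<comment> \<open>If \<open>R\<close> does not fit into the enlarged content, then
      \<open>R\<close> does not fit into the old one, nor does \<open>R\<close> without a copy of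
      \<open>r z\<close>; both summands vanish.\<close>
    have "content r X \<subseteq># add_mset ?l (content r X)" by simp
    then have "\<not> R \<subseteq># content r X" using False subset_mset.order_trans by blast
    moreover have "\<not> R - {#?l#} \<subseteq># content r X" if "?l \<in># R"
      using False that by (metis insert_DiffM mset_subset_eq_add_mset_cancel)
    ultimately show ?thesis using False by (simp only: eq IH cX) simp
  next
    case True
    define U where "U = add_mset ?l (content r X) - R"
    have RU: "R + U = add_mset ?l (content r X)" using True by (simp add: U_def)
    \<comment> \<open>Monotonicity makes \<open>r z\<close> the largest letter, as
      \<open>shuffle_coeff_rec\<close> requires.\<close>
    have le: "x \<le> ?l" if "x \<in># R + U" for x
      using that insert.hyps(2) mono_onD[OF insert.prems] fin unfolding RU by fastforce
    have cnt: "count R i = 0" "count U i = 0" if "i > ?l" for i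
      using le[of i] that by (auto simp: count_eq_zero_iff)
    have rec: "shuffle_coeff q R U = (if ?l \<in># U then shuffle_coeff q R (U - {#?l#}) else 0)
        + (if ?l \<in># R then q ^ size U * shuffle_coeff q (R - {#?l#}) U else 0)"
      by (rule shuffle_coeff_rec) (use cnt in \<open>simp_all add: RU\<close>)
    have sub1: "R \<subseteq># content r X \<longleftrightarrow> ?l \<in># U"
    proof
      assume "R \<subseteq># content r X"
      then obtain V where "content r X = R + V" by (auto simp: mset_subset_eq_exists_conv)
      then have "U = add_mset ?l V" by (simp add: U_def)
      then show "?l \<in># U" by simp
    next
      assume "?l \<in># U"
      then obtain U' where "U = add_mset ?l U'" by (meson multi_member_split)
      then have "R + U' = content r X" using RU by simp
      then show "R \<subseteq># content r X" by (metis mset_subset_eq_add_left)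
    qed
    have d1: "content r X - R = U - {#?l#}" by (simp add: U_def)
    have sub2: "R - {#?l#} \<subseteq># content r X" if "?l \<in># R"
      using True that by (metis insert_DiffM mset_subset_eq_add_mset_cancel)
    have d2: "content r X - (R - {#?l#}) = U" if "?l \<in># R"
      unfolding U_def using that by (metis add_mset_diff_bothsides insert_DiffM)
    have "size R + size U = Suc (card X)" using arg_cong[OF RU, of size] by simp
    then have "Suc (card X) - size R = size U" by simp
    then show ?thesis
      using True sub1 sub2 d1 d2 unfolding eq IH cX by (simp add: rec U_def[symmetric])
  qed
qed

text \<open>Passing to complements gives \<open>weighted_subset_sum\<close>. The chosen set is now
  the left member of the counted pairs, hence its content is the second argument of
  \<open>shuffle_coeff\<close>; this is the form needed for the second row.\<close>

lemma weighted_complement_sum: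
  fixes q :: "'a::field" and X :: "nat set"
  assumes X: "finite X" and r: "mono_on X r"
  shows "(\<Sum>Q | Q \<subseteq> X \<and> content r Q = T. q ^ card {(i, j). i \<in> Q \<and> j \<in> X - Q \<and> i < j})
    = (if T \<subseteq># content r X then shuffle_coeff q (content r X - T) T else 0)"
proof (cases "T \<subseteq># content r X")
  case False
  then have "{Q. Q \<subseteq> X \<and> content r Q = T} = {}" using content_subset[OF X] by blast
  then show ?thesis using False by (simp only:) simp
next
  case True
  have "(\<Sum>Q | Q \<subseteq> X \<and> content r Q = T. q ^ card {(i, j). i \<in> Q \<and> j \<in> X - Q \<and> i < j})
    = (\<Sum>P | P \<subseteq> X \<and> content r P = content r X - T. q ^ card {(i, j). i \<in> X - P \<and> j \<in> P \<and> i < j})"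
  proof (rule sum.reindex_bij_witness[of _ "\<lambda>P. X - P" "\<lambda>P. X - P"])
    fix P assume "P \<in> {P. P \<subseteq> X \<and> content r P = content r X - T}"
    then show "X - P \<in> {Q. Q \<subseteq> X \<and> content r Q = T}"
      using content_Diff[OF X, of P r] True by (simp add: subset_mset.diff_diff_right double_diff)
  next
    fix Q assume "Q \<in> {Q. Q \<subseteq> X \<and> content r Q = T}"
    then show "X - Q \<in> {P. P \<subseteq> X \<and> content r P = content r X - T}"
      using content_Diff[OF X, of Q r] by auto
  qed (auto simp: double_diff)
  also have "\<dots> = shuffle_coeff q (content r X - T) (content r X - (content r X - T))"
    by (subst weighted_subset_sum[OF X r]) simp
  also have "content r X - (content r X - T) = T"
    using True by (auto simp: mset_subset_eq_exists_conv)
  finally show ?thesis using True by simp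
qed

section \<open>Splitting the rows of a two-row diagram\<close>

text \<open>With \<open>a = |R|\<close> and \<open>b = |R| + |S|\<close>, the function \<open>four_blocks a m b\<close> is the row function of the
  composition \<open>(|R|, |U|, |V|, |T|)\<close>; merging blocks gives those of \<open>\<mu>\<close> and of
  \<open>\<nu> = (|R|, |S|, |T|)\<close>.\<close>

definition four_blocks :: "nat \<Rightarrow> nat \<Rightarrow> nat \<Rightarrow> nat \<Rightarrow> nat" where
  "four_blocks a m b k = (if k \<le> a then 1 else if k \<le> m then 2 else if k \<le> b then 3 else 4)"

definition merge_outer :: "nat \<Rightarrow> nat" where
  "merge_outer x = (if x \<le> 2 then 1 else 2)"

definition merge_middle :: "nat \<Rightarrow> nat" where
  "merge_middle x = (if x \<le> 1 then 1 else if x \<le> 3 then 2 else 3)"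

text \<open>Cut down to \<open>{1..n}\<close>, since row functions may take any values
  elsewhere.\<close>

definition fibre :: "nat \<Rightarrow> (nat \<Rightarrow> nat) \<Rightarrow> nat \<Rightarrow> nat set" where
  "fibre n f v = {k \<in> {1..n}. f k = v}"

lemma finite_fibre [simp]: "finite (fibre n f v)"
  by (simp add: fibre_def)

lemma mono_four_blocks: "a \<le> m \<Longrightarrow> m \<le> b \<Longrightarrow> mono (four_blocks a m b)"
  by (auto simp: mono_def four_blocks_def)

lemma fibre_four_blocks:
  assumes "a \<le> m" "m \<le> b" "b \<le> n"
  shows "fibre n (four_blocks a m b) 1 = {1..a}" "fibre n (four_blocks a m b) 2 = {Suc a..m}"
    "fibre n (four_blocks a m b) 3 = {Suc m..b}" "fibre n (four_blocks a m b) 4 = {Suc b..n}"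
  using assms by (auto simp: fibre_def four_blocks_def split: if_splits)

lemma card_fibre_comp:
  assumes w: "w permutes {1..n}"
  shows "card (fibre n (r \<circ> w) v) = card (fibre n r v)"
proof -
  have "bij_betw w (fibre n (r \<circ> w) v) (fibre n r v)"
  proof (rule bij_betw_imageI)
    show "w ` fibre n (r \<circ> w) v = fibre n r v"
    proof
      show "fibre n r v \<subseteq> w ` fibre n (r \<circ> w) v"
      proof
        fix k assume k: "k \<in> fibre n r v"
        then have "perm_inv w k \<in> fibre n (r \<circ> w) v"
          using permutes_in_image[OF permutes_inv[OF w]] permutes_inverses(1)[OF w]
          by (auto simp: fibre_def)
        then show "k \<in> w ` fibre n (r \<circ> w) v"
          using permutes_inverses(1)[OF w] by (intro image_eqI[of _ _ "perm_inv w k"]) auto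
      qed
    qed (use permutes_in_image[OF w] in \<open>auto simp: fibre_def\<close>)
  qed (use permutes_inj_on[OF w] in blast)
  then show ?thesis by (rule bij_betw_same_card)
qed

text \<open>Equal fibre sizes mean equal multisets of values, and these differ by a permutation of
  the arguments.\<close>

lemma exists_perm_of_card_fibres:
  assumes "\<And>v. card (fibre n g v) = card (fibre n r v)"
  shows "\<exists>w. w permutes {1..n} \<and> (\<forall>k\<in>{1..n}. g k = r (w k))"
proof -
  have cnt: "count (image_mset h (mset_set {1..n})) v = card (fibre n h v)" for h :: "nat \<Rightarrow> nat" and v
    by (auto simp: count_image_mset fibre_def Int_def vimage_def intro!: arg_cong[of _ _ card])
  have "image_mset g (mset_set {1..n}) = image_mset r (mset_set {1..n})"
    by (rule multiset_eqI) (simp only: cnt assms)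
  from image_mset_eq_implies_permutes[OF _ this] show ?thesis by (metis finite_atLeastAtMost)
qed

text \<open>Exponent of \<open>q\<close> attached to the coset labelled \<open>g\<close>: blocks 1
  and 2 form the first row of \<open>\<mu>\<close>, blocks 3 and 4 the second, and inversions are
  counted within these rows only.\<close>

definition block_descents :: "nat \<Rightarrow> (nat \<Rightarrow> nat) \<Rightarrow> nat" where
  "block_descents n g =
     card {(i, j). i \<in> fibre n g 2 \<and> j \<in> fibre n g 1 \<and> i < j}
     + card {(i, j). i \<in> fibre n g 4 \<and> j \<in> fibre n g 3 \<and> i < j}"

context hecke_algebra
begin

lemma rows_of_permsI:
  assumes "\<And>k. k \<notin> {1..n} \<Longrightarrow> g k = r k" "\<And>v. card (fibre n g v) = card (fibre n r v)"
  shows "g \<in> rows_of_perms r"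
proof -
  obtain w where w: "w permutes {1..n}" "\<And>k. k \<in> {1..n} \<Longrightarrow> g k = r (w k)"
    using exists_perm_of_card_fibres[OF assms(2)] by blast
  have "g k = r (w k)" for k
    using w(2)[of k] assms(1)[of k] permutes_not_in[OF w(1), of k] by (cases "k \<in> {1..n}") auto
  then have "g = r \<circ> w" by auto
  then show ?thesis using w(1) by (auto simp: rows_of_perms_def)
qed

lemma rows_of_perms_outside:
  assumes "g \<in> rows_of_perms r" "k \<notin> {1..n}"
  shows "g k = r k"
  using assms permutes_not_in by (fastforce simp: rows_of_perms_def)

lemma card_fibre_rows_of_perms: "g \<in> rows_of_perms r \<Longrightarrow> card (fibre n g v) = card (fibre n r v)"
  using card_fibre_comp by (auto simp: rows_of_perms_def)

text \<open>Only blocks 1 and 4 have prescribed contents. Blocks 2 and 3 are restricted jointly,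
  which makes the condition depend on the rows of \<open>\<nu>\<close> alone.\<close>

definition refined_rows :: "nat \<Rightarrow> nat \<Rightarrow> nat \<Rightarrow> (nat \<Rightarrow> nat) \<Rightarrow> nat multiset \<Rightarrow> nat multiset \<Rightarrow> (nat \<Rightarrow> nat) set" where
  "refined_rows a m b r R R' = {g \<in> rows_of_perms (four_blocks a m b).
     content r (fibre n g 1) = R \<and> content r (fibre n g 4) = R'}"

text \<open>Refining the two-row word \<open>f\<close> into four blocks means choosing block 1
  inside the first fibre and block 4 inside the second. The choices are independent and the weight
  is multiplicative, so the sum is a product of two weighted subset sums.\<close>

lemma sum_refined_rows:
  fixes r :: "nat \<Rightarrow> nat"
  assumes ord: "a \<le> m" "m \<le> b" "b \<le> n" and r: "mono_on {1..n} r" and w: "w permutes {1..n}"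
    and sizes: "size R = a" "size R' = n - b"
  defines "f \<equiv> merge_outer \<circ> four_blocks a m b \<circ> w"
  shows "(\<Sum>g\<in>refined_rows a m b r R R'. q ^ block_descents n g * of_bool (merge_outer \<circ> g = f))
    = (if R \<subseteq># content r (fibre n f 1) then shuffle_coeff q R (content r (fibre n f 1) - R) else 0)
      * (if R' \<subseteq># content r (fibre n f 2) then shuffle_coeff q (content r (fibre n f 2) - R') R' else 0)"
proof -
  let ?r4 = "four_blocks a m b"
  let ?X = "fibre n f 1" and ?Y = "fibre n f 2"
  let ?PP = "{P. P \<subseteq> ?X \<and> content r P = R}" and ?QQ = "{Q. Q \<subseteq> ?Y \<and> content r Q = R'}"
  let ?d = "\<lambda>P. card {(i, j). i \<in> ?X - P \<and> j \<in> P \<and> i < j}"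
  let ?e = "\<lambda>Q. card {(i, j). i \<in> Q \<and> j \<in> ?Y - Q \<and> i < j}"
  \<comment> \<open>Inverse to reading off blocks 1 and 4. Off \<open>{1..n}\<close> the value is
    that of \<open>four_blocks\<close>, as for every member of \<open>rows_of_perms\<close>.\<close>
  let ?g = "\<lambda>(P, Q) k. if k \<in> P then 1 else if k \<in> ?X then 2 else if k \<in> Q then 4
    else if k \<in> ?Y then 3 else ?r4 k"
  have f12: "f k = 1 \<or> f k = 2" for k by (auto simp: f_def merge_outer_def)
  have XY: "?X \<union> ?Y = {1..n}" "?X \<inter> ?Y = {}" using f12 by (auto simp: fibre_def)
  have f_out: "f k = merge_outer (?r4 k)" if "k \<notin> {1..n}" for k
    using that permutes_not_in[OF w] by (simp add: f_def)
  have cardX: "card ?X = m"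
  proof -
    have "card ?X = card (fibre n (merge_outer \<circ> ?r4) 1)" unfolding f_def by (rule card_fibre_comp[OF w])
    also have "fibre n (merge_outer \<circ> ?r4) 1 = {1..m}"
      using ord by (auto simp: fibre_def merge_outer_def four_blocks_def)
    finally show ?thesis by simp
  qed
  have cardY: "card ?Y = n - m"
  proof -
    have "card ?X + card ?Y = n" using XY card_Un_disjoint[of ?X ?Y] by simp
    then show ?thesis using cardX by simp
  qed
  have rec: "fibre n g 1 \<subseteq> ?X" "fibre n g 2 = ?X - fibre n g 1" "fibre n g 4 \<subseteq> ?Y"
    "fibre n g 3 = ?Y - fibre n g 4" "?g (fibre n g 1, fibre n g 4) = g"
    if g: "g \<in> rows_of_perms ?r4" and mg: "merge_outer \<circ> g = f" for g
  proof -
    have f_eq: "f k = merge_outer (g k)" for k using mg by auto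
    have val: "g k = 1 \<or> g k = 2 \<or> g k = 3 \<or> g k = 4" for k
      using g by (auto simp: rows_of_perms_def four_blocks_def split: if_splits)
    show "fibre n g 1 \<subseteq> ?X" "fibre n g 4 \<subseteq> ?Y"
      by (auto simp: fibre_def f_eq merge_outer_def)
    show "fibre n g 2 = ?X - fibre n g 1" "fibre n g 3 = ?Y - fibre n g 4"
    proof -
      have "k \<in> fibre n g 2 \<longleftrightarrow> k \<in> ?X - fibre n g 1" "k \<in> fibre n g 3 \<longleftrightarrow> k \<in> ?Y - fibre n g 4" for k
        using val[of k] by (auto simp: fibre_def f_eq merge_outer_def)
      then show "fibre n g 2 = ?X - fibre n g 1" "fibre n g 3 = ?Y - fibre n g 4" by blast+
    qed
    show "?g (fibre n g 1, fibre n g 4) = g"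
    proof
      fix k
      show "?g (fibre n g 1, fibre n g 4) k = g k"
        using val[of k] rows_of_perms_outside[OF g, of k]
        by (cases "k \<in> {1..n}") (auto simp: fibre_def f_eq merge_outer_def)
    qed
  qed
  have build: "fibre n (?g (P, Q)) 1 = P" "fibre n (?g (P, Q)) 2 = ?X - P"
      "fibre n (?g (P, Q)) 3 = ?Y - Q" "fibre n (?g (P, Q)) 4 = Q"
      "v \<notin> {1, 2, 3, 4} \<Longrightarrow> fibre n (?g (P, Q)) v = {}" "merge_outer \<circ> ?g (P, Q) = f"
    if P: "P \<subseteq> ?X" and Q: "Q \<subseteq> ?Y" for P Q v
  proof -
    have in_n: "k \<in> {1..n} \<longleftrightarrow> k \<in> ?X \<or> k \<in> ?Y" for k using XY by auto
    have disj: "k \<in> ?X \<Longrightarrow> k \<notin> ?Y" for k using XY by auto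
    show "fibre n (?g (P, Q)) 1 = P" "fibre n (?g (P, Q)) 2 = ?X - P"
      "fibre n (?g (P, Q)) 3 = ?Y - Q" "fibre n (?g (P, Q)) 4 = Q"
      unfolding fibre_def[of n "?g (P, Q)"] in_n using P Q disj by (auto split: if_splits)
    show "fibre n (?g (P, Q)) v = {}" if "v \<notin> {1, 2, 3, 4}"
      unfolding fibre_def[of n "?g (P, Q)"] in_n using that by (auto split: if_splits)
    show "merge_outer \<circ> ?g (P, Q) = f"
    proof
      fix k
      show "(merge_outer \<circ> ?g (P, Q)) k = f k"
      proof (cases "k \<in> {1..n}")
        case True
        then consider "k \<in> ?X" "k \<notin> ?Y" "k \<notin> Q" | "k \<in> ?Y" "k \<notin> ?X" "k \<notin> P"
          using in_n[of k] disj[of k] P Q by blast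
        then show ?thesis by cases (auto simp: merge_outer_def, auto simp: fibre_def)
      next
        case False
        then have "k \<notin> ?X" "k \<notin> ?Y" "k \<notin> P" "k \<notin> Q" using in_n[of k] P Q by blast+
        then show ?thesis using f_out[OF False] by simp
      qed
    qed
  qed
  have rows: "?g (P, Q) \<in> refined_rows a m b r R R'" if "P \<in> ?PP" "Q \<in> ?QQ" for P Q
  proof -
    have P: "P \<subseteq> ?X" "content r P = R" and Q: "Q \<subseteq> ?Y" "content r Q = R'" using that by auto
    have fin: "finite P" "finite Q" using P(1) Q(1) by (auto intro: finite_subset)
    \<comment> \<open>The prescribed contents force the block sizes, and this puts the assembled
      word into \<open>rows_of_perms\<close>.\<close>
    have cP: "card P = a" using arg_cong[OF P(2), of size] sizes by simp
    have cQ: "card Q = n - b" using arg_cong[OF Q(2), of size] sizes by simp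
    have "card (?X - P) = m - a" "card (?Y - Q) = b - m"
      using P Q fin cP cQ cardX cardY ord by (simp_all add: card_Diff_subset)
    then have "card (fibre n (?g (P, Q)) v) = card (fibre n ?r4 v)" for v
    proof (cases "v \<in> {1, 2, 3, 4}")
      case True
      then show ?thesis
        using build(1-4)[OF P(1) Q(1)] fibre_four_blocks[OF ord] cP cQ
          \<open>card (?X - P) = m - a\<close> \<open>card (?Y - Q) = b - m\<close> by auto
    next
      case False
      then have "fibre n ?r4 v = {}" by (auto simp: fibre_def four_blocks_def)
      then show ?thesis using build(5)[OF P(1) Q(1) False] by simp
    qed
    moreover have "?g (P, Q) k = ?r4 k" if "k \<notin> {1..n}" for k
      using that XY P(1) Q(1) by auto
    ultimately have "?g (P, Q) \<in> rows_of_perms ?r4" by (intro rows_of_permsI)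
    then show ?thesis
      using build(1,4)[OF P(1) Q(1)] P(2) Q(2) unfolding refined_rows_def by simp
  qed
  have "(\<Sum>g\<in>refined_rows a m b r R R'. q ^ block_descents n g * of_bool (merge_outer \<circ> g = f))
      = (\<Sum>g | g \<in> refined_rows a m b r R R' \<and> merge_outer \<circ> g = f. q ^ block_descents n g)"
    by (rule sum.mono_neutral_cong_right) (auto simp: refined_rows_def)
  also have "\<dots> = (\<Sum>PQ\<in>?PP \<times> ?QQ. q ^ ?d (fst PQ) * q ^ ?e (snd PQ))"
  proof (rule sum.reindex_bij_witness[of _ ?g "\<lambda>g. (fibre n g 1, fibre n g 4)"])
    fix g assume "g \<in> {g. g \<in> refined_rows a m b r R R' \<and> merge_outer \<circ> g = f}"
    then have g: "g \<in> rows_of_perms ?r4" "merge_outer \<circ> g = f"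
      "content r (fibre n g 1) = R" "content r (fibre n g 4) = R'"
      by (auto simp: refined_rows_def)
    show "?g (fibre n g 1, fibre n g 4) = g" by (rule rec(5)[OF g(1,2)])
    show "(fibre n g 1, fibre n g 4) \<in> ?PP \<times> ?QQ" using rec(1,3)[OF g(1,2)] g(3,4) by simp
    show "q ^ ?d (fst (fibre n g 1, fibre n g 4)) * q ^ ?e (snd (fibre n g 1, fibre n g 4))
        = q ^ block_descents n g"
      unfolding block_descents_def rec(2,4)[OF g(1,2)] by (simp add: power_add)
  next
    fix PQ assume "PQ \<in> ?PP \<times> ?QQ"
    then obtain P Q where PQ: "PQ = (P, Q)" "P \<in> ?PP" "Q \<in> ?QQ" by auto
    then have b: "P \<subseteq> ?X" "Q \<subseteq> ?Y" by auto
    show "(fibre n (?g PQ) 1, fibre n (?g PQ) 4) = PQ"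
      unfolding PQ(1) using build(1,4)[OF b] by simp
    show "?g PQ \<in> {g. g \<in> refined_rows a m b r R R' \<and> merge_outer \<circ> g = f}"
      unfolding PQ(1) using rows[OF PQ(2,3)] build(6)[OF b] by blast
  qed
  also have "\<dots> = (\<Sum>P\<in>?PP. q ^ ?d P) * (\<Sum>Q\<in>?QQ. q ^ ?e Q)"
    by (simp add: sum_product sum.cartesian_product case_prod_beta)
  also have "(\<Sum>P\<in>?PP. q ^ ?d P) = (if R \<subseteq># content r ?X then shuffle_coeff q R (content r ?X - R) else 0)"
    by (rule weighted_subset_sum) (use mono_on_subset[OF r] XY in auto)
  also have "(\<Sum>Q\<in>?QQ. q ^ ?e Q) = (if R' \<subseteq># content r ?Y then shuffle_coeff q (content r ?Y - R') R' else 0)"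
    by (rule weighted_complement_sum) (use mono_on_subset[OF r] XY in auto)
  finally show ?thesis .
qed

text \<open>The representative has no inversion inside a block, so an inversion inside a row of
  \<open>\<mu>\<close> joins its two blocks; conversely, by monotonicity of
  \<open>four_blocks\<close>, a descent between blocks is an inversion of the
  representative.\<close>

lemma restricted_inv_count_min_rep:
  assumes ord: "a \<le> m" "m \<le> b" and f: "f \<in> rows_of_perms (four_blocks a m b)"
  defines "r2 \<equiv> merge_outer \<circ> four_blocks a m b"
  shows "restricted_inv_count n (\<lambda>x y. r2 x = r2 y) (min_rep (four_blocks a m b) f) = block_descents n f"
proof -
  let ?e = "min_rep (four_blocks a m b) f"
  note e = min_rep[OF f]
  have fe: "four_blocks a m b (?e k) = f k" for k using fun_cong[OF e(2), of k] by simp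
  have val: "f k = 1 \<or> f k = 2 \<or> f k = 3 \<or> f k = 4" for k
    using fe[of k] by (auto simp: four_blocks_def split: if_splits)
  have mono: "f j \<le> f i" if "?e j < ?e i" for i j
    using monoD[OF mono_four_blocks[OF ord], of "?e j" "?e i"] that fe by simp
  let ?A = "{(i, j). i \<in> fibre n f 2 \<and> j \<in> fibre n f 1 \<and> i < j}"
  let ?B = "{(i, j). i \<in> fibre n f 4 \<and> j \<in> fibre n f 3 \<and> i < j}"
  have "{(i, j) \<in> inversions n ?e. r2 (?e i) = r2 (?e j)} = ?A \<union> ?B"
  proof (intro subset_antisym subsetI)
    fix p assume "p \<in> {(i, j) \<in> inversions n ?e. r2 (?e i) = r2 (?e j)}"
    then obtain i j where ij: "p = (i, j)" "1 \<le> i" "i < j" "j \<le> n" "?e j < ?e i"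
      "merge_outer (f i) = merge_outer (f j)"
      by (auto simp: inversions_def r2_def fe)
    have "f j \<noteq> f i" using e(3) ij fe unfolding increasing_in_rows_def by (metis not_less_iff_gr_or_eq)
    then have "f j < f i" using mono[OF ij(5)] by simp
    then have "f i = 2 \<and> f j = 1 \<or> f i = 4 \<and> f j = 3"
      using ij(6) val[of i] val[of j] by (auto simp: merge_outer_def)
    then show "p \<in> ?A \<union> ?B" using ij by (auto simp: fibre_def)
  next
    fix p assume "p \<in> ?A \<union> ?B"
    then obtain i j where ij: "p = (i, j)" "1 \<le> i" "i < j" "j \<le> n" "f i = 2 \<and> f j = 1 \<or> f i = 4 \<and> f j = 3"
      by (auto simp: fibre_def)
    then have "f j < f i" "merge_outer (f i) = merge_outer (f j)" by (auto simp: merge_outer_def)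
    moreover have "?e j < ?e i"
    proof (rule ccontr)
      assume "\<not> ?thesis"
      then have "?e i \<le> ?e j" by simp
      then have "f i \<le> f j" using monoD[OF mono_four_blocks[OF ord]] fe by metis
      then show False using \<open>f j < f i\<close> by simp
    qed
    ultimately show "p \<in> {(i, j) \<in> inversions n ?e. r2 (?e i) = r2 (?e j)}"
      using ij by (auto simp: inversions_def r2_def fe)
  qed
  moreover have "finite ?A" "finite ?B"
    by (rule finite_subset[of _ "{1..n} \<times> {1..n}"], auto simp: fibre_def)+
  moreover have "?A \<inter> ?B = {}" by (auto simp: fibre_def)
  ultimately show ?thesis by (simp add: restricted_inv_count_def block_descents_def card_Un_disjoint)
qed

text \<open>The composite of the tableau homomorphisms \<open>M\<^sup>\<mu> \<rightarrow> M\<^sup>\<nu> \<rightarrow> M\<^sup>\<lambda>\<close>, evaluated at \<open>x\<^sub>\<mu>\<close>.\<close>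

lemma refined_sum_factors:
  fixes r :: "nat \<Rightarrow> nat"
  assumes ord: "a \<le> m" "m \<le> b"
  defines "r4 \<equiv> four_blocks a m b"
  shows "\<exists>h\<in>carrier H. \<exists>g\<in>carrier H.
    lincomb (\<lambda>w. \<Sum>f\<in>refined_rows a m b r R R'.
      q ^ block_descents n f * of_bool (merge_outer \<circ> f = merge_outer \<circ> r4 \<circ> w))
    = h \<otimes>\<^bsub>H\<^esub> young_sum (merge_middle \<circ> r4) \<otimes>\<^bsub>H\<^esub> g"
proof -
  define r2 where "r2 = merge_outer \<circ> r4"
  define r3 where "r3 = merge_middle \<circ> r4"
  \<comment> \<open>In the application these are the coefficients of the double coset sum for the
    second map, from \<open>M^\<nu>\<close> to \<open>M^\<lambda>\<close>.\<close>
  define \<phi> :: "(nat \<Rightarrow> nat) \<Rightarrow> 'a" where "\<phi> w = of_bool (r4 \<circ> w \<in> refined_rows a m b r R R')" for w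
  have m4: "mono r4" unfolding r4_def by (rule mono_four_blocks[OF ord])
  have mo4: "mono_on {1..n} r4" using m4 by (rule mono_on_subset) auto
  have mm: "mono merge_middle" and mo: "mono merge_outer" by (auto simp: mono_def merge_middle_def merge_outer_def)
  have mo3: "mono_on {1..n} r3"
    by (rule mono_onI) (simp add: r3_def monoD[OF mm] monoD[OF m4])
  have mo2: "mono_on {1..n} r2"
    by (rule mono_onI) (simp add: r2_def monoD[OF mo] monoD[OF m4])
  have "\<exists>h\<in>carrier H. lincomb \<phi> = h \<otimes>\<^bsub>H\<^esub> young_sum r3"
  proof (rule left_factor[OF mo3])
    fix v w assume vw: "v permutes {1..n}" "w permutes {1..n}" "r3 \<circ> v = r3 \<circ> w"
    \<comment> \<open>Blocks 1 and 4 are rows 1 and 3 of \<open>\<nu>\<close>, so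
      \<open>\<phi>\<close> is constant on the cosets of \<open>W_\<nu>\<close>.\<close>
    have r43: "r4 x = 1 \<longleftrightarrow> r3 x = 1" "r4 x = 4 \<longleftrightarrow> r3 x = 3" for x
      by (simp_all add: r3_def merge_middle_def r4_def four_blocks_def)
    have "r3 (v k) = r3 (w k)" for k using fun_cong[OF vw(3), of k] by simp
    then have "r4 (v k) = 1 \<longleftrightarrow> r4 (w k) = 1" "r4 (v k) = 4 \<longleftrightarrow> r4 (w k) = 4" for k
      by (simp_all only: r43)
    then have "fibre n (r4 \<circ> v) 1 = fibre n (r4 \<circ> w) 1" "fibre n (r4 \<circ> v) 4 = fibre n (r4 \<circ> w) 4"
      by (auto simp: fibre_def)
    moreover have "r4 \<circ> v \<in> rows_of_perms r4" "r4 \<circ> w \<in> rows_of_perms r4"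
      using vw by (auto simp: rows_of_perms_def)
    ultimately show "\<phi> v = \<phi> w" unfolding \<phi>_def refined_rows_def r4_def by simp
  qed
  then obtain h where h: "h \<in> carrier H" "lincomb \<phi> = h \<otimes>\<^bsub>H\<^esub> young_sum r3" by blast
  have "\<exists>g\<in>carrier H. lincomb (\<lambda>w. row_fibre r2 r2 (perm_inv w)) = young_sum r4 \<otimes>\<^bsub>H\<^esub> g"
  proof (rule right_factor[OF mo4])
    fix v w assume "r4 \<circ> perm_inv v = r4 \<circ> perm_inv w"
    then have "r2 \<circ> perm_inv v = r2 \<circ> perm_inv w" by (simp add: r2_def comp_assoc)
    then show "row_fibre r2 r2 (perm_inv v) = (row_fibre r2 r2 (perm_inv w) :: 'a)"
      by (simp only: row_fibre_def)
  qed
  then obtain g where g: "g \<in> carrier H" "young_sum r2 = young_sum r4 \<otimes>\<^bsub>H\<^esub> g"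
    unfolding young_sum_right by blast
  \<comment> \<open>\<open>lincomb \<phi>\<close> is now expanded a second time, over cosets of the
    smaller group \<open>W_\<rho>\<close>, whose sum is the one that \<open>g\<close> completes to
    \<open>x_\<mu>\<close>.\<close>
  let ?e = "min_rep r4"
  have "lincomb \<phi> \<otimes>\<^bsub>H\<^esub> g
      = (\<Oplus>\<^bsub>H\<^esub>f\<in>rows_of_perms r4. scal (\<phi> (?e f)) \<otimes>\<^bsub>H\<^esub> Tw (?e f)) \<otimes>\<^bsub>H\<^esub> young_sum r4 \<otimes>\<^bsub>H\<^esub> g"
    by (subst left_factorisation[OF mo4]) (simp_all add: \<phi>_def)
  also have "\<dots> = (\<Oplus>\<^bsub>H\<^esub>f\<in>rows_of_perms r4. scal (\<phi> (?e f)) \<otimes>\<^bsub>H\<^esub> Tw (?e f)) \<otimes>\<^bsub>H\<^esub> young_sum r2"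
    unfolding g(2) using g(1) by (intro H.m_assoc H.finsum_closed) auto
  also have "\<dots> = (\<Oplus>\<^bsub>H\<^esub>f\<in>rows_of_perms r4. scal (\<phi> (?e f)) \<otimes>\<^bsub>H\<^esub> (Tw (?e f) \<otimes>\<^bsub>H\<^esub> young_sum r2))"
    by (subst H.finsum_ldistr) (simp_all add: Pi_def H.m_assoc cong: H.finsum_cong)
  also have "\<dots> = (\<Oplus>\<^bsub>H\<^esub>f\<in>rows_of_perms r4.
      lincomb (\<lambda>w. \<phi> (?e f) * (q ^ block_descents n f * row_fibre r2 (merge_outer \<circ> f) w)))"
  proof (rule H.finsum_cong'[OF refl])
    fix f assume f: "f \<in> rows_of_perms r4"
    have "r2 \<circ> ?e f = merge_outer \<circ> f" using min_rep(2)[OF f] by (simp add: r2_def comp_assoc)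
    moreover have "restricted_inv_count n (\<lambda>x y. r2 x = r2 y) (?e f) = block_descents n f"
      using restricted_inv_count_min_rep[OF ord] f unfolding r4_def r2_def by blast
    ultimately show "scal (\<phi> (?e f)) \<otimes>\<^bsub>H\<^esub> (Tw (?e f) \<otimes>\<^bsub>H\<^esub> young_sum r2)
        = lincomb (\<lambda>w. \<phi> (?e f) * (q ^ block_descents n f * row_fibre r2 (merge_outer \<circ> f) w))"
      unfolding Tw_young_sum[OF mo2 min_rep(1)[OF f]] by (simp only: lincomb_smult)
  qed auto
  also have "\<dots> = lincomb (\<lambda>w. \<Sum>f\<in>rows_of_perms r4.
      \<phi> (?e f) * (q ^ block_descents n f * row_fibre r2 (merge_outer \<circ> f) w))"
    by (rule lincomb_sum[symmetric]) simp
  also have "\<dots> = lincomb (\<lambda>w. \<Sum>f\<in>refined_rows a m b r R R'.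
      q ^ block_descents n f * of_bool (merge_outer \<circ> f = merge_outer \<circ> r4 \<circ> w))"
  proof (rule lincomb_cong)
    fix w
    show "(\<Sum>f\<in>rows_of_perms r4. \<phi> (?e f) * (q ^ block_descents n f * row_fibre r2 (merge_outer \<circ> f) w))
      = (\<Sum>f\<in>refined_rows a m b r R R'. q ^ block_descents n f * of_bool (merge_outer \<circ> f = merge_outer \<circ> r4 \<circ> w))"
    proof (rule sum.mono_neutral_cong_right)
      show "refined_rows a m b r R R' \<subseteq> rows_of_perms r4" by (auto simp: refined_rows_def r4_def)
      show "\<forall>f\<in>rows_of_perms r4 - refined_rows a m b r R R'.
        \<phi> (?e f) * (q ^ block_descents n f * row_fibre r2 (merge_outer \<circ> f) w) = 0"
      proof
        fix f assume f: "f \<in> rows_of_perms r4 - refined_rows a m b r R R'"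
        then have "r4 \<circ> ?e f = f" by (intro min_rep(2)) auto
        then have "\<phi> (?e f) = 0" using f unfolding \<phi>_def by simp
        then show "\<phi> (?e f) * (q ^ block_descents n f * row_fibre r2 (merge_outer \<circ> f) w) = 0"
          by simp
      qed
      fix f assume f: "f \<in> refined_rows a m b r R R'"
      then have "r4 \<circ> ?e f = f" by (intro min_rep(2)) (auto simp: refined_rows_def r4_def)
      then have "\<phi> (?e f) = 1" using f unfolding \<phi>_def by simp
      then show "\<phi> (?e f) * (q ^ block_descents n f * row_fibre r2 (merge_outer \<circ> f) w)
        = q ^ block_descents n f * of_bool (merge_outer \<circ> f = merge_outer \<circ> r4 \<circ> w)"
        by (auto simp: row_fibre_def r2_def)
    qed simp
  qed
  finally have "h \<otimes>\<^bsub>H\<^esub> young_sum r3 \<otimes>\<^bsub>H\<^esub> g = lincomb (\<lambda>w. \<Sum>f\<in>refined_rows a m b r R R'.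
      q ^ block_descents n f * of_bool (merge_outer \<circ> f = merge_outer \<circ> r4 \<circ> w))"
    unfolding h(2) .
  from this[symmetric] show ?thesis unfolding r3_def by (rule bexI[OF bexI[OF _ g(1)] h(1)])
qed

section \<open>Annihilation\<close>

definition alternating_young_sum :: "(nat \<Rightarrow> nat) \<Rightarrow> 'a hecke_elem" where
  "alternating_young_sum r = lincomb (\<lambda>w. inverse (- q) ^ inv_count n w * row_fibre r r w)"

lemma alternating_young_sum_closed [simp]: "alternating_young_sum r \<in> carrier H"
  by (simp add: alternating_young_sum_def)

text \<open>As \<open>r i = r (Suc i)\<close>, the Young subgroup splits into pairs
  \<open>w\<close>, \<open>w \<circ> simple_transp i\<close>. Taking \<open>z\<close> as the part
  supported on ascents at \<open>i\<close>, multiplication by \<open>T i\<close> produces the other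
  half, one power of \<open>inverse (- q)\<close> short.\<close>

lemma alternating_young_sum_factor:
  assumes i: "1 \<le> i" "i < n" and r: "r i = r (Suc i)"
  shows "\<exists>z\<in>carrier H. alternating_young_sum r = z \<oplus>\<^bsub>H\<^esub> (scal (inverse (- q)) \<otimes>\<^bsub>H\<^esub> (T i \<otimes>\<^bsub>H\<^esub> z))"
proof -
  let ?p = "inverse (- q)"
  let ?y = "\<lambda>w. ?p ^ inv_count n w * row_fibre r r w"
  define z where "z w = (if w i < w (Suc i) then ?y w else 0)" for w
  have rs: "r \<circ> simple_transp i = r" using r by (auto simp: fun_eq_iff simple_transp_apply)
  have "?y w = z w + ?p * left_shift i z w" if w: "w permutes {1..n}" for w
  proof (cases "w i < w (Suc i)")
    case True
    then have "z (w \<circ> simple_transp i) = 0" by (simp add: z_def simple_transp_apply)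
    then show ?thesis using True by (simp add: z_def left_shift_def)
  next
    case False
    then have d: "w (Suc i) < w i" using permutes_neq_Suc[OF w, of i] by simp
    then have "z (w \<circ> simple_transp i) = ?y (w \<circ> simple_transp i)"
      by (simp add: z_def simple_transp_apply)
    moreover have "row_fibre r r (w \<circ> simple_transp i) = (row_fibre r r w :: 'a)"
      by (simp only: row_fibre_comp_transp rs)
    moreover have "z w = 0" using False by (simp add: z_def)
    ultimately show ?thesis
      using False unfolding left_shift_def inv_count_comp_simple_transp_descent[OF i d] by simp
  qed
  then have "alternating_young_sum r = lincomb (\<lambda>w. z w + ?p * left_shift i z w)"
    unfolding alternating_young_sum_def by (rule lincomb_cong)
  also have "\<dots> = lincomb z \<oplus>\<^bsub>H\<^esub> (scal ?p \<otimes>\<^bsub>H\<^esub> (T i \<otimes>\<^bsub>H\<^esub> lincomb z))"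
    by (simp only: lincomb_add lincomb_smult T_lincomb[OF i])
  finally show ?thesis by (intro bexI[of _ "lincomb z"]) simp_all
qed

text \<open>Equal letters give \<open>x T_i = q x\<close>, while
  \<open>y = z - q\<inverse> T_i z\<close>; hence \<open>x y = x z - x z = 0\<close>. Here
  \<open>q\<close> has to be invertible.\<close>

lemma row_fibre_alternating_zero:
  assumes q: "q \<noteq> 0" and r: "mono_on {1..n} r" and i: "1 \<le> i" "i < n"
    and "c i = c (Suc i)" "r' i = r' (Suc i)"
  shows "lincomb (\<lambda>w. row_fibre r c (perm_inv w)) \<otimes>\<^bsub>H\<^esub> alternating_young_sum r' = \<zero>\<^bsub>H\<^esub>"
proof -
  obtain z where z: "z \<in> carrier H"
    "alternating_young_sum r' = z \<oplus>\<^bsub>H\<^esub> (scal (inverse (- q)) \<otimes>\<^bsub>H\<^esub> (T i \<otimes>\<^bsub>H\<^esub> z))"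
    using alternating_young_sum_factor[of i r', OF i assms(6)] by blast
  define x where "x = lincomb (\<lambda>w. row_fibre r c (perm_inv w))"
  have x: "x \<in> carrier H" "x \<otimes>\<^bsub>H\<^esub> T i = scal q \<otimes>\<^bsub>H\<^esub> x"
    unfolding x_def using row_fibre_T(2)[of r i c, OF r i assms(5)] by simp_all
  define p where "p = inverse (- q)"
  have p: "1 + p * q = 0" using q by (simp add: p_def)
  define y where "y = x \<otimes>\<^bsub>H\<^esub> z"
  have y: "y \<in> carrier H" using x(1) z(1) by (simp add: y_def)
  have "x \<otimes>\<^bsub>H\<^esub> alternating_young_sum r' = y \<oplus>\<^bsub>H\<^esub> (scal p \<otimes>\<^bsub>H\<^esub> (x \<otimes>\<^bsub>H\<^esub> T i \<otimes>\<^bsub>H\<^esub> z))"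
    unfolding z(2) using z(1) x(1) i by (simp add: p_def y_def H.r_distr scal_left_comm H.m_assoc)
  also have "\<dots> = scal 1 \<otimes>\<^bsub>H\<^esub> y \<oplus>\<^bsub>H\<^esub> (scal (p * q) \<otimes>\<^bsub>H\<^esub> y)"
    unfolding x(2) using z(1) x(1) y by (simp add: y_def scal_1 scal_mult H.m_assoc)
  also have "\<dots> = scal (1 + p * q) \<otimes>\<^bsub>H\<^esub> y"
    using y by (simp only: scal_add H.l_distr scal_closed)
  also have "\<dots> = \<zero>\<^bsub>H\<^esub>" unfolding p using y by (simp add: scal_0)
  finally show ?thesis unfolding x_def .
qed

text \<open>By pigeonhole every word of the type given by \<open>r\<close> has two equal letters in one block of \<open>r'\<close>, and
  they are adjacent because the blocks have at most two elements.\<close>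

lemma young_sum_alternating_zero:
  assumes q: "q \<noteq> 0" and r: "mono_on {1..n} r" and r': "mono_on {1..n} r'"
    and two: "\<And>k. 1 \<le> k \<Longrightarrow> k + 2 \<le> n \<Longrightarrow> r' k \<noteq> r' (k + 2)"
    and big: "card (fibre n r v) > card (r' ` {1..n})"
    and h: "h \<in> carrier H"
  shows "young_sum r \<otimes>\<^bsub>H\<^esub> (h \<otimes>\<^bsub>H\<^esub> alternating_young_sum r') = \<zero>\<^bsub>H\<^esub>"
proof -
  let ?E = "\<lambda>c. lincomb (\<lambda>w. row_fibre r c (perm_inv w))"
  let ?Y = "alternating_young_sum r'"
  have base: "?E c \<otimes>\<^bsub>H\<^esub> ?Y = \<zero>\<^bsub>H\<^esub>" if c: "c \<in> rows_of_perms r" for c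
  proof -
    have "\<not> inj_on r' (fibre n c v)"
    proof
      assume "inj_on r' (fibre n c v)"
      then have "card (fibre n c v) = card (r' ` fibre n c v)" by (simp add: card_image)
      also have "\<dots> \<le> card (r' ` {1..n})" by (rule card_mono) (auto simp: fibre_def)
      finally show False using big card_fibre_rows_of_perms[OF c] by simp
    qed
    then obtain i j where ij: "i < j" "i \<in> fibre n c v" "j \<in> fibre n c v" "r' i = r' j"
      by (metis inj_onI linorder_neqE_nat)
    have "j = Suc i"
    proof (rule ccontr)
      assume "j \<noteq> Suc i"
      then have le: "i + 2 \<le> j" using ij(1) by simp
      then have "r' i \<le> r' (i + 2)" "r' (i + 2) \<le> r' j"
        using ij(2,3) by (auto simp: fibre_def intro!: mono_onD[OF r'])
      then show False using two[of i] le ij by (auto simp: fibre_def)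
    qed
    then show ?thesis using ij by (intro row_fibre_alternating_zero[OF q r, of i]) (auto simp: fibre_def)
  qed
  \<comment> \<open>All right coset sums are treated at once: a generator turns one into a
    combination of others, so the claim for \<open>young_sum r\<close> alone would not survive the
    induction on \<open>h\<close>.\<close>
  have "\<forall>c\<in>rows_of_perms r. ?E c \<otimes>\<^bsub>H\<^esub> (h \<otimes>\<^bsub>H\<^esub> ?Y) = \<zero>\<^bsub>H\<^esub>"
    using h
  proof (induction h rule: hecke_induct)
    case one
    then show ?case using base by simp
  next
    case (add x y)
    then show ?case by (simp add: H.l_distr H.r_distr)
  next
    case (scal c x)
    then show ?case by (simp add: H.m_assoc scal_left_comm)
  next
    case (gen i x)
    show ?case
    proof
      fix c assume c: "c \<in> rows_of_perms r"
      have cs: "c \<circ> simple_transp i \<in> rows_of_perms r"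
        using c permutes_comp_simple_transp(1)[OF _ gen(1,2)]
        by (auto simp: rows_of_perms_def comp_assoc)
      have "?E c \<otimes>\<^bsub>H\<^esub> (T i \<otimes>\<^bsub>H\<^esub> x \<otimes>\<^bsub>H\<^esub> ?Y) = (?E c \<otimes>\<^bsub>H\<^esub> T i) \<otimes>\<^bsub>H\<^esub> (x \<otimes>\<^bsub>H\<^esub> ?Y)"
        using gen(1-3) by (simp add: H.m_assoc)
      also have "\<dots> = \<zero>\<^bsub>H\<^esub>"
      proof -
        have z: "?E c \<otimes>\<^bsub>H\<^esub> (x \<otimes>\<^bsub>H\<^esub> ?Y) = \<zero>\<^bsub>H\<^esub>"
          "?E (c \<circ> simple_transp i) \<otimes>\<^bsub>H\<^esub> (x \<otimes>\<^bsub>H\<^esub> ?Y) = \<zero>\<^bsub>H\<^esub>"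
          using gen(4) c cs by blast+
        consider "c i < c (Suc i)" | "c i = c (Suc i)" | "c (Suc i) < c i" by linarith
        then show ?thesis
        proof cases
          case 1
          show ?thesis unfolding row_fibre_T(1)[OF r gen(1,2) 1] by (rule z(2))
        next
          case 2
          show ?thesis unfolding row_fibre_T(2)[OF r gen(1,2) 2]
            using gen(3) z(1) by (simp add: H.m_assoc)
        next
          case 3
          show ?thesis unfolding row_fibre_T(3)[OF r gen(1,2) 3]
            using gen(3) z by (simp add: H.l_distr H.m_assoc)
        qed
      qed
      finally show "?E c \<otimes>\<^bsub>H\<^esub> (T i \<otimes>\<^bsub>H\<^esub> x \<otimes>\<^bsub>H\<^esub> ?Y) = \<zero>\<^bsub>H\<^esub>" .
    qed
  qed
  moreover have "r \<in> rows_of_perms r"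
    unfolding rows_of_perms_def using permutes_id[of "{1..n}"] by (intro image_eqI[of _ _ id]) simp_all
  ultimately show ?thesis unfolding young_sum_right by blast
qed

end

section \<open>Row functions of compositions\<close>

text \<open>Values off \<open>{1..n}\<close> are left free, so that suitably merged
  \<open>four_blocks\<close> and the canonical \<open>row_of\<close> both qualify.\<close>

definition row_function :: "(nat \<Rightarrow> nat) \<Rightarrow> (nat \<Rightarrow> nat) \<Rightarrow> bool" where
  "row_function lam r \<longleftrightarrow> (\<forall>b\<in>diagram lam. r (row_tab lam b) = fst b)"

definition row_of :: "(nat \<Rightarrow> nat) \<Rightarrow> nat \<Rightarrow> nat" where
  "row_of lam k = fst (inv_into (diagram lam) (row_tab lam) k)"

lemma sum_parts_le:
  assumes "composition_of n lam"
  shows "(\<Sum>k=1..r. lam k) \<le> n"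
proof -
  have fin: "finite {i. lam i \<noteq> 0}" and n: "(\<Sum>i | lam i \<noteq> 0. lam i) = n"
    using assms by (auto simp: composition_of_def)
  have "(\<Sum>k=1..r. lam k) = (\<Sum>k\<in>{1..r} \<inter> {i. lam i \<noteq> 0}. lam k)"
    by (rule sum.mono_neutral_right) auto
  also have "\<dots> \<le> (\<Sum>i | lam i \<noteq> 0. lam i)"
    by (rule sum_mono2[OF fin]) auto
  finally show ?thesis using n by simp
qed

lemma row_tab_less:
  assumes "(r, c) \<in> diagram lam" "(r', c') \<in> diagram lam" "r < r'"
  shows "row_tab lam (r, c) < row_tab lam (r', c')"
proof -
  have "c \<le> lam r" "1 \<le> c'" "1 \<le> r" using assms by (auto simp: diagram_def)
  then have "row_tab lam (r, c) \<le> (\<Sum>k=1..<Suc r. lam k)" by (simp add: row_tab_def)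
  also have "\<dots> \<le> (\<Sum>k=1..<r'. lam k)" by (rule sum_mono2) (use assms in auto)
  also have "\<dots> < row_tab lam (r', c')" using \<open>1 \<le> c'\<close> by (simp add: row_tab_def)
  finally show ?thesis .
qed

lemma inj_on_row_tab: "inj_on (row_tab lam) (diagram lam)"
proof (rule inj_onI)
  fix x y assume *: "x \<in> diagram lam" "y \<in> diagram lam" "row_tab lam x = row_tab lam y"
  obtain r c r' c' where xy: "x = (r, c)" "y = (r', c')" by fastforce
  have "r = r'"
    using row_tab_less[of r c lam r' c'] row_tab_less[of r' c' lam r c] * xy
    by (metis less_irrefl linorder_neqE_nat)
  then show "x = y" using * xy by (simp add: row_tab_def)
qed

lemma diagram_eq_Sigma: "lam 0 = 0 \<Longrightarrow> diagram lam = (SIGMA r:{i. lam i \<noteq> 0}. {1..lam r})"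
proof -
  assume "lam 0 = 0"
  then have "(r, c) \<in> diagram lam \<longleftrightarrow> lam r \<noteq> 0 \<and> 1 \<le> c \<and> c \<le> lam r" for r c
    by (cases "r = 0") (auto simp: diagram_def)
  then show ?thesis by auto
qed

lemma finite_card_diagram:
  assumes "composition_of n lam"
  shows "finite (diagram lam)" "card (diagram lam) = n"
  using assms by (simp_all add: composition_of_def diagram_eq_Sigma)

lemma bij_betw_row_tab:
  assumes "composition_of n lam"
  shows "bij_betw (row_tab lam) (diagram lam) {1..n}"
proof -
  have "row_tab lam ` diagram lam \<subseteq> {1..n}"
  proof clarify
    fix r c assume rc: "(r, c) \<in> diagram lam"
    then have "c \<le> lam r" "1 \<le> c" "1 \<le> r" by (auto simp: diagram_def)
    then have "row_tab lam (r, c) \<le> (\<Sum>k=1..<Suc r. lam k)" by (simp add: row_tab_def)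
    also have "\<dots> = (\<Sum>k=1..r. lam k)" by (simp only: atLeastLessThanSuc_atLeastAtMost)
    also have "\<dots> \<le> n" by (rule sum_parts_le[OF assms])
    finally show "row_tab lam (r, c) \<in> {1..n}" using \<open>1 \<le> c\<close> by (simp add: row_tab_def)
  qed
  moreover have "card (row_tab lam ` diagram lam) = card {1..n}"
    using finite_card_diagram[OF assms] by (simp add: card_image inj_on_row_tab)
  ultimately have "row_tab lam ` diagram lam = {1..n}" by (simp add: card_subset_eq)
  then show ?thesis by (simp add: bij_betw_def inj_on_row_tab)
qed

lemma row_tab_range:
  assumes "composition_of n lam" "k \<in> {1..n}"
  obtains b where "b \<in> diagram lam" "k = row_tab lam b"
  using bij_betw_imp_surj_on[OF bij_betw_row_tab[OF assms(1)]] assms(2) by blast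

lemma row_tab_in_range: "composition_of n lam \<Longrightarrow> b \<in> diagram lam \<Longrightarrow> row_tab lam b \<in> {1..n}"
  using bij_betw_imp_surj_on[OF bij_betw_row_tab] by blast

lemma row_function_row_of: "row_function lam (row_of lam)"
  by (simp add: row_function_def row_of_def inv_into_f_f inj_on_row_tab)

lemma fibre_row_function:
  assumes "composition_of n lam" "row_function lam r"
  shows "fibre n r i = {row_tab lam (i, c) | c. (i, c) \<in> diagram lam}"
proof (intro subset_antisym subsetI)
  fix k assume k: "k \<in> fibre n r i"
  then obtain b where b: "b \<in> diagram lam" "k = row_tab lam b"
    using row_tab_range[OF assms(1), of k] by (auto simp: fibre_def)
  then have "fst b = i" using k assms(2) by (auto simp: fibre_def row_function_def)
  then show "k \<in> {row_tab lam (i, c) | c. (i, c) \<in> diagram lam}" using b by (cases b) auto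
next
  fix k assume "k \<in> {row_tab lam (i, c) | c. (i, c) \<in> diagram lam}"
  then show "k \<in> fibre n r i"
    using assms row_tab_in_range[OF assms(1)] unfolding fibre_def row_function_def by fastforce
qed

lemma fibre_row_function_image:
  assumes "composition_of n lam" "row_function lam r"
  shows "fibre n r i = (\<lambda>c. row_tab lam (i, c)) ` {1..lam i}"
  using assms(1) by (auto simp: fibre_row_function[OF assms] diagram_def composition_of_def intro!: Suc_leI Nat.gr0I)

lemma inj_row_tab_row: "inj_on (\<lambda>c. row_tab lam (i, c)) A"
  by (auto simp: inj_on_def row_tab_def)

lemma card_fibre_row_function:
  assumes "composition_of n lam" "row_function lam r"
  shows "card (fibre n r i) = lam i"
  by (simp add: fibre_row_function_image[OF assms] card_image inj_row_tab_row)

lemma row_function_mono_on: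
  assumes "composition_of n lam" "row_function lam r"
  shows "mono_on {1..n} r"
proof (rule mono_onI)
  fix j k assume jk: "j \<in> {1..n}" "k \<in> {1..n}" "j \<le> k"
  obtain b b' where b: "b \<in> diagram lam" "j = row_tab lam b" "b' \<in> diagram lam" "k = row_tab lam b'"
    using row_tab_range[OF assms(1)] jk by metis
  have "fst b \<le> fst b'"
    using row_tab_less[of "fst b'" "snd b'" lam "fst b" "snd b"] b jk(3)
    by (metis linorder_not_less prod.collapse)
  then show "r j \<le> r k" using b assms(2) by (simp add: row_function_def)
qed

text \<open>A permutation that maps each row into itself maps it onto itself, by cardinality. From
  here on Young subgroups are handled through row functions.\<close>

lemma young_subgroup_iff:
  assumes "composition_of n lam" "row_function lam r"
  shows "w \<in> young_subgroup n lam \<longleftrightarrow> w permutes {1..n} \<and> r \<circ> w = r"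
proof -
  have "(\<forall>i\<ge>1. w ` fibre n r i = fibre n r i) \<longleftrightarrow> r \<circ> w = r" if w: "w permutes {1..n}"
  proof
    assume *: "\<forall>i\<ge>1. w ` fibre n r i = fibre n r i"
    show "r \<circ> w = r"
    proof
      fix k
      show "(r \<circ> w) k = r k"
      proof (cases "k \<in> {1..n}")
        case True
        then obtain b where b: "b \<in> diagram lam" "k = row_tab lam b"
          using row_tab_range[OF assms(1)] by blast
        then have "r k \<ge> 1" using assms(2) by (auto simp: row_function_def diagram_def)
        moreover have "k \<in> fibre n r (r k)" using True by (simp add: fibre_def)
        ultimately have "w k \<in> fibre n r (r k)" using * by blast
        then show ?thesis by (simp add: fibre_def)
      next
        case False
        then show ?thesis using permutes_not_in[OF w] by simp
      qed
    qed
  next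
    assume rw: "r \<circ> w = r"
    show "\<forall>i\<ge>1. w ` fibre n r i = fibre n r i"
    proof (intro allI impI card_subset_eq)
      fix i
      show "w ` fibre n r i \<subseteq> fibre n r i"
        using permutes_in_image[OF w] fun_cong[OF rw] by (auto simp: fibre_def)
      show "card (w ` fibre n r i) = card (fibre n r i)"
        by (rule card_image[OF permutes_inj_on[OF w]])
    qed simp
  qed
  then show ?thesis
    unfolding young_subgroup_def fibre_row_function[OF assms, symmetric] by blast
qed

section \<open>Conjugate partitions\<close>

text \<open>Parts decrease weakly, so the rows that reach column \<open>j\<close> form an initial
  segment.\<close>

lemma conjugate_set_eq:
  assumes "partition_of n mu" "1 \<le> j"
  shows "{i. 1 \<le> i \<and> j \<le> mu i} = {1..conjugate mu j}"
proof -
  let ?D = "{i. 1 \<le> i \<and> j \<le> mu i}"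
  have "finite {i. mu i \<noteq> 0}" using assms(1) by (auto simp: partition_of_def composition_of_def)
  then have fin: "finite ?D" by (rule rev_finite_subset) (use assms(2) in auto)
  have down: "i' \<in> ?D" if "i \<in> ?D" "1 \<le> i'" "i' \<le> i" for i i'
    using assms(1) that unfolding partition_of_def by (auto intro: order_trans)
  have "?D = {1..card ?D}"
  proof (cases "?D = {}")
    case False
    have "?D = {1..Max ?D}"
    proof
      show "{1..Max ?D} \<subseteq> ?D" using down[OF Max_in[OF fin False]] by auto
    qed (use Max_ge[OF fin] in auto)
    then show ?thesis by (metis card_atLeastAtMost diff_Suc_1)
  next
    case True
    then show ?thesis by (simp only: card.empty) simp
  qed
  then show ?thesis using assms(2) by (simp add: conjugate_def)
qed

lemma diagram_conjugate:
  assumes "partition_of n mu"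
  shows "(c, r) \<in> diagram (conjugate mu) \<longleftrightarrow> (r, c) \<in> diagram mu"
  using conjugate_set_eq[OF assms, of c] by (auto simp: diagram_def set_eq_iff)

lemma diagram_conjugate_image:
  assumes "partition_of n mu"
  shows "diagram (conjugate mu) = prod.swap ` diagram mu"
proof -
  have "p \<in> diagram (conjugate mu) \<longleftrightarrow> p \<in> prod.swap ` diagram mu" for p
  proof -
    obtain c r where "p = (c, r)" by (cases p)
    moreover have "(c, r) \<in> prod.swap ` diagram mu \<longleftrightarrow> (r, c) \<in> diagram mu" by force
    ultimately show ?thesis using diagram_conjugate[OF assms] by simp
  qed
  then show ?thesis by blast
qed

lemma composition_conjugate:
  assumes "partition_of n mu"
  shows "composition_of n (conjugate mu)"
proof -
  have comp: "composition_of n mu" using assms by (simp add: partition_of_def)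
  have 0: "conjugate mu 0 = 0" by (simp add: conjugate_def)
  have fin: "finite (diagram (conjugate mu))"
    unfolding diagram_conjugate_image[OF assms] using finite_card_diagram(1)[OF comp] by simp
  have supp: "{j. conjugate mu j \<noteq> 0} \<subseteq> fst ` diagram (conjugate mu)"
  proof
    fix j assume "j \<in> {j. conjugate mu j \<noteq> 0}"
    moreover have "j \<noteq> 0" using calculation 0 by (metis (mono_tags, lifting) mem_Collect_eq)
    ultimately have "(j, 1) \<in> diagram (conjugate mu)" by (simp add: diagram_def)
    then show "j \<in> fst ` diagram (conjugate mu)" by force
  qed
  then have fin': "finite {j. conjugate mu j \<noteq> 0}" using fin by (auto intro: finite_subset)
  have "card (diagram (conjugate mu)) = n"
    unfolding diagram_conjugate_image[OF assms]
    using finite_card_diagram(2)[OF comp] by (simp add: card_image)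
  then have "(\<Sum>j | conjugate mu j \<noteq> 0. conjugate mu j) = n"
    using fin' by (simp add: diagram_eq_Sigma[of "conjugate mu", OF 0])
  then show ?thesis using 0 fin' by (simp add: composition_of_def)
qed

text \<open>Filling down the columns is filling along the rows of the transposed diagram.\<close>

lemma bij_betw_col_tab:
  assumes "partition_of n mu"
  shows "bij_betw (col_tab mu) (diagram mu) {1..n}"
proof -
  have "col_tab mu = row_tab (conjugate mu) \<circ> prod.swap"
    by (auto simp: fun_eq_iff col_tab_def row_tab_def)
  moreover have "bij_betw prod.swap (diagram mu) (diagram (conjugate mu))"
    unfolding diagram_conjugate_image[OF assms] by (simp add: bij_betw_def)
  ultimately show ?thesis
    using bij_betw_row_tab[OF composition_conjugate[OF assms]] bij_betw_trans by metis
qed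

text \<open>Both tableaux are bijections onto \<open>{1..n}\<close>, so going back along one and
  forward along the other is the unique permutation that the definite description asks for.\<close>

lemma w_perm_permutes:
  assumes "partition_of n mu"
  shows "w_perm n mu permutes {1..n}"
proof -
  have comp: "composition_of n mu" using assms by (simp add: partition_of_def)
  let ?P = "\<lambda>w. w permutes {1..n} \<and> (\<forall>b\<in>diagram mu. w (row_tab mu b) = col_tab mu b)"
  let ?f = "\<lambda>k. if k \<in> {1..n} then col_tab mu (inv_into (diagram mu) (row_tab mu) k) else k"
  have "bij_betw (col_tab mu \<circ> inv_into (diagram mu) (row_tab mu)) {1..n} {1..n}"
    by (rule bij_betw_trans[OF bij_betw_inv_into[OF bij_betw_row_tab[OF comp]] bij_betw_col_tab[OF assms]])
  then have "bij_betw ?f {1..n} {1..n}" by (rule bij_betw_cong[THEN iffD1, rotated]) simp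
  then have "?f permutes {1..n}" by (rule bij_imp_permutes) (rule if_not_P)
  moreover have "?f (row_tab mu b) = col_tab mu b" if "b \<in> diagram mu" for b
    using that row_tab_in_range[OF comp that] by (simp add: inv_into_f_f inj_on_row_tab)
  ultimately have ex: "?P ?f" by blast
  have "w = w'" if w: "?P w" and w': "?P w'" for w w'
  proof
    fix k
    show "w k = w' k"
    proof (cases "k \<in> {1..n}")
      case True
      then obtain b where "b \<in> diagram mu" "k = row_tab mu b" using row_tab_range[OF comp] by blast
      then show ?thesis using w w' by simp
    next
      case False
      then show ?thesis using w w' permutes_not_in by metis
    qed
  qed
  then have "\<exists>!w. ?P w" using ex by blast
  from theI'[OF this] show ?thesis unfolding w_perm_def by blast
qed

section \<open>Tableau homomorphisms\<close>

lemma count_content: "finite P \<Longrightarrow> count (content f P) v = card {k \<in> P. f k = v}"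
  by (auto simp: count_image_mset Int_def vimage_def intro!: arg_cong[of _ _ card])

definition has_type :: "nat \<Rightarrow> (nat \<Rightarrow> nat) \<Rightarrow> (nat \<Rightarrow> nat) \<Rightarrow> tableau \<Rightarrow> bool" where
  "has_type n mu lam A \<longleftrightarrow> (\<forall>i. card {b \<in> diagram mu. A b = i} = lam i)"

text \<open>Reading \<open>A\<close> along the positions of \<open>\<mu>\<close> gives a word
  \<open>\<alpha>\<close>; the permutation sought is the inverse of the increasing representative
  \<open>e\<close> with \<open>r \<circ> e = \<alpha>\<close> on \<open>{1..n}\<close>. It is unique
  because the image of each row of \<open>\<lambda>\<close> is prescribed and must be listed in
  increasing order.\<close>

lemma one_perm:
  assumes mu: "composition_of n mu" and lam: "composition_of n lam" and r: "row_function lam r"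
    and A: "has_type n mu lam A"
  shows "one_perm n mu lam A permutes {1..n}"
    and "\<And>b. b \<in> diagram mu \<Longrightarrow> r (perm_inv (one_perm n mu lam A) (row_tab mu b)) = A b"
proof -
  let ?P = "\<lambda>w. w permutes {1..n} \<and>
        (\<forall>i c d. (i, c) \<in> diagram lam \<and> (i, d) \<in> diagram lam \<and> c < d
            \<longrightarrow> w (row_tab lam (i, c)) < w (row_tab lam (i, d))) \<and>
        (\<forall>b\<in>diagram mu. \<exists>c. (A b, c) \<in> diagram lam \<and> w (row_tab lam (A b, c)) = row_tab mu b)"
  define \<alpha> where "\<alpha> p = A (inv_into (diagram mu) (row_tab mu) p)" for p
  have \<alpha>: "\<alpha> (row_tab mu b) = A b" if "b \<in> diagram mu" for b
    using that by (simp add: \<alpha>_def inv_into_f_f inj_on_row_tab)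
  have "card (fibre n r v) = card (fibre n \<alpha> v)" for v
  proof -
    have "fibre n \<alpha> v = row_tab mu ` {b \<in> diagram mu. A b = v}"
    proof (intro subset_antisym subsetI)
      fix k assume "k \<in> fibre n \<alpha> v"
      then have k: "k \<in> {1..n}" "\<alpha> k = v" by (auto simp: fibre_def)
      obtain b where b: "b \<in> diagram mu" "k = row_tab mu b" by (rule row_tab_range[OF mu k(1)])
      then have "A b = v" using k(2) \<alpha>[OF b(1)] by simp
      then show "k \<in> row_tab mu ` {b \<in> diagram mu. A b = v}" using b by simp
    qed (use \<alpha> row_tab_in_range[OF mu] in \<open>auto simp: fibre_def\<close>)
    then have "card (fibre n \<alpha> v) = lam v"
      using A by (simp add: has_type_def card_image inj_on_subset[OF inj_on_row_tab])
    then show ?thesis by (simp add: card_fibre_row_function[OF lam r])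
  qed
  then obtain w0 where w0: "w0 permutes {1..n}" "\<And>k. k \<in> {1..n} \<Longrightarrow> r k = \<alpha> (w0 k)"
    using exists_perm_of_card_fibres[of n r \<alpha>] by blast
  obtain e where e: "e permutes {1..n}" "r \<circ> e = r \<circ> perm_inv w0" "increasing_in_rows n r e"
    using exists_increasing_in_rows[OF permutes_inv[OF w0(1)]] by blast
  have we: "perm_inv e permutes {1..n}" by (rule permutes_inv[OF e(1)])
  note ei = permutes_inverses[OF e(1)]
  have in_n: "perm_inv e k \<in> {1..n} \<longleftrightarrow> k \<in> {1..n}" for k by (rule permutes_in_image[OF we])
  have re: "r (e p) = \<alpha> p" if "p \<in> {1..n}" for p
    using fun_cong[OF e(2), of p] w0(2)[of "perm_inv w0 p"] permutes_in_image[OF permutes_inv[OF w0(1)]]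
      permutes_inverses(1)[OF w0(1)] that by simp
  have ex: "?P (perm_inv e)"
  proof (intro conjI allI impI ballI)
    show "perm_inv e permutes {1..n}" by fact
    fix i c d assume icd: "(i, c) \<in> diagram lam \<and> (i, d) \<in> diagram lam \<and> c < d"
    let ?j = "row_tab lam (i, c)" and ?k = "row_tab lam (i, d)"
    have jk: "?j < ?k" "r ?j = i" "r ?k = i" "?j \<in> {1..n}" "?k \<in> {1..n}"
      using icd r row_tab_in_range[OF lam] by (auto simp: row_tab_def[of lam] row_function_def)
    show "perm_inv e ?j < perm_inv e ?k"
    proof (rule ccontr)
      assume "\<not> ?thesis"
      moreover have "perm_inv e ?j \<noteq> perm_inv e ?k" using jk(1) ei(1)[of ?j] ei(1)[of ?k] by auto
      ultimately have "perm_inv e ?k < perm_inv e ?j" by simp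
      then have "e (perm_inv e ?k) < e (perm_inv e ?j)"
        using e(3)[unfolded increasing_in_rows_def, rule_format, of "perm_inv e ?k" "perm_inv e ?j"]
          jk in_n[of ?j] in_n[of ?k] by (simp add: ei)
      then show False using jk(1) by (simp add: ei)
    qed
  next
    fix b assume b: "b \<in> diagram mu"
    let ?p = "row_tab mu b"
    have p: "?p \<in> {1..n}" by (rule row_tab_in_range[OF mu b])
    then have "e ?p \<in> {1..n}" using permutes_in_image[OF e(1)] by blast
    then obtain b' where b': "b' \<in> diagram lam" "e ?p = row_tab lam b'" by (rule row_tab_range[OF lam])
    then have "fst b' = A b" using re[OF p] \<alpha>[OF b] r by (simp add: row_function_def)
    then have "(A b, snd b') = b'" by (simp add: prod_eq_iff)
    then have "(A b, snd b') \<in> diagram lam" "row_tab lam (A b, snd b') = e ?p" using b' by simp_all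
    then show "\<exists>c. (A b, c) \<in> diagram lam \<and> perm_inv e (row_tab lam (A b, c)) = ?p"
      by (intro exI[of _ "snd b'"]) (simp add: ei)
  qed
  have val: "\<alpha> (w k) = r k" if w: "?P w" and k: "k \<in> {1..n}" for w k
  proof -
    have wp: "w permutes {1..n}" using w by (rule conjunct1)
    have "w k \<in> {1..n}" using k by (simp only: permutes_in_image[OF wp])
    then obtain b where b: "b \<in> diagram mu" "w k = row_tab mu b" by (rule row_tab_range[OF mu])
    then obtain c where c: "(A b, c) \<in> diagram lam" "w (row_tab lam (A b, c)) = row_tab mu b"
      using w by blast
    then have "k = row_tab lam (A b, c)" using b(2) injD[OF permutes_inj[OF wp]] by simp
    then show ?thesis using b c r \<alpha> by (simp add: row_function_def)
  qed
  have inc: "w j < w k" if w: "?P w" and jk: "j < k" "j \<in> {1..n}" "k \<in> {1..n}" "r j = r k" for w j k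
  proof -
    obtain b where b: "b \<in> diagram lam" "j = row_tab lam b" by (rule row_tab_range[OF lam jk(2)])
    obtain b' where b': "b' \<in> diagram lam" "k = row_tab lam b'" by (rule row_tab_range[OF lam jk(3)])
    have "fst b = fst b'" using b b' r jk(4) by (simp add: row_function_def)
    moreover obtain i c where "b = (i, c)" by (cases b)
    moreover obtain i' d where "b' = (i', d)" by (cases b')
    ultimately have "b = (i, c)" "b' = (i, d)" by auto
    moreover have "c < d" using jk(1) b(2) b'(2) calculation by (simp add: row_tab_def)
    ultimately show ?thesis using w b b' by blast
  qed
  \<comment> \<open>At a first disagreement \<open>k\<close>, the value \<open>w k\<close> is
    \<open>w' j\<close> for some \<open>j\<close> in the same row. Monotonicity of \<open>w'\<close>
    along the row gives \<open>j < k\<close>, where both maps agree, against injectivity of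
    \<open>w\<close>.\<close>
  have not_less: "\<not> w k < w' k"
    if w: "?P w" and w': "?P w'" and k: "k \<in> {1..n}" and IH: "\<And>j. j < k \<Longrightarrow> w j = w' j" for w w' k
  proof
    assume less: "w k < w' k"
    have w'p: "w' permutes {1..n}" and wp: "w permutes {1..n}" using w w' by blast+
    define j where "j = perm_inv w' (w k)"
    have wj: "w' j = w k" unfolding j_def by (rule permutes_inverses(1)[OF w'p])
    have j: "j \<in> {1..n}"
      using k permutes_in_image[OF wp, of k] permutes_in_image[OF w'p, of j] wj by simp
    have "r j = r k" using val[OF w' j] val[OF w k] wj by simp
    have "j \<noteq> k" using less wj by auto
    moreover have "\<not> k < j"
      using inc[OF w' _ k j] \<open>r j = r k\<close> less wj by auto
    ultimately have "j < k" by simp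
    then have "w j = w k" using IH wj by simp
    then show False using \<open>j \<noteq> k\<close> injD[OF permutes_inj[OF wp]] by metis
  qed
  have "w = w'" if w: "?P w" and w': "?P w'" for w w'
  proof
    fix k
    show "w k = w' k"
    proof (induction k rule: less_induct)
      case (less k)
      show ?case
      proof (cases "k \<in> {1..n}")
        case True
        then show ?thesis
          using not_less[OF w w' True less] not_less[OF w' w True less[symmetric]] by simp
      next
        case False
        then show ?thesis using w w' permutes_not_in by metis
      qed
    qed
  qed
  then have "\<exists>!w. ?P w" using ex by blast
  from theI'[OF this] have P: "?P (one_perm n mu lam A)" unfolding one_perm_def by blast
  then show wp: "one_perm n mu lam A permutes {1..n}" by blast
  fix b assume b: "b \<in> diagram mu"
  let ?k = "perm_inv (one_perm n mu lam A) (row_tab mu b)"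
  have "?k \<in> {1..n}"
    using permutes_in_image[OF permutes_inv[OF wp]] row_tab_in_range[OF mu b] by blast
  from val[OF P this] show "r ?k = A b" using \<alpha>[OF b] permutes_inverses(1)[OF wp] by simp
qed

text \<open>A double coset of Young subgroups is determined by how many points of each row of
  \<open>\<lambda>\<close> are sent to each row of \<open>\<mu>\<close>; the row contents record
  these numbers.\<close>

lemma double_coset_eq:
  assumes mu: "composition_of n mu" "row_function mu s" and lam: "composition_of n lam" "row_function lam r"
    and d: "d permutes {1..n}"
  shows "double_coset n lam d mu =
    {w. w permutes {1..n} \<and> (\<forall>g. content r (fibre n (s \<circ> w) g) = content r (fibre n (s \<circ> d) g))}"
    (is "?L = ?R")
proof (intro subset_antisym subsetI)
  fix w assume "w \<in> ?L"
  then obtain u v where w: "w = v \<circ> d \<circ> u" and u: "u permutes {1..n}" "r \<circ> u = r"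
    and v: "v permutes {1..n}" "s \<circ> v = s"
    unfolding double_coset_def young_subgroup_iff[OF mu] young_subgroup_iff[OF lam] by blast
  have "w permutes {1..n}" unfolding w by (intro permutes_compose u v d)
  moreover have "content r (fibre n (s \<circ> w) g) = content r (fibre n (s \<circ> d) g)" for g
  proof -
    have sw: "s (w k) = s (d (u k))" for k using fun_cong[OF v(2), of "d (u k)"] by (simp add: w)
    have img: "u ` fibre n (s \<circ> w) g = fibre n (s \<circ> d) g"
    proof (intro subset_antisym subsetI)
      fix k assume "k \<in> fibre n (s \<circ> d) g"
      then have "perm_inv u k \<in> fibre n (s \<circ> w) g"
        using permutes_in_image[OF permutes_inv[OF u(1)]] permutes_inverses(1)[OF u(1)]
        by (simp add: fibre_def sw)
      then show "k \<in> u ` fibre n (s \<circ> w) g"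
        using permutes_inverses(1)[OF u(1), of k] by (intro image_eqI[of _ _ "perm_inv u k"]) simp_all
    qed (use permutes_in_image[OF u(1)] in \<open>auto simp: fibre_def sw\<close>)
    have "content r (fibre n (s \<circ> d) g) = image_mset r (image_mset u (mset_set (fibre n (s \<circ> w) g)))"
      unfolding img[symmetric] by (simp only: image_mset_mset_set[OF permutes_inj_on[OF u(1)]])
    also have "\<dots> = image_mset (r \<circ> u) (mset_set (fibre n (s \<circ> w) g))"
      by (simp add: multiset.map_comp)
    finally show ?thesis by (simp only: u(2))
  qed
  ultimately show "w \<in> ?R" by blast
next
  fix w assume "w \<in> ?R"
  then have w: "w permutes {1..n}" "\<And>g. content r (fibre n (s \<circ> w) g) = content r (fibre n (s \<circ> d) g)"
    by auto
  have cnt: "count (image_mset (\<lambda>k. (r k, s (v k))) (mset_set {1..n})) (i, g)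
      = count (content r (fibre n (s \<circ> v) g)) i" for v i g
  proof -
    have "count (image_mset (\<lambda>k. (r k, s (v k))) (mset_set {1..n})) (i, g)
        = card {k \<in> {1..n}. r k = i \<and> s (v k) = g}"
      by (auto simp: count_image_mset Int_def vimage_def intro!: arg_cong[of _ _ card])
    also have "{k \<in> {1..n}. r k = i \<and> s (v k) = g} = {k \<in> fibre n (s \<circ> v) g. r k = i}"
      by (auto simp: fibre_def)
    finally show ?thesis by (simp add: count_content)
  qed
  have "image_mset (\<lambda>k. (r k, s (w k))) (mset_set {1..n}) = image_mset (\<lambda>k. (r k, s (d k))) (mset_set {1..n})"
  proof (rule multiset_eqI)
    fix x :: "nat \<times> nat"
    obtain i g where "x = (i, g)" by (cases x)
    then show "count (image_mset (\<lambda>k. (r k, s (w k))) (mset_set {1..n})) x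
      = count (image_mset (\<lambda>k. (r k, s (d k))) (mset_set {1..n})) x"
      by (simp only: cnt w(2))
  qed
  \<comment> \<open>The first coordinate says that \<open>u\<close> preserves the rows of
    \<open>\<lambda>\<close>, the second that the remaining factor \<open>v\<close> preserves the
    rows of \<open>\<mu>\<close>.\<close>
  then obtain u where u: "u permutes {1..n}"
    "\<forall>k\<in>{1..n}. (r k, s (w k)) = (r (u k), s (d (u k)))"
    by (rule image_mset_eq_implies_permutes[OF finite_atLeastAtMost])
  define v where "v = w \<circ> perm_inv u \<circ> perm_inv d"
  have vp: "v permutes {1..n}"
    unfolding v_def by (intro permutes_compose permutes_inv u(1) d w(1))
  have w_eq: "w = v \<circ> d \<circ> u"
    using permutes_inverses(2)[OF d] permutes_inverses(2)[OF u(1)] by (auto simp: v_def)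
  have "r \<circ> u = r"
  proof
    fix k show "(r \<circ> u) k = r k"
      using u permutes_not_in[OF u(1), of k] by (cases "k \<in> {1..n}") auto
  qed
  then have "u \<in> young_subgroup n lam" using u(1) young_subgroup_iff[OF lam] by blast
  moreover have "s \<circ> v = s"
  proof
    fix p
    show "(s \<circ> v) p = s p"
    proof (cases "p \<in> {1..n}")
      case True
      let ?k = "perm_inv u (perm_inv d p)"
      have "?k \<in> {1..n}"
        using True permutes_in_image[OF permutes_inv[OF u(1)]] permutes_in_image[OF permutes_inv[OF d]] by blast
      then have "s (w ?k) = s (d (u ?k))" using u(2) by auto
      then show ?thesis
        by (simp add: v_def permutes_inverses(1)[OF u(1)] permutes_inverses(1)[OF d])
    next
      case False
      then show ?thesis using permutes_not_in[OF vp] by simp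
    qed
  qed
  then have "v \<in> young_subgroup n mu" using vp young_subgroup_iff[OF mu] by blast
  ultimately show "w \<in> ?L" unfolding double_coset_def w_eq by blast
qed

lemma content_one_perm:
  assumes mu: "composition_of n mu" "row_function mu s" and lam: "composition_of n lam" "row_function lam r"
    and A: "has_type n mu lam A"
  shows "content r (fibre n (s \<circ> one_perm n mu lam A) g) = row_entries mu A g"
proof -
  let ?d = "one_perm n mu lam A"
  note d = one_perm[OF mu(1) lam A]
  let ?f = "\<lambda>c. perm_inv ?d (row_tab mu (g, c))"
  have dg: "fibre n (s \<circ> ?d) g = ?f ` {1..mu g}"
  proof -
    have "fibre n (s \<circ> ?d) g = perm_inv ?d ` fibre n s g"
    proof (intro subset_antisym subsetI)
      fix k assume "k \<in> fibre n (s \<circ> ?d) g"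
      then have "?d k \<in> fibre n s g" using permutes_in_image[OF d(1)] by (simp add: fibre_def)
      then show "k \<in> perm_inv ?d ` fibre n s g"
        using permutes_inverses(2)[OF d(1), of k] by (intro image_eqI[of _ _ "?d k"]) simp_all
    next
      fix k assume "k \<in> perm_inv ?d ` fibre n s g"
      then show "k \<in> fibre n (s \<circ> ?d) g"
        using permutes_in_image[OF permutes_inv[OF d(1)]] permutes_inverses(1)[OF d(1)]
        by (auto simp: fibre_def)
    qed
    then show ?thesis by (simp add: fibre_row_function_image[OF mu] image_image)
  qed
  have inj: "inj_on ?f {1..mu g}"
    using comp_inj_on[OF inj_row_tab_row permutes_inj_on[OF permutes_inv[OF d(1)]]]
    by (simp only: comp_def)
  have "content r (fibre n (s \<circ> ?d) g) = image_mset r (image_mset ?f (mset_set {1..mu g}))"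
    unfolding dg by (simp only: image_mset_mset_set[OF inj])
  also have "\<dots> = image_mset (\<lambda>c. r (?f c)) (mset_set {1..mu g})" by (simp add: multiset.map_comp comp_def)
  also have "\<dots> = image_mset (\<lambda>c. A (g, c)) (mset_set {1..mu g})"
  proof (rule image_mset_cong)
    fix c assume "c \<in># mset_set {1..mu g}"
    then have "(g, c) \<in> diagram mu" using mu(1) by (auto simp: diagram_def composition_of_def intro!: Suc_leI Nat.gr0I)
    then show "r (?f c) = A (g, c)" by (rule d(2))
  qed
  finally show ?thesis by (simp add: row_entries_def)
qed

context hecke_algebra
begin

lemma hecke_x_eq:
  assumes "composition_of n lam" "row_function lam r"
  shows "hecke_x n q lam = young_sum r"
proof -
  have "hecke_x n q lam = lincomb (\<lambda>w. of_bool (w \<in> young_subgroup n lam))"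
    unfolding hecke_x_def by (rule lincomb_of_bool) (auto simp: young_subgroup_iff[OF assms])
  also have "\<dots> = young_sum r"
    unfolding young_sum_def by (rule lincomb_cong) (simp only: young_subgroup_iff[OF assms] row_fibre_def simp_thms)
  finally show ?thesis .
qed

lemma hecke_y_eq:
  assumes "composition_of n lam" "row_function lam r"
  shows "hecke_y n q lam = alternating_young_sum r"
proof -
  have "hecke_y n q lam = (\<Oplus>\<^bsub>H\<^esub>w\<in>perms. scal (inverse (- q) ^ inv_count n w * row_fibre r r w) \<otimes>\<^bsub>H\<^esub> Tw w)"
    unfolding hecke_y_def
  proof (rule H.add.finprod_mono_neutral_cong_left)
    show "young_subgroup n lam \<subseteq> perms" by (auto simp: young_subgroup_iff[OF assms])
    fix w assume "w \<in> perms - young_subgroup n lam"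
    then have "\<not> r \<circ> w = r" and w: "w permutes {1..n}"
      using young_subgroup_iff[OF assms, of w] by auto
    then have "row_fibre r r w = (0 :: 'a)" by (simp only: row_fibre_def of_bool_eq)
    with w show "scal (inverse (- q) ^ inv_count n w * row_fibre r r w) \<otimes>\<^bsub>H\<^esub> Tw w = \<zero>\<^bsub>H\<^esub>"
      by (simp add: scal_0)
  next
    fix w assume "w \<in> young_subgroup n lam"
    then have "row_fibre r r w = (1 :: 'a)" "w permutes {1..n}"
      unfolding row_fibre_def young_subgroup_iff[OF assms] by auto
    then show "hecke_smult n q (inverse ((- q) ^ coxeter_length n w)) (Tw w)
      = scal (inverse (- q) ^ inv_count n w * row_fibre r r w) \<otimes>\<^bsub>H\<^esub> Tw w"
      by (simp only: hecke_smult_eq coxeter_length_eq_inv_count power_inverse mult_1_right)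
  qed auto
  then show ?thesis by (simp only: alternating_young_sum_def lincomb_def)
qed

text \<open>The double coset of \<open>1_A\<close>, described by row contents so that neither
  \<open>one_perm\<close> nor factorisations of \<open>w\<close> occur afterwards.\<close>

definition tableau_perms :: "(nat \<Rightarrow> nat) \<Rightarrow> (nat \<Rightarrow> nat) \<Rightarrow> (nat \<Rightarrow> nat) \<Rightarrow> tableau \<Rightarrow> (nat \<Rightarrow> nat) set" where
  "tableau_perms mu s r A =
     {w. w permutes {1..n} \<and> (\<forall>g. content r (fibre n (s \<circ> w) g) = row_entries mu A g)}"

text \<open>The definite description needs existence and uniqueness. With
  \<open>X = h x_\<mu>\<close>, left multiplication by \<open>h\<close> is a candidate; its values
  lie in \<open>M^\<lambda>\<close> because also \<open>X = x_\<lambda> k\<close>. Uniqueness holds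
  since \<open>x_\<mu>\<close> generates \<open>M^\<mu>\<close>.\<close>

lemma tableau_hom_apply:
  assumes mu: "composition_of n mu" "row_function mu s" and lam: "composition_of n lam" "row_function lam r"
    and A: "has_type n mu lam A" and z: "z \<in> carrier H"
  shows "tableau_hom n q mu lam A (young_sum s \<otimes>\<^bsub>H\<^esub> z)
    = lincomb (\<lambda>w. of_bool (w \<in> tableau_perms mu s r A)) \<otimes>\<^bsub>H\<^esub> z"
proof -
  let ?D = "tableau_perms mu s r A"
  define X where "X = lincomb (\<lambda>w. of_bool (w \<in> ?D))"
  have "double_coset n lam (one_perm n mu lam A) mu = ?D"
    unfolding double_coset_eq[OF mu lam one_perm(1)[OF mu(1) lam A]] content_one_perm[OF mu lam A]
      tableau_perms_def by (rule refl)
  then have X: "(\<Oplus>\<^bsub>H\<^esub>w\<in>double_coset n lam (one_perm n mu lam A) mu. Tw w) = X"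
    unfolding X_def by (simp only:) (rule lincomb_of_bool, auto simp: tableau_perms_def)
  have "\<exists>h\<in>carrier H. X = h \<otimes>\<^bsub>H\<^esub> young_sum s"
    unfolding X_def
  proof (rule left_factor[OF row_function_mono_on[OF mu]])
    fix v w assume "v permutes {1..n}" "w permutes {1..n}" "s \<circ> v = s \<circ> w"
    then show "of_bool (v \<in> ?D) = (of_bool (w \<in> ?D) :: 'a)" unfolding tableau_perms_def by simp
  qed
  then obtain h where h: "h \<in> carrier H" "X = h \<otimes>\<^bsub>H\<^esub> young_sum s" by blast
  have "\<exists>k\<in>carrier H. X = young_sum r \<otimes>\<^bsub>H\<^esub> k"
    unfolding X_def
  proof (rule right_factor[OF row_function_mono_on[OF lam]])
    fix v w assume vw: "v permutes {1..n}" "w permutes {1..n}" "r \<circ> perm_inv v = r \<circ> perm_inv w"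
    have c: "content r (fibre n (s \<circ> u) g) = content (r \<circ> perm_inv u) (fibre n s g)"
      if u: "u permutes {1..n}" for u g
    proof -
      have "fibre n (s \<circ> u) g = perm_inv u ` fibre n s g"
      proof (intro subset_antisym subsetI)
        fix k assume "k \<in> fibre n (s \<circ> u) g"
        then have "u k \<in> fibre n s g" using permutes_in_image[OF u] by (simp add: fibre_def)
        then show "k \<in> perm_inv u ` fibre n s g"
          using permutes_inverses(2)[OF u, of k] by (intro image_eqI[of _ _ "u k"]) simp_all
      next
        fix k assume "k \<in> perm_inv u ` fibre n s g"
        then show "k \<in> fibre n (s \<circ> u) g"
          using permutes_in_image[OF permutes_inv[OF u]] permutes_inverses(1)[OF u]
          by (auto simp: fibre_def)
      qed
      then have "content r (fibre n (s \<circ> u) g) = image_mset r (image_mset (perm_inv u) (mset_set (fibre n s g)))"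
        by (simp only: image_mset_mset_set[OF permutes_inj_on[OF permutes_inv[OF u]]])
      then show ?thesis by (simp add: multiset.map_comp)
    qed
    show "of_bool (v \<in> ?D) = (of_bool (w \<in> ?D) :: 'a)"
      unfolding tableau_perms_def mem_Collect_eq c[OF vw(1)] c[OF vw(2)] vw(3)
      by (simp only: vw(1,2))
  qed
  then obtain k where k: "k \<in> carrier H" "X = young_sum r \<otimes>\<^bsub>H\<^esub> k" by blast
  let ?M = "perm_module n q mu" and ?N = "perm_module n q lam"
  have M: "?M = {young_sum s \<otimes>\<^bsub>H\<^esub> x | x. x \<in> carrier H}" and N: "?N = {young_sum r \<otimes>\<^bsub>H\<^esub> x | x. x \<in> carrier H}"
    by (simp_all add: perm_module_def right_ideal_gen_def hecke_x_eq[OF mu] hecke_x_eq[OF lam])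
  have MI: "young_sum s \<otimes>\<^bsub>H\<^esub> x \<in> ?M" if "x \<in> carrier H" for x using that M by blast
  have Mc: "x \<in> carrier H" if "x \<in> ?M" for x using that M by auto
  have gen: "young_sum s \<in> ?M" using MI[of "\<one>\<^bsub>H\<^esub>"] by simp
  let ?P = "\<lambda>f. f \<in> right_module_hom n q ?M ?N \<and> f (hecke_x n q mu) =
      (\<Oplus>\<^bsub>H\<^esub>w\<in>double_coset n lam (one_perm n mu lam A) mu. Tw w)"
  define f where "f = restrict (\<lambda>x. h \<otimes>\<^bsub>H\<^esub> x) ?M"
  have add: "x \<oplus>\<^bsub>H\<^esub> y \<in> ?M" if xy: "x \<in> ?M" "y \<in> ?M" for x y
  proof -
    obtain a b where "a \<in> carrier H" "b \<in> carrier H" "x = young_sum s \<otimes>\<^bsub>H\<^esub> a" "y = young_sum s \<otimes>\<^bsub>H\<^esub> b"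
      using xy unfolding M by blast
    then show ?thesis using MI[of "a \<oplus>\<^bsub>H\<^esub> b"] by (simp add: H.r_distr)
  qed
  have mult: "x \<otimes>\<^bsub>H\<^esub> y \<in> ?M" if xy: "x \<in> ?M" "y \<in> carrier H" for x y
  proof -
    obtain a where "a \<in> carrier H" "x = young_sum s \<otimes>\<^bsub>H\<^esub> a" using xy unfolding M by blast
    then show ?thesis using MI[of "a \<otimes>\<^bsub>H\<^esub> y"] xy(2) by (simp add: H.m_assoc)
  qed
  have "h \<otimes>\<^bsub>H\<^esub> x \<in> ?N" if x: "x \<in> ?M" for x
  proof -
    obtain a where a: "a \<in> carrier H" "x = young_sum s \<otimes>\<^bsub>H\<^esub> a" using x unfolding M by blast
    have "h \<otimes>\<^bsub>H\<^esub> x = X \<otimes>\<^bsub>H\<^esub> a"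
      unfolding a(2) h(2) by (rule H.m_assoc[symmetric]) (use h(1) a(1) in simp_all)
    also have "\<dots> = young_sum r \<otimes>\<^bsub>H\<^esub> (k \<otimes>\<^bsub>H\<^esub> a)"
      unfolding k(2) by (rule H.m_assoc) (use k(1) a(1) in simp_all)
    finally show ?thesis unfolding N using H.m_closed[OF k(1) a(1)] by blast
  qed
  then have "f \<in> ?M \<rightarrow>\<^sub>E ?N" by (auto simp: f_def)
  moreover have "f (x \<oplus>\<^bsub>H\<^esub> y) = f x \<oplus>\<^bsub>H\<^esub> f y" if "x \<in> ?M" "y \<in> ?M" for x y
    using that add Mc h(1) by (simp add: f_def H.r_distr)
  moreover have "f (x \<otimes>\<^bsub>H\<^esub> y) = f x \<otimes>\<^bsub>H\<^esub> y" if "x \<in> ?M" "y \<in> carrier H" for x y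
    using that mult Mc h(1) by (simp add: f_def H.m_assoc)
  moreover have "f (young_sum s) = X" using gen h by (simp add: f_def)
  ultimately have f: "?P f"
    unfolding X hecke_x_eq[OF mu] right_module_hom_def by blast
  have val: "g (young_sum s \<otimes>\<^bsub>H\<^esub> x) = X \<otimes>\<^bsub>H\<^esub> x" if g: "?P g" and x: "x \<in> carrier H" for g x
  proof -
    have "g (young_sum s \<otimes>\<^bsub>H\<^esub> x) = g (young_sum s) \<otimes>\<^bsub>H\<^esub> x"
      using g gen x unfolding right_module_hom_def by blast
    moreover have "g (young_sum s) = X" using g unfolding X hecke_x_eq[OF mu] by blast
    ultimately show ?thesis by (simp only:)
  qed
  have "g = f" if g: "?P g" for g
  proof (rule extensionalityI[of _ ?M])
    have ext: "f' \<in> extensional ?M" if "?P f'" for f'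
      using that unfolding right_module_hom_def PiE_def by blast
    show "g \<in> extensional ?M" by (rule ext[OF g])
    show "f \<in> extensional ?M" by (rule ext[OF f])
    fix x assume "x \<in> ?M"
    then obtain a where a: "a \<in> carrier H" "x = young_sum s \<otimes>\<^bsub>H\<^esub> a" unfolding M by blast
    show "g x = f x" unfolding a(2) val[OF g a(1)] val[OF f a(1)] by (rule refl)
  qed
  then have "\<exists>!g. ?P g" using f by blast
  from theI'[OF this] have "?P (tableau_hom n q mu lam A)" unfolding tableau_hom_def .
  from val[OF this z] show ?thesis unfolding X_def .
qed

end

section \<open>The relation between tableau homomorphisms\<close>

lemma composition_of_count:
  assumes "0 \<notin># M"
  shows "composition_of (size M) (count M)"
proof -
  have "{i. count M i \<noteq> 0} = set_mset M" by (auto simp: count_eq_zero_iff)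
  then show ?thesis
    using assms by (simp add: composition_of_def size_multiset_overloaded_eq count_eq_zero_iff)
qed

lemma finite_submultisets: "finite {U. U \<subseteq># S}"
proof (rule finite_subset)
  show "{U. U \<subseteq># S} \<subseteq> mset ` {xs. set xs \<subseteq> set_mset S \<and> length xs \<le> size S}"
  proof
    fix U assume U: "U \<in> {U. U \<subseteq># S}"
    obtain xs where xs: "mset xs = U" using ex_mset by blast
    then have "set xs \<subseteq> set_mset S" "length xs \<le> size S"
      using U set_mset_mono[of U S] size_mset_mono[of U S] by (auto simp flip: size_mset)
    then show "U \<in> mset ` {xs. set xs \<subseteq> set_mset S \<and> length xs \<le> size S}" using xs by blast
  qed
qed (rule finite_imageI, rule finite_lists_length_le, simp)

lemma finite_splittings:
  fixes S :: "'b multiset"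
  shows "finite {(U, V). S = U + V \<and> P U V}"
  by (rule finite_subset[of _ "(\<lambda>U. (U, S - U)) ` {U. U \<subseteq># S}"]) (auto simp: finite_submultisets)

text \<open>In the exponent \<open>T_i V_j\<close> with \<open>i < j\<close> the larger index
  belongs to \<open>V\<close>, so \<open>V\<close> is the first argument of the second
  \<open>shuffle_coeff\<close>; the symmetry of binomials adjusts the other factor.\<close>

lemma splitting_coeff_eq:
  fixes q :: "'a::field"
  shows "(\<Prod>i. quantum_binomial q (count R i + count U i) (count R i)
          * quantum_binomial q (count T i + count V i) (count T i))
       * (\<Prod>(i, j). if i < j
            then q ^ (count R j * count U i + count T i * count V j) else 1)
     = shuffle_coeff q R U * shuffle_coeff q V T"
proof -
  let ?M = "R + U + T + V"
  define N where "N = Max (insert 0 (set_mset ?M))"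
  have "count ?M i = 0" if "i > N" for i
  proof -
    have "i \<notin># ?M" using that Max_ge[of "insert 0 (set_mset ?M)" i] unfolding N_def by auto
    then show ?thesis by (simp add: count_eq_zero_iff)
  qed
  then have 0: "count R i = 0" "count U i = 0" "count T i = 0" "count V i = 0" if "i > N" for i
    using that by fastforce+
  have sym: "quantum_binomial q (count T i + count V i) (count T i)
      = quantum_binomial q (count V i + count T i) (count V i)" for i
    by (rule quantum_binomial_symmetric)
  have "(\<Prod>i. quantum_binomial q (count R i + count U i) (count R i)
          * quantum_binomial q (count T i + count V i) (count T i))
      = (\<Prod>i\<le>N. quantum_binomial q (count R i + count U i) (count R i)
          * quantum_binomial q (count T i + count V i) (count T i))"
    by (rule Prod_any_eq_prod_atMost) (simp add: 0)
  moreover have "(\<Prod>(i, j). if i < j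
            then q ^ (count R j * count U i + count T i * count V j) else 1)
      = q ^ (\<Sum>j\<le>N. \<Sum>i<j. count R j * count U i + count T i * count V j)"
    by (rule Prod_any_pairs_eq_power) (simp add: 0)
  moreover have "shuffle_coeff q R U =
      (\<Prod>i\<le>N. quantum_binomial q (count R i + count U i) (count R i))
      * q ^ (\<Sum>j\<le>N. count R j * (\<Sum>i<j. count U i))"
    by (rule shuffle_coeff_eq) (simp_all add: 0)
  moreover have "shuffle_coeff q V T =
      (\<Prod>i\<le>N. quantum_binomial q (count V i + count T i) (count V i))
      * q ^ (\<Sum>j\<le>N. count V j * (\<Sum>i<j. count T i))"
    by (rule shuffle_coeff_eq) (simp_all add: 0)
  ultimately show ?thesis
    by (simp add: prod.distrib sum.distrib power_add sum_distrib_left sym mult.commute mult.left_commute)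
qed

text \<open>Given row contents \<open>C\<close> and \<open>D\<close>, only \<open>U = C - R\<close>
  and \<open>V = D - T\<close> can contribute, and the total content then forces
  \<open>S = U + V\<close>.\<close>

lemma sum_splittings:
  fixes c1 c2 :: "nat multiset \<Rightarrow> nat multiset \<Rightarrow> 'a::comm_semiring_1"
  assumes "R + S + T = C + D" "size C = m"
  shows "(\<Sum>(U, V) | S = U + V \<and> size R + size U = m.
      c1 R U * c2 V T * of_bool (C = R + U \<and> D = T + V))
    = (if R \<subseteq># C then c1 R (C - R) else 0) * (if T \<subseteq># D then c2 (D - T) T else 0)"
proof (cases "R \<subseteq># C \<and> T \<subseteq># D")
  case True
  let ?f = "\<lambda>(U, V). c1 R U * c2 V T * of_bool (C = R + U \<and> D = T + V) :: 'a"
  obtain U V where UV: "C = R + U" "D = T + V" using True by (auto simp: mset_subset_eq_exists_conv)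
  then have "R + S + T = R + (U + V) + T" using assms(1) by (simp add: ac_simps)
  then have S: "S = U + V" by (metis add_left_cancel add_right_cancel)
  have "sum ?f {(U, V). S = U + V \<and> size R + size U = m} = sum ?f {(U, V)}"
    by (rule sum.mono_neutral_right[OF finite_splittings]) (use assms(2) UV S in \<open>auto simp: of_bool_def split: if_splits\<close>)
  then show ?thesis using UV by simp
next
  case False
  have "(\<Sum>(U, V) | S = U + V \<and> size R + size U = m.
      c1 R U * c2 V T * of_bool (C = R + U \<and> D = T + V)) = 0"
    by (rule sum.neutral) (use False in auto)
  then show ?thesis using False by auto
qed

lemma has_type_tableau_of_rows:
  assumes mu: "mu = composition_of_list [m, k]" and sizes: "size P = m" "size Q = k"
  defines "A \<equiv> tableau_of_rows ((\<lambda>_. {#})(1 := P, 2 := Q))"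
  shows "\<And>g. row_entries mu A g = ((\<lambda>_. {#})(1 := P, 2 := Q)) g" and "has_type n mu (count (P + Q)) A"
proof -
  have parts: "mu 1 = m" "mu 2 = k" and other: "g \<noteq> 1 \<Longrightarrow> g \<noteq> 2 \<Longrightarrow> mu g = 0" for g
    by (auto simp: mu composition_of_list_def nth_Cons' split: if_splits)
  show entries: "row_entries mu A g = ((\<lambda>_. {#})(1 := P, 2 := Q)) g" for g
    unfolding A_def by (rule row_entries_tableau_of_rows) (use sizes parts other in auto)
  have cnt: "card {c \<in> {1..mu g}. A (g, c) = i} = count (row_entries mu A g) i" for g i
    unfolding row_entries_def by (subst count_content) auto
  show "has_type n mu (count (P + Q)) A"
    unfolding has_type_def
  proof
    fix i
    let ?f = "\<lambda>g. Pair g ` {c \<in> {1..mu g}. A (g, c) = i}"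
    have "{b \<in> diagram mu. A b = i} = ?f 1 \<union> ?f 2"
    proof -
      have dia: "(g, c) \<in> diagram mu \<longleftrightarrow> (g = 1 \<or> g = 2) \<and> c \<in> {1..mu g}" for g c
      proof (cases "g = 1 \<or> g = 2")
        case False
        then have "mu g = 0" using other by blast
        then show ?thesis using False by (simp add: diagram_def)
      qed (auto simp: diagram_def)
      show ?thesis
      proof (rule Set.set_eqI)
        fix b :: "nat \<times> nat"
        obtain g c where "b = (g, c)" by (cases b)
        then show "b \<in> {b \<in> diagram mu. A b = i} \<longleftrightarrow> b \<in> ?f 1 \<union> ?f 2"
          by (simp only: mem_Collect_eq dia Un_iff image_iff prod.inject bex_simps) blast
      qed
    qed
    then have "card {b \<in> diagram mu. A b = i} = card (?f 1) + card (?f 2)"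
      by (simp add: card_Un_disjoint disjoint_iff image_iff)
    also have "\<dots> = count (row_entries mu A 1) i + count (row_entries mu A 2) i"
    proof -
      have "card (Pair g ` X) = card X" for g :: nat and X :: "nat set"
        by (rule card_image) (auto simp: inj_on_def)
      then show ?thesis unfolding cnt[symmetric] by (simp only:)
    qed
    also have "\<dots> = count (P + Q) i" by (simp add: entries)
    finally show "card {b \<in> diagram mu. A b = i} = count (P + Q) i" .
  qed
qed

text \<open>Taking the merged blocks themselves as row function of \<open>\<mu>\<close> makes
  \<open>x_\<mu>\<close> directly comparable with \<open>x_\<rho>\<close> and
  \<open>x_\<nu>\<close>.\<close>

lemma row_function_two_rows:
  assumes "mu = composition_of_list [m, k]" "a \<le> m" "m \<le> b"
  shows "row_function mu (merge_outer \<circ> four_blocks a m b)"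
  unfolding row_function_def
proof
  fix x assume x: "x \<in> diagram mu"
  obtain g c where gc: "x = (g, c)" by (cases x)
  have mu: "mu 1 = m" "mu 2 = k" "mu g \<noteq> 0 \<Longrightarrow> g = 1 \<or> g = 2"
    by (auto simp: assms(1) composition_of_list_def split: if_splits)
  have "mu g \<noteq> 0" "1 \<le> c" "c \<le> mu g" using x gc by (auto simp: diagram_def)
  then consider "g = 1" "1 \<le> c" "c \<le> m" | "g = 2" "1 \<le> c" using mu by blast
  then show "(merge_outer \<circ> four_blocks a m b) (row_tab mu x) = fst x"
  proof cases
    case 1
    then have "row_tab mu x = c" by (simp add: gc row_tab_def)
    then show ?thesis using 1 gc by (simp add: merge_outer_def four_blocks_def)
  next
    case 2
    have "{1..<2} = {1 :: nat}" by auto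
    then have "row_tab mu x = m + c" using 2 mu(1) by (simp add: gc row_tab_def)
    then show ?thesis using 2 gc assms(2) by (simp add: merge_outer_def four_blocks_def)
  qed
qed

lemma conjugate_two_rows_le: "conjugate (composition_of_list [m, k]) j \<le> 2"
proof -
  have "j \<noteq> 0 \<Longrightarrow> {i. 1 \<le> i \<and> j \<le> composition_of_list [m, k] i} \<subseteq> {1, 2}"
    by (auto simp: composition_of_list_def split: if_splits)
  then have "j \<noteq> 0 \<Longrightarrow> card {i. 1 \<le> i \<and> j \<le> composition_of_list [m, k] i} \<le> card {1, 2 :: nat}"
    by (intro card_mono) auto
  moreover have "card {1, 2 :: nat} = 2" by simp
  ultimately show ?thesis by (cases "j = 0") (simp_all only: conjugate_def if_True if_False not_False_eq_True, simp)
qed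

lemma content_row_function:
  assumes "composition_of n (count M)" "row_function (count M) r"
  shows "content r {1..n} = M"
proof (rule multiset_eqI)
  fix i
  have "{k \<in> {1..n}. r k = i} = fibre n r i" by (simp add: fibre_def)
  then show "count (content r {1..n}) i = count M i"
    by (simp only: count_content finite_atLeastAtMost card_fibre_row_function[OF assms])
qed

context hecke_algebra
begin

text \<open>For each \<open>w\<close>, both coefficients depend only on the contents
  \<open>C\<close>, \<open>D\<close> that \<open>w\<close> gives to the rows of
  \<open>\<mu>\<close>. \<open>sum_splittings\<close> evaluates the tableau side and
  \<open>sum_refined_rows\<close> the composite, with the same product of two shuffle
  coefficients.\<close>

lemma hecke_relation_factors:
  fixes m :: nat and R S R' :: "nat multiset"
  assumes mu: "mu = composition_of_list [m, n - m]" "composition_of n mu"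
    and nz: "0 \<notin># R + S + R'" and n: "size R + size S + size R' = n"
    and ord: "size R \<le> m" "m \<le> size R + size S"
  defines "A \<equiv> \<lambda>U V. tableau_of_rows ((\<lambda>_. {#})(1 := R + U, 2 := R' + V))"
    and "s \<equiv> merge_outer \<circ> four_blocks (size R) m (size R + size S)"
    and "r \<equiv> row_of (count (R + S + R'))"
  shows "\<exists>h\<in>carrier H. \<exists>g\<in>carrier H.
    lincomb (\<lambda>w. \<Sum>(U, V) | S = U + V \<and> size R + size U = m.
      shuffle_coeff q R U * shuffle_coeff q V R' * of_bool (w \<in> tableau_perms mu s r (A U V)))
    = h \<otimes>\<^bsub>H\<^esub> young_sum (merge_middle \<circ> four_blocks (size R) m (size R + size S)) \<otimes>\<^bsub>H\<^esub> g"
proof -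
  let ?a = "size R" and ?b = "size R + size S"
  let ?M = "R + S + R'"
  have lam: "composition_of n (count ?M)" using composition_of_count[OF nz] n by simp
  have rf: "row_function (count ?M) r" unfolding r_def by (rule row_function_row_of)
  have sf: "row_function mu s" unfolding s_def by (rule row_function_two_rows[OF mu(1) ord])
  have mono: "mono_on {1..n} r" by (rule row_function_mono_on[OF lam rf])
  have bn: "?b \<le> n" "size R' = n - ?b" using n by auto
  have "(\<Sum>(U, V) | S = U + V \<and> size R + size U = m.
      shuffle_coeff q R U * shuffle_coeff q V R' * of_bool (w \<in> tableau_perms mu s r (A U V)))
    = (\<Sum>f\<in>refined_rows ?a m ?b r R R'. q ^ block_descents n f * of_bool (merge_outer \<circ> f = s \<circ> w))"
    if w: "w permutes {1..n}" for w
  proof -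
    define C where "C = content r (fibre n (s \<circ> w) 1)"
    define D where "D = content r (fibre n (s \<circ> w) 2)"
    have s12: "(s \<circ> w) k = 1 \<or> (s \<circ> w) k = 2" for k by (simp add: s_def merge_outer_def)
    have "fibre n (s \<circ> w) 1 \<union> fibre n (s \<circ> w) 2 = {1..n}"
      "fibre n (s \<circ> w) 1 \<inter> fibre n (s \<circ> w) 2 = {}"
      using s12 unfolding fibre_def by auto
    then have "C + D = content r {1..n}"
      unfolding C_def D_def by (metis content_Un_disjoint finite_fibre)
    then have CD: "?M = C + D" by (simp only: content_row_function[OF lam rf])
    have mu1: "mu 1 = m" by (simp add: mu(1) composition_of_list_def)
    have "size C = card (fibre n s 1)" unfolding C_def by (simp only: size_image_mset size_mset_set card_fibre_comp[OF w])
    then have sC: "size C = m" by (simp only: card_fibre_row_function[OF mu(2) sf] mu1)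
    have mem: "w \<in> tableau_perms mu s r (A U V) \<longleftrightarrow> C = R + U \<and> D = R' + V"
      if "S = U + V" "size R + size U = m" for U V
    proof -
      have sizes: "size (R + U) = m" "size (R' + V) = n - m" using that n by auto
      have e: "row_entries mu (A U V) g = ((\<lambda>_. {#})(1 := R + U, 2 := R' + V)) g" for g
        unfolding A_def by (rule has_type_tableau_of_rows(1)[OF mu(1) sizes])
      have "fibre n (s \<circ> w) g = {}" if "g \<noteq> 1" "g \<noteq> 2" for g
        using s12 that unfolding fibre_def by auto
      then have "content r (fibre n (s \<circ> w) g) = {#}" if "g \<noteq> 1" "g \<noteq> 2" for g
        using that by simp
      then show ?thesis unfolding tableau_perms_def e C_def D_def using w by auto
    qed
    have "(\<Sum>(U, V) | S = U + V \<and> size R + size U = m.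
        shuffle_coeff q R U * shuffle_coeff q V R' * of_bool (w \<in> tableau_perms mu s r (A U V)))
      = (\<Sum>(U, V) | S = U + V \<and> size R + size U = m.
        shuffle_coeff q R U * shuffle_coeff q V R' * of_bool (C = R + U \<and> D = R' + V))"
      by (rule sum.cong[OF refl]) (use mem in auto)
    also have "\<dots> = (if R \<subseteq># C then shuffle_coeff q R (C - R) else 0)
        * (if R' \<subseteq># D then shuffle_coeff q (D - R') R' else 0)"
      by (rule sum_splittings[OF CD sC])
    also have "\<dots> = (\<Sum>f\<in>refined_rows ?a m ?b r R R'.
        q ^ block_descents n f * of_bool (merge_outer \<circ> f = s \<circ> w))"
      unfolding C_def D_def s_def
      by (rule sum_refined_rows[OF ord bn(1) mono w refl bn(2), symmetric])
    finally show ?thesis .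
  qed
  then have "lincomb (\<lambda>w. \<Sum>(U, V) | S = U + V \<and> size R + size U = m.
      shuffle_coeff q R U * shuffle_coeff q V R' * of_bool (w \<in> tableau_perms mu s r (A U V)))
    = lincomb (\<lambda>w. \<Sum>f\<in>refined_rows ?a m ?b r R R'. q ^ block_descents n f * of_bool (merge_outer \<circ> f = s \<circ> w))"
    by (rule lincomb_cong)
  then show ?thesis using refined_sum_factors[OF ord, of r R R'] unfolding s_def by simp
qed

lemma young_sum_alternating_conjugate_zero:
  assumes q: "q \<noteq> 0" and mu: "mu = composition_of_list [m, n - m]" "partition_of n mu"
    and ord: "a \<le> m" "m \<le> b" "b \<le> n" and big: "m < b - a" and h: "h \<in> carrier H"
  shows "young_sum (merge_middle \<circ> four_blocks a m b) \<otimes>\<^bsub>H\<^esub>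
    (h \<otimes>\<^bsub>H\<^esub> alternating_young_sum (row_of (conjugate mu))) = \<zero>\<^bsub>H\<^esub>"
proof (rule young_sum_alternating_zero[OF q _ _ _ _ h, where v = 2])
  let ?r = "row_of (conjugate mu)"
  note comp = composition_conjugate[OF mu(2)]
  note rf = row_function_row_of[of "conjugate mu"]
  show mono: "mono_on {1..n} ?r" by (rule row_function_mono_on[OF comp rf])
  have "mono merge_middle" by (auto simp: mono_def merge_middle_def)
  then show "mono_on {1..n} (merge_middle \<circ> four_blocks a m b)"
    by (intro mono_onI) (simp add: monoD monoD[OF mono_four_blocks[OF ord(1,2)]])
  show "?r k \<noteq> ?r (k + 2)" if k: "1 \<le> k" "k + 2 \<le> n" for k
  proof
    assume eq: "?r k = ?r (k + 2)"
    have "?r k \<le> ?r (k + 1)" "?r (k + 1) \<le> ?r (k + 2)" using k by (auto intro!: mono_onD[OF mono])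
    then have "{k, k + 1, k + 2} \<subseteq> fibre n ?r (?r k)" using eq k by (auto simp: fibre_def)
    then have "card {k, k + 1, k + 2} \<le> card (fibre n ?r (?r k))" by (intro card_mono) auto
    also have "\<dots> \<le> 2"
      unfolding card_fibre_row_function[OF comp rf] using conjugate_two_rows_le mu(1) by simp
    finally show False by simp
  qed
  have "?r ` {1..n} \<subseteq> {1..m}"
  proof clarify
    fix k assume k: "k \<in> {1..n}"
    obtain x where x: "x \<in> diagram (conjugate mu)" "k = row_tab (conjugate mu) x"
      by (rule row_tab_range[OF comp k])
    obtain c g where cg: "x = (c, g)" by (cases x)
    then have "(g, c) \<in> diagram mu" using x(1) diagram_conjugate[OF mu(2)] by blast
    then have "1 \<le> c" "1 \<le> g" "c \<le> mu g" by (auto simp: diagram_def)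
    moreover have "mu g \<le> mu 1" using mu(2) \<open>1 \<le> g\<close> by (auto simp: partition_of_def)
    moreover have "mu 1 = m" by (simp add: mu(1) composition_of_list_def)
    moreover have "?r k = c" using rf x cg by (simp add: row_function_def)
    ultimately show "?r k \<in> {1..m}" by simp
  qed
  then have "card (?r ` {1..n}) \<le> m" using card_mono[of "{1..m}"] by fastforce
  \<comment> \<open>The fibre over 2 is the middle row of \<open>\<nu>\<close>, whose length
    \<open>b - a\<close> will be \<open>|S|\<close>.\<close>
  moreover have "fibre n (merge_middle \<circ> four_blocks a m b) 2 = {Suc a..b}"
    using ord by (auto simp: fibre_def merge_middle_def four_blocks_def)
  ultimately show "card (?r ` {1..n}) < card (fibre n (merge_middle \<circ> four_blocks a m b) 2)"
    using big by simp
qed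

end

theorem theorem3p1:
  fixes q :: "'a::field"
    and n m :: nat
    and R S T :: "nat multiset"
    and \<mu> lam :: "nat \<Rightarrow> nat"
    and pairs :: "(nat multiset \<times> nat multiset) set"
    and A :: "nat multiset \<Rightarrow> nat multiset \<Rightarrow> tableau"
  assumes "q \<noteq> 0"
    and "\<mu> = composition_of_list [m, n - m]"
    and "partition_of n \<mu>"
    and "0 \<notin># R" and "0 \<notin># S" and "0 \<notin># T"
    and "size R + size S + size T = n"
    and "size S > m"
    and "lam = (\<lambda>i. count R i + count S i + count T i)"
    and "pairs = {(U, V). S = U + V \<and> size R + size U = m}"
    and "A = (\<lambda>U V. tableau_of_rows ((\<lambda>_. {#})(1 := R + U, 2 := T + V)))"
  shows "(\<lambda>v\<in>specht_module n q \<mu>.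
            \<Oplus>\<^bsub>hecke n q\<^esub>UV\<in>pairs. case UV of (U, V) \<Rightarrow>
              hecke_smult n q
                ((\<Prod>i. quantum_binomial q (count R i + count U i) (count R i)
                      * quantum_binomial q (count T i + count V i) (count T i))
                 * (\<Prod>(i, j). if i < j
                      then q ^ (count R j * count U i + count T i * count V j) else 1))
                (specht_hom n q \<mu> lam (A U V) v))
         = (\<lambda>v\<in>specht_module n q \<mu>. \<zero>\<^bsub>hecke n q\<^esub>)"
proof (rule restrict_ext)
  interpret hecke_algebra n q .
  fix v assume v: "v \<in> specht_module n q \<mu>"
  let ?coeff = "\<lambda>U V. (\<Prod>i. quantum_binomial q (count R i + count U i) (count R i)
                      * quantum_binomial q (count T i + count V i) (count T i))
                 * (\<Prod>(i, j). if i < j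
                      then q ^ (count R j * count U i + count T i * count V j) else 1)"
  let ?K = "\<lambda>U V. shuffle_coeff q R U * shuffle_coeff q V T"
  let ?G = "\<lambda>UV. case UV of (U, V) \<Rightarrow> hecke_smult n q (?coeff U V) (specht_hom n q \<mu> lam (A U V) v)"
  let ?a = "size R" and ?b = "size R + size S"
  show "(\<Oplus>\<^bsub>hecke n q\<^esub>UV\<in>pairs. ?G UV) = \<zero>\<^bsub>hecke n q\<^esub>"
  proof (cases "size R \<le> m")
    case False
    \<comment> \<open>The size condition is additive, so for \<open>|R| > m\<close> no truncated
      difference intervenes and the sum is empty.\<close>
    then have "pairs = {}" unfolding assms(10) by auto
    then show ?thesis by simp
  next
    case True
    have ord: "?a \<le> m" "m \<le> ?b" "?b \<le> n" using True assms(7,8) by auto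
    have comp: "composition_of n \<mu>" using assms(3) by (simp add: partition_of_def)
    have nz: "0 \<notin># R + S + T" using assms(4-6) by simp
    have lam: "lam = count (R + S + T)" by (simp add: assms(9) fun_eq_iff)
    have clam: "composition_of n lam" using composition_of_count[OF nz] assms(7) by (simp add: lam)
    define s where "s = merge_outer \<circ> four_blocks ?a m ?b"
    define r where "r = row_of (count (R + S + T))"
    define y where "y = alternating_young_sum (row_of (conjugate \<mu>))"
    have sf: "row_function \<mu> s" unfolding s_def by (rule row_function_two_rows[OF assms(2) ord(1,2)])
    have rf: "row_function lam r" unfolding r_def lam by (rule row_function_row_of)
    have fin: "finite pairs" unfolding assms(10) by (rule finite_splittings)
    have y: "y \<in> carrier (hecke n q)" "hecke_y n q (conjugate \<mu>) = y"
      unfolding y_def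
      by (rule alternating_young_sum_closed, rule hecke_y_eq[OF composition_conjugate[OF assms(3)] row_function_row_of])
    define t where "t = hecke_T n q (w_perm n \<mu>)"
    have t: "t \<in> carrier (hecke n q)" unfolding t_def by (rule Tw_closed[OF w_perm_permutes[OF assms(3)]])
    obtain h where h: "h \<in> carrier (hecke n q)"
      "v = young_sum s \<otimes>\<^bsub>hecke n q\<^esub> t \<otimes>\<^bsub>hecke n q\<^esub> y \<otimes>\<^bsub>hecke n q\<^esub> h"
      using v unfolding specht_module_def right_ideal_gen_def hecke_x_eq[OF comp sf] y(2) t_def by blast
    \<comment> \<open>Everything to the right of \<open>x_\<mu>\<close> is collected in
      \<open>z\<close>, because \<open>tableau_hom_apply\<close> evaluates on products
      \<open>x_\<mu> z\<close>.\<close>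
    define z where "z = t \<otimes>\<^bsub>hecke n q\<^esub> y \<otimes>\<^bsub>hecke n q\<^esub> h"
    have z: "z \<in> carrier (hecke n q)" using t y(1) h(1) by (simp add: z_def)
    have vz: "v = young_sum s \<otimes>\<^bsub>hecke n q\<^esub> z" using h t y(1) by (simp add: z_def H.m_assoc)
    let ?D = "\<lambda>U V w. of_bool (w \<in> tableau_perms \<mu> s r (A U V)) :: 'a"
    have summand: "?G (U, V) = lincomb (\<lambda>w. ?K U V * ?D U V w) \<otimes>\<^bsub>hecke n q\<^esub> z" if UV: "(U, V) \<in> pairs" for U V
    proof -
      have S: "S = U + V" "size R + size U = m" using UV unfolding assms(10) by auto
      then have sizes: "size (R + U) = m" "size (T + V) = n - m" using assms(7) by auto
      have "lam = count ((R + U) + (T + V))" unfolding lam S(1) by (simp add: fun_eq_iff)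
      then have ty: "has_type n \<mu> lam (A U V)"
        using has_type_tableau_of_rows(2)[OF assms(2) sizes, of n] unfolding assms(11) by simp
      have "specht_hom n q \<mu> lam (A U V) v = lincomb (?D U V) \<otimes>\<^bsub>hecke n q\<^esub> z"
        using tableau_hom_apply[OF comp sf clam rf ty z] v unfolding specht_hom_def vz by simp
      then have "?G (U, V) = scal (?K U V) \<otimes>\<^bsub>hecke n q\<^esub> (lincomb (?D U V) \<otimes>\<^bsub>hecke n q\<^esub> z)"
        by (simp only: prod.case hecke_smult_eq splitting_coeff_eq)
      also have "\<dots> = lincomb (\<lambda>w. ?K U V * ?D U V w) \<otimes>\<^bsub>hecke n q\<^esub> z"
        unfolding lincomb_smult by (rule H.m_assoc[symmetric]) (use z in simp_all)
      finally show ?thesis .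
    qed
    let ?L = "\<lambda>UV. lincomb (\<lambda>w. case UV of (U, V) \<Rightarrow> ?K U V * ?D U V w)"
    have "(\<Oplus>\<^bsub>hecke n q\<^esub>UV\<in>pairs. ?G UV) = (\<Oplus>\<^bsub>hecke n q\<^esub>UV\<in>pairs. ?L UV \<otimes>\<^bsub>hecke n q\<^esub> z)"
    proof (rule H.finsum_cong'[OF refl])
      show "(\<lambda>UV. ?L UV \<otimes>\<^bsub>hecke n q\<^esub> z) \<in> pairs \<rightarrow> carrier (hecke n q)" using z by simp
      fix UV assume "UV \<in> pairs"
      then show "?G UV = ?L UV \<otimes>\<^bsub>hecke n q\<^esub> z" using summand by (cases UV) (simp only: prod.case)
    qed
    also have "\<dots> = (\<Oplus>\<^bsub>hecke n q\<^esub>UV\<in>pairs. ?L UV) \<otimes>\<^bsub>hecke n q\<^esub> z"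
      by (rule H.finsum_ldistr[symmetric, OF fin z]) simp
    also have "(\<Oplus>\<^bsub>hecke n q\<^esub>UV\<in>pairs. ?L UV) = lincomb (\<lambda>w. \<Sum>(U, V)\<in>pairs. ?K U V * ?D U V w)"
      by (rule lincomb_sum[OF fin, symmetric])
    finally have sum: "(\<Oplus>\<^bsub>hecke n q\<^esub>UV\<in>pairs. ?G UV)
      = lincomb (\<lambda>w. \<Sum>(U, V)\<in>pairs. ?K U V * ?D U V w) \<otimes>\<^bsub>hecke n q\<^esub> z" .
    obtain h0 g0 where hg: "h0 \<in> carrier (hecke n q)" "g0 \<in> carrier (hecke n q)"
      "lincomb (\<lambda>w. \<Sum>(U, V)\<in>pairs. ?K U V * ?D U V w)
        = h0 \<otimes>\<^bsub>hecke n q\<^esub> young_sum (merge_middle \<circ> four_blocks ?a m ?b) \<otimes>\<^bsub>hecke n q\<^esub> g0"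
      using hecke_relation_factors[OF assms(2) comp nz assms(7) ord(1,2)]
      unfolding assms(10,11) s_def r_def by blast
    let ?x = "young_sum (merge_middle \<circ> four_blocks ?a m ?b)"
    \<comment> \<open>The product \<open>g0 t\<close> takes the place of the arbitrary element
      between \<open>x_\<nu>\<close> and \<open>y\<close>; the factors \<open>h0\<close> and
      \<open>h\<close> stay outside.\<close>
    have "?x \<otimes>\<^bsub>hecke n q\<^esub> ((g0 \<otimes>\<^bsub>hecke n q\<^esub> t) \<otimes>\<^bsub>hecke n q\<^esub> y) = \<zero>\<^bsub>hecke n q\<^esub>"
      unfolding y_def
      by (rule young_sum_alternating_conjugate_zero[OF assms(1-3) ord])
        (use assms(8) hg(2) t in simp_all)
    moreover have "h0 \<otimes>\<^bsub>hecke n q\<^esub> ?x \<otimes>\<^bsub>hecke n q\<^esub> g0 \<otimes>\<^bsub>hecke n q\<^esub> z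
        = h0 \<otimes>\<^bsub>hecke n q\<^esub> (?x \<otimes>\<^bsub>hecke n q\<^esub> ((g0 \<otimes>\<^bsub>hecke n q\<^esub> t) \<otimes>\<^bsub>hecke n q\<^esub> y)) \<otimes>\<^bsub>hecke n q\<^esub> h"
      using hg(1,2) t y(1) h(1) by (simp add: z_def H.m_assoc)
    ultimately show ?thesis using sum hg h(1) by simp
  qed
qed

end
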